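(* Let $G=SL_4$ and let $H=SL_2$ be embedded in $G$ so that the standard representation of $SL_4$ restricts to the third symmetric power of the standard representation of $SL_2$. Let $\Xi_H^G=\sum_{\lambda\in\Lambda^+}\dim(V_\lambda^H)z^\lambda$, and write $z_1,z_2,z_3$ for the monomials $z^{\omega_1},z^{\omega_2},z^{\omega_3}$. Then $$\Xi_H^G=\frac{P}{U}$$ where $$\begin{aligned} P=\;&1 - z_1^2 z_2 + z_1^4 z_2^2 + z_1^5 z_2 z_3 + z_1 z_2^2 z_3 + z_1^3 z_2^2 z_3 - z_1^7 z_2^2 z_3 - z_1^3 z_2^3 z_3 + z_1^2 z_3^2 \\ &- z_2 z_3^2 + z_1^2 z_2 z_3^2 + 2 z_1^2 z_2^2 z_3^2 - z_1^4 z_2^2 z_3^2 - z_1^6 z_2^2 z_3^2 - z_1^4 z_2^3 z_3^2 + z_1^3 z_3^3 \\ &+ z_1^3 z_2 z_3^3 - z_1^5 z_2 z_3^3 + z_1 z_2^2 z_3^3 + z_1^3 z_2^2 z_3^3 - 3 z_1^5 z_2^2 z_3^3 - z_1 z_2^3 z_3^3 - z_1^3 z_2^3 z_3^3 \\ &- z_1^5 z_2^3 z_3^3 + z_1^7 z_2^3 z_3^3 + z_1^3 z_2^4 z_3^3 + z_1^4 z_2 z_3^4 - z_1^6 z_2 z_3^4 + z_2^2 z_3^4 - z_1^2 z_2^2 z_3^4 \\ &-2 z_1^4 z_2^2 z_3^4 - z_1^6 z_2^2 z_3^4 + z_1^8 z_2^2 z_3^4 - z_1^2 z_2^3 z_3^4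 + z_1^4 z_2^3 z_3^4 + z_1^5 z_3^5 + z_1 z_2 z_3^5 \\ &-z_1^3 z_2 z_3^5 - z_1^5 z_2 z_3^5 - z_1^7 z_2 z_3^5 - 3 z_1^3 z_2^2 z_3^5 + z_1^5 z_2^2 z_3^5 + z_1^7 z_2^2 z_3^5 - z_1^3 z_2^3 z_3^5 \\ &+z_1^5 z_2^3 z_3^5 + z_1^5 z_2^4 z_3^5 - z_1^4 z_2 z_3^6 - z_1^2 z_2^2 z_3^6 - z_1^4 z_2^2 z_3^6 + 2 z_1^6 z_2^2 z_3^6 + z_1^6 z_2^3 z_3^6 \\ &- z_1^8 z_2^3 z_3^6 + z_1^6 z_2^4 z_3^6 - z_1^5 z_2 z_3^7 - z_1 z_2^2 z_3^7 + z_1^5 z_2^2 z_3^7 + z_1^7 z_2^2 z_3^7 + z_1^3 z_2^3 z_3^7 \\ &+ z_1^4 z_2^2 z_3^8 - z_1^6 z_2^3 z_3^8 + z_1^8 z_2^4 z_3^8, \end{aligned}$$ $$U=(1-z_1^4)(1-z_1^3z_3)(1-z_1z_3^3)(1-z_3^4)(1-z_2)(1-z_2^3)(1-z_1^2z_2)(1-z_2z_3^2).$$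
   Context: Over $\mathbb{C}$. $\Lambda^+$ is the monoid of dominant weights of $SL_4$, with fundamental weights $\omega_1,\omega_2,\omega_3$; $V_\lambda$ is the irreducible representation of $SL_4$ of highest weight $\lambda$, and $V_\lambda^H$ is the subspace of $H$-invariant vectors. The identity takes place in the ring of formal power series $\mathbb{Z}[[z_1,z_2,z_3]]$, where $z^{a\omega_1+b\omega_2+c\omega_3}=z_1^az_2^bz_3^c$. *)

theory Defs
  imports "HOL-Analysis.Analysis" "HOL-Computational_Algebra.Polynomial" "HOL-Computational_Algebra.Formal_Power_Series"
begin

definition SL :: "(complex^'n^'n) set" where
  "SL = {g. det g = 1}"

text \<open>Polynomial functions (over the complex numbers) of the matrix entries. The library's
  \<open>polynomial_function\<close> means polynomial in the real and imaginary parts, which would also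
  admit complex conjugation.\<close>

inductive entry_polynomial :: "(complex^'n^'n \<Rightarrow> complex) \<Rightarrow> bool" where
  const: "entry_polynomial (\<lambda>g. c)"
| entry: "entry_polynomial (\<lambda>g. g $ i $ j)"
| add: "entry_polynomial p \<Longrightarrow> entry_polynomial q \<Longrightarrow> entry_polynomial (\<lambda>g. p g + q g)"
| mult: "entry_polynomial p \<Longrightarrow> entry_polynomial q \<Longrightarrow> entry_polynomial (\<lambda>g. p g * q g)"

text \<open>The coordinate ring of the closed subvariety \<open>SL\<close> of matrix space consists of the
  restrictions of polynomial functions.\<close>

definition regular_on_SL :: "(complex^'n^'n \<Rightarrow> complex) \<Rightarrow> bool" where
  "regular_on_SL f \<longleftrightarrow> (\<exists>p. entry_polynomial p \<and> (\<forall>g\<in>SL. f g = p g))"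

text \<open>A finite-dimensional rational representation of \<open>SL\<close> over the complex numbers. The space is
  a subspace \<open>V\<close> of an ambient complex vector space, so that representations of different dimensions
  can be collected in one family. Only the values of \<open>\<rho> g v\<close> for \<open>g \<in> SL\<close> and \<open>v \<in> V\<close>
  are relevant.\<close>

locale SL_rep = vector_space smul
  for smul :: "complex \<Rightarrow> 'v::ab_group_add \<Rightarrow> 'v" +
  fixes V :: "'v set"
    and \<rho> :: "complex^'n^'n \<Rightarrow> 'v \<Rightarrow> 'v"
  assumes subspace_V: "subspace V"
    and finite_dim: "\<exists>B. finite B \<and> V = span B"
    and rep_closed: "g \<in> SL \<Longrightarrow> v \<in> V \<Longrightarrow> \<rho> g v \<in> V"
    and rep_add: "g \<in> SL \<Longrightarrow> v \<in> V \<Longrightarrow> w \<in> V \<Longrightarrow> \<rho> g (v + w) = \<rho> g v + \<rho> g w"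
    and rep_smul: "g \<in> SL \<Longrightarrow> v \<in> V \<Longrightarrow> \<rho> g (smul c v) = smul c (\<rho> g v)"
    and rep_one: "v \<in> V \<Longrightarrow> \<rho> (mat 1) v = v"
    and rep_mult: "g \<in> SL \<Longrightarrow> h \<in> SL \<Longrightarrow> v \<in> V \<Longrightarrow> \<rho> (g ** h) v = \<rho> g (\<rho> h v)"
    and rep_regular: "v \<in> V \<Longrightarrow> Vector_Spaces.linear smul (*) f \<Longrightarrow> regular_on_SL (\<lambda>g. f (\<rho> g v))"
begin

definition irreducible_rep :: bool where
  "irreducible_rep \<longleftrightarrow> V \<noteq> {0} \<and>
     (\<forall>W. subspace W \<and> W \<subseteq> V \<and> (\<forall>g\<in>SL. \<forall>w\<in>W. \<rho> g w \<in> W) \<longrightarrow> W = {0} \<or> W = V)"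

definition invariants :: "(complex^'n^'n) set \<Rightarrow> 'v set" where
  "invariants H = {v \<in> V. \<forall>h\<in>H. \<rho> h v = v}"

end

text \<open>Matrices below are listed by rows. Note that the index type \<open>4\<close> is only compatible with
  \<open>vector\<close> as the list of indices 1, 2, 3, 4; its order is not, since \<open>(4::4) = 0\<close>.\<close>

definition unitriangular4 ::
    "complex \<Rightarrow> complex \<Rightarrow> complex \<Rightarrow> complex \<Rightarrow> complex \<Rightarrow> complex \<Rightarrow> complex^4^4" where
  "unitriangular4 p q r s t u = vector [
     vector [1, p, q, r],
     vector [0, 1, s, t],
     vector [0, 0, 1, u],
     vector [0, 0, 0, 1]]"

definition diagonal4 :: "complex \<Rightarrow> complex \<Rightarrow> complex \<Rightarrow> complex \<Rightarrow> complex^4^4" where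
  "diagonal4 t1 t2 t3 t4 = vector [
     vector [t1, 0, 0, 0],
     vector [0, t2, 0, 0],
     vector [0, 0, t3, 0],
     vector [0, 0, 0, t4]]"

text \<open>The value of the weight \<open>a \<omega>\<^sub>1 + b \<omega>\<^sub>2 + c \<omega>\<^sub>3\<close> on
  \<open>diag(t1, t2, t3, t4)\<close>; the k-th fundamental weight is the product of the first k diagonal
  entries.\<close>

definition weight4 :: "nat \<Rightarrow> nat \<Rightarrow> nat \<Rightarrow> complex \<Rightarrow> complex \<Rightarrow> complex \<Rightarrow> complex" where
  "weight4 a b c t1 t2 t3 = t1 ^ a * (t1 * t2) ^ b * (t1 * t2 * t3) ^ c"

definition has_highest_weight ::
    "(complex \<Rightarrow> 'v::ab_group_add \<Rightarrow> 'v) \<Rightarrow> 'v set \<Rightarrow> (complex^4^4 \<Rightarrow> 'v \<Rightarrow> 'v) \<Rightarrow>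
     nat \<Rightarrow> nat \<Rightarrow> nat \<Rightarrow> bool" where
  "has_highest_weight smul V \<rho> a b c \<longleftrightarrow> (\<exists>v\<in>V. v \<noteq> 0 \<and>
     (\<forall>p q r s t u. \<rho> (unitriangular4 p q r s t u) v = v) \<and>
     (\<forall>t1 t2 t3 t4. t1 * t2 * t3 * t4 = 1 \<longrightarrow>
        \<rho> (diagonal4 t1 t2 t3 t4) v = smul (weight4 a b c t1 t2 t3) v))"

definition irrep4 ::
    "(complex \<Rightarrow> 'v::ab_group_add \<Rightarrow> 'v) \<Rightarrow> 'v set \<Rightarrow> (complex^4^4 \<Rightarrow> 'v \<Rightarrow> 'v) \<Rightarrow>
     nat \<Rightarrow> nat \<Rightarrow> nat \<Rightarrow> bool" where
  "irrep4 smul V \<rho> a b c \<longleftrightarrow>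
     SL_rep smul V \<rho> \<and> SL_rep.irreducible_rep smul V \<rho> \<and> has_highest_weight smul V \<rho> a b c"

text \<open>Third symmetric power of the standard representation of 2-by-2 matrices, in the basis
  \<open>e1^3, e1^2 e2, e1 e2^2, e2^3\<close>. A cubic form in e1, e2 is written as a polynomial in one variable
  by setting e1 = 1, so \<open>A e1\<close> and \<open>A e2\<close> become x and y, and the columns of the matrix are
  the coefficients of the images of the basis vectors.\<close>

definition sym_cube :: "complex^2^2 \<Rightarrow> complex^4^4" where
  "sym_cube A =
     (let x = [:A $ 1 $ 1, A $ 2 $ 1:];
          y = [:A $ 1 $ 2, A $ 2 $ 2:];
          coeffs4 = (\<lambda>f. vector [coeff f 0, coeff f 1, coeff f 2, coeff f 3] :: complex^4)
      in transpose (vector [coeffs4 (x ^ 3), coeffs4 (x ^ 2 * y), coeffs4 (x * y ^ 2), coeffs4 (y ^ 3)]))"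

text \<open>The maps from \<open>SL\<^sub>2\<close> to 4-by-4 matrices through which the standard representation of
  \<open>SL\<^sub>4\<close> restricts to the third symmetric power, up to isomorphism. On \<open>SL\<^sub>2\<close> such a map is automatically
  an injective group homomorphism into \<open>SL\<^sub>4\<close>.\<close>

definition sym_cube_embedding :: "(complex^2^2 \<Rightarrow> complex^4^4) \<Rightarrow> bool" where
  "sym_cube_embedding \<iota> \<longleftrightarrow>
     (\<exists>Q. invertible Q \<and> (\<forall>A\<in>SL. \<iota> A ** Q = Q ** sym_cube A))"

text \<open>Power series in \<open>z1, z2, z3\<close> with integer coefficients as iterated power series: the
  coefficient of \<open>z1^a z2^b z3^c\<close> in \<open>F\<close> is \<open>fps_nth (fps_nth (fps_nth F c) b) a\<close>.\<close>

type_synonym int_fps3 = "int fps fps fps"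

definition z1 :: int_fps3 where "z1 = fps_const (fps_const fps_X)"
definition z2 :: int_fps3 where "z2 = fps_const fps_X"
definition z3 :: int_fps3 where "z3 = fps_X"

definition fps3_of :: "(nat \<Rightarrow> nat \<Rightarrow> nat \<Rightarrow> int) \<Rightarrow> int_fps3" where
  "fps3_of f = Abs_fps (\<lambda>c. Abs_fps (\<lambda>b. Abs_fps (\<lambda>a. f a b c)))"

text \<open>\<open>V a b c\<close>, \<open>\<rho> a b c\<close> is meant to be the representation of highest weight
  \<open>a \<omega>\<^sub>1 + b \<omega>\<^sub>2 + c \<omega>\<^sub>3\<close>.\<close>

definition Xi ::
    "(complex \<Rightarrow> 'v::ab_group_add \<Rightarrow> 'v) \<Rightarrow> (nat \<Rightarrow> nat \<Rightarrow> nat \<Rightarrow> 'v set) \<Rightarrow>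
     (nat \<Rightarrow> nat \<Rightarrow> nat \<Rightarrow> complex^4^4 \<Rightarrow> 'v \<Rightarrow> 'v) \<Rightarrow> (complex^4^4) set \<Rightarrow> int_fps3" where
  "Xi smul V \<rho> H =
     fps3_of (\<lambda>a b c. int (vector_space.dim smul (SL_rep.invariants (V a b c) (\<rho> a b c) H)))"

definition P :: int_fps3 where
  "P =
     1 - z1^2 * z2 + z1^4 * z2^2 + z1^5 * z2 * z3 + z1 * z2^2 * z3 + z1^3 * z2^2 * z3 - z1^7 * z2^2 * z3 - z1^3 * z2^3 * z3 + z1^2 * z3^2
     - z2 * z3^2 + z1^2 * z2 * z3^2 + 2 * z1^2 * z2^2 * z3^2 - z1^4 * z2^2 * z3^2 - z1^6 * z2^2 * z3^2 - z1^4 * z2^3 * z3^2 + z1^3 * z3^3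
     + z1^3 * z2 * z3^3 - z1^5 * z2 * z3^3 + z1 * z2^2 * z3^3 + z1^3 * z2^2 * z3^3 - 3 * z1^5 * z2^2 * z3^3 - z1 * z2^3 * z3^3 - z1^3 * z2^3 * z3^3
     - z1^5 * z2^3 * z3^3 + z1^7 * z2^3 * z3^3 + z1^3 * z2^4 * z3^3 + z1^4 * z2 * z3^4 - z1^6 * z2 * z3^4 + z2^2 * z3^4 - z1^2 * z2^2 * z3^4
     - 2 * z1^4 * z2^2 * z3^4 - z1^6 * z2^2 * z3^4 + z1^8 * z2^2 * z3^4 - z1^2 * z2^3 * z3^4 + z1^4 * z2^3 * z3^4 + z1^5 * z3^5 + z1 * z2 * z3^5
     - z1^3 * z2 * z3^5 - z1^5 * z2 * z3^5 - z1^7 * z2 * z3^5 - 3 * z1^3 * z2^2 * z3^5 + z1^5 * z2^2 * z3^5 + z1^7 * z2^2 * z3^5 - z1^3 * z2^3 * z3^5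
     + z1^5 * z2^3 * z3^5 + z1^5 * z2^4 * z3^5 - z1^4 * z2 * z3^6 - z1^2 * z2^2 * z3^6 - z1^4 * z2^2 * z3^6 + 2 * z1^6 * z2^2 * z3^6 + z1^6 * z2^3 * z3^6
     - z1^8 * z2^3 * z3^6 + z1^6 * z2^4 * z3^6 - z1^5 * z2 * z3^7 - z1 * z2^2 * z3^7 + z1^5 * z2^2 * z3^7 + z1^7 * z2^2 * z3^7 + z1^3 * z2^3 * z3^7
     + z1^4 * z2^2 * z3^8 - z1^6 * z2^3 * z3^8 + z1^8 * z2^4 * z3^8"

definition U :: int_fps3 where
  "U = (1 - z1^4) * (1 - z1^3 * z3) * (1 - z1 * z3^3) * (1 - z3^4) *
     (1 - z2) * (1 - z2^3) * (1 - z1^2 * z2) * (1 - z2 * z3^2)"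

end

theory Submission
  imports Defs "HOL-Computational_Algebra.Formal_Laurent_Series"
begin

text \<open>
  A highest weight representation of \<open>SL\<^sub>4\<close> is spanned by the images of the highest weight vector
  under products of lowering operators of the derived representation, so it has a basis of weight
  vectors. The trace of the Casimir element on a weight space is known, and by the cyclicity of the
  trace it is determined by the weight multiplicities \<open>m\<close>. The resulting recursion says that the product of
  the Weyl denominator with \<open>m\<close> is an eigenvector of \<open>\<mu> \<mapsto> |\<mu>|\<^sup>2\<close>. Being alternating and bounded by
  \<open>\<lambda> + \<rho>\<close>, it is the alternating sum over the orbit of \<open>\<lambda> + \<rho>\<close>, which is Weyl's character formula.

  The subgroup is the principal \<open>SL\<^sub>2\<close>, for which \<open>\<mu>\<close> has weight \<open>3\<mu>\<^sub>1 + \<mu>\<^sub>2 - \<mu>\<^sub>3 - 3\<mu>\<^sub>4\<close>, and the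
  dimension of the invariants is the difference of the multiplicities of the weights 0 and 2. Let \<open>F\<close> be
  the generating function of the restricted characters, a rational function of \<open>z1, z2, z3, q\<close>, and let
  \<open>G\<close> be the generating function of the multiplicities of all irreducible \<open>SL\<^sub>2\<close>-modules, with \<open>q\<close>
  marking their highest weights. Then \<open>(q - 1/q) F(q) = q G(q) - G(1/q) / q\<close>, and this equation
  determines \<open>G\<close>. So a guess for \<open>G\<close> can be verified as an identity of polynomials, and
  its value at \<open>q = 0\<close> is \<open>P / U\<close>.
\<close>

text \<open>A representation is given only as a group action with polynomial matrix coefficients, so
  every fact about Lie algebras has to be extracted from the group. Derivatives along curves give
  the operators of \<open>sl4\<close>. In the other direction, polynomiality along elementary
  matrices, which generate the group, turns stability under these operators into stability under the
  group. In the Casimir relation the traces of \<open>e i j\<close> after \<open>e j i\<close> on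
  weight spaces are unknowns besides the multiplicities \<open>m\<close>. They obey a first-order
  recurrence along root strings. Antisymmetrising over shifts by the permutations of
  \<open>(3, 2, 1, 0)\<close> pairs points of the same string, so the traces telescope away and a
  finite identity in \<open>m\<close> remains. Counting invariants avoids complete reducibility: on
  weight 2, raising after lowering is injective. Finally, up to the factor \<open>U\<close>, the
  series \<open>G\<close> has polynomials in \<open>q\<close> as coefficients. Hence the coefficient
  of \<open>q^2\<close> in \<open>q^2 G(q) - G(1/q)\<close> is \<open>G(0)\<close>, and this single
  coefficient gives the invariants.\<close>

no_notation fps_nth (infixl \<open>$\<close> 75)

subsection \<open>Generation of the special linear group by elementary matrices\<close>

definition elem :: "'n::finite \<Rightarrow> 'n \<Rightarrow> complex \<Rightarrow> complex^'n^'n" where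
  "elem i j s = (\<chi> k l. (if k = l then 1 else 0) + (if k = i \<and> l = j then s else 0))"

lemma elem_mult_nth:
  "(elem i j s ** A) $ k $ l = A $ k $ l + (if k = i then s * A $ j $ l else 0)"
proof -
  have "(elem i j s ** A) $ k $ l = (\<Sum>m\<in>UNIV. (if k = m then A $ m $ l else 0) +
      (if m = j then (if k = i then s * A $ m $ l else 0) else 0))"
    by (auto simp: matrix_matrix_mult_def elem_def algebra_simps intro!: sum.cong)
  then show ?thesis by (simp add: sum.distrib)
qed

lemma elem_0: "elem i j 0 = mat 1"
  by (auto simp: elem_def mat_def vec_eq_iff)

lemma elem_mult_elem:
  assumes "i \<noteq> j"
  shows "elem i j s ** elem i j t = elem i j (s + t)"
  using assms by (auto simp: vec_eq_iff elem_mult_nth) (auto simp: elem_def)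

lemma elem_in_SL:
  assumes "i \<noteq> j"
  shows "elem i j s \<in> SL"
proof -
  have "(\<chi> k. if k = i then row i (mat 1) + s *s row j (mat 1) else row k (mat 1)) = elem i j s"
    by (auto simp: vec_eq_iff row_def mat_def elem_def)
  then show ?thesis
    using det_row_operation[OF assms, of "mat 1" s] by (simp add: SL_def)
qed

lemma SL_mult: "A \<in> SL \<Longrightarrow> B \<in> SL \<Longrightarrow> A ** B \<in> SL"
  by (simp add: SL_def det_mul)

lemma one_in_SL: "mat 1 \<in> SL"
  by (simp add: SL_def)

lemma SL_inverse:
  fixes A :: "complex^'n^'n"
  assumes "A \<in> SL"
  obtains B where "B \<in> SL" "A ** B = mat 1" "B ** A = mat 1"
proof -
  have "invertible A" using assms by (simp add: SL_def invertible_det_nz)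
  then obtain B where B: "A ** B = mat 1" "B ** A = mat 1" by (auto simp: invertible_def)
  have "det A * det B = 1" using B(1) by (metis det_mul det_I)
  then have "B \<in> SL" using assms by (simp add: SL_def)
  with B show ?thesis by (rule that[rotated])
qed

text \<open>Clearing one row of column \<open>k\<close> multiplies by one elementary matrix, so the
  rows in \<open>L\<close> can be treated one at a time without leaving \<open>SL\<close>.\<close>

lemma cleared_in_SL:
  fixes A :: "complex^'n^'n"
  assumes "k \<notin> L" "A \<in> SL"
  shows "(\<chi> i l. A $ i $ l - (if i \<in> L then A $ i $ k / A $ k $ k * A $ k $ l else 0)) \<in> SL" (is "?B L \<in> _")
proof -
  have "finite L" by simp
  then show ?thesis using assms(1)
  proof (induction L)
    case empty
    have "?B {} = A" by (simp add: vec_eq_iff)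
    then show ?case using assms(2) by simp
  next
    case (insert r L)
    then have "?B (insert r L) = elem r k (- (A $ r $ k / A $ k $ k)) ** ?B L"
      by (auto simp: vec_eq_iff elem_mult_nth)
    then show ?case using insert by (auto intro!: SL_mult elem_in_SL)
  qed
qed

text \<open>Gaussian elimination read backwards. Diagonal matrices are not among the generators, so
  a pivot is made 1 with the help of another row, and the last pivot is 1 because of the
  determinant.\<close>

lemma SL_induct [consumes 1, case_names one step]:
  fixes A :: "complex^'n^'n" and P :: "complex^'n^'n \<Rightarrow> bool"
  assumes "A \<in> SL" and one: "P (mat 1)"
    and step: "\<And>i j s A. i \<noteq> j \<Longrightarrow> A \<in> SL \<Longrightarrow> P A \<Longrightarrow> P (elem i j s ** A)"
  shows "P A"
proof -
  \<comment> \<open>Inverses of elementary matrices are elementary, so \<open>P\<close> can also be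
    pulled back along a row operation.\<close>
  have red: "P A" if "i \<noteq> j" "A \<in> SL" "P (elem i j s ** A)" for i j s and A :: "complex^'n^'n"
  proof -
    have "A = elem i j (- s) ** (elem i j s ** A)"
      using that(1) by (simp add: matrix_mul_assoc elem_mult_elem elem_0)
    then show ?thesis
      using step[OF that(1) SL_mult[OF elem_in_SL[OF that(1)] that(2)] that(3), of "- s"] by simp
  qed
  have clear: "P A"
    if "k \<notin> L" "A $ k $ k \<noteq> 0" "A \<in> SL"
      and "P (\<chi> i l. A $ i $ l - (if i \<in> L then A $ i $ k / A $ k $ k * A $ k $ l else 0))"
    for k L and A :: "complex^'n^'n"
  proof -
    have "finite L" by simp
    then show ?thesis using that
    proof (induction L)
      case empty
      then show ?case by (simp add: vec_lambda_unique[THEN iffD2])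
    next
      case (insert r L)
      let ?B = "\<lambda>L. \<chi> i l. A $ i $ l - (if i \<in> L then A $ i $ k / A $ k $ k * A $ k $ l else 0)"
      let ?e = "elem r k (- (A $ r $ k / A $ k $ k))"
      have rk: "r \<noteq> k" using insert by auto
      have "?B (insert r L) = ?e ** ?B L"
        using insert by (auto simp: vec_eq_iff elem_mult_nth)
      moreover have "?B L \<in> SL"
        using insert.prems by (intro cleared_in_SL) auto
      ultimately have "P (?B L)"
        using red[OF rk, of "?B L"] insert.prems by simp
      then show ?case using insert.IH insert.prems by simp
    qed
  qed
  \<comment> \<open>\<open>K\<close> is the set of columns that already agree with the identity; the
    induction enlarges it.\<close>
  have "P A" if "A \<in> SL" "\<And>i j. j \<in> K \<Longrightarrow> A $ i $ j = (if i = j then 1 else 0)"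
    for K and A :: "complex^'n^'n"
    using that
  proof (induction "card (- K)" arbitrary: K A)
    case 0
    then have K: "K = UNIV" by auto
    have "A = mat 1" using 0(3) unfolding K by (simp add: vec_eq_iff mat_def)
    then show ?case using one by simp
  next
    case (Suc n)
    then obtain k where k: "k \<notin> K" by (metis Compl_iff card.empty ex_in_conv nat.distinct(1))
    have card: "card (- insert k K) = n"
      using Suc.hyps(2) k by (simp add: Compl_insert)
    have cleared: "P B" if B: "B \<in> SL" "B $ k $ k \<noteq> 0" "\<And>i j. j \<in> K \<Longrightarrow> B $ i $ j = (if i = j then 1 else 0)"
      and imp: "insert k K = UNIV \<or> B $ k $ k = 1" for B
    proof -
      let ?B = "\<chi> i l. B $ i $ l - (if i \<in> - {k} then B $ i $ k / B $ k $ k * B $ k $ l else 0)"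
      have cols: "?B $ i $ j = (if i = j then 1 else 0)" if "j \<in> K" for i j
        using B(3)[OF that] k that by auto
      have colk: "?B $ i $ k = (if i = k then B $ k $ k else 0)" for i
        using B(2) by simp
      have det: "det ?B = 1"
        using cleared_in_SL[of k "- {k}" B] B(1) by (simp add: SL_def)
      \<comment> \<open>In the last column the cleared matrix is diagonal with all other entries 1,
        so its determinant is the pivot.\<close>
      have Bkk: "B $ k $ k = 1"
      proof (cases "insert k K = UNIV")
        case True
        have off: "?B $ i $ j = 0" if "i \<noteq> j" for i j
        proof (cases "j = k")
          case True
          then show ?thesis using colk[of i] that by simp
        next
          case False
          then have "j \<in> K" using \<open>insert k K = UNIV\<close> by auto
          then show ?thesis using cols[of j i] that by simp
        qed
        have "det ?B = (\<Prod>i\<in>UNIV. ?B $ i $ i)"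
          by (rule det_diagonal) (rule off)
        also have "\<dots> = ?B $ k $ k * (\<Prod>i\<in>UNIV - {k}. ?B $ i $ i)"
          by (rule prod.remove) simp_all
        also have "(\<Prod>i\<in>UNIV - {k}. ?B $ i $ i) = 1"
        proof (rule prod.neutral, rule ballI)
          fix i assume "i \<in> UNIV - {k}"
          then have "i \<in> K" using \<open>insert k K = UNIV\<close> by auto
          then show "?B $ i $ i = 1" using cols[of i i] by simp
        qed
        finally show ?thesis using det colk[of k] by simp
      next
        case False
        then show ?thesis using imp by simp
      qed
      have "P ?B"
      proof (rule Suc.hyps(1)[of "insert k K"])
        show "n = card (- insert k K)" using card ..
        show "?B \<in> SL" using det by (simp add: SL_def)
        fix i j assume "j \<in> insert k K"
        then show "?B $ i $ j = (if i = j then 1 else 0)"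
          using cols[of j i] colk[of i] Bkk by (cases "j = k") simp_all
      qed
      then show "P B" by (intro clear[of k "- {k}" B]) (use B in auto)
    qed
    show ?case
    proof (cases "insert k K = UNIV")
      case True
      have "A $ k $ k \<noteq> 0"
      proof
        assume "A $ k $ k = 0"
        moreover have "A $ k $ j = 0" if "j \<noteq> k" for j
          using True Suc.prems(2)[of j k] that by auto
        ultimately have "A $ k $ j = 0" for j by (cases "j = k") auto
        then have "row k A = 0" by (simp add: row_def vec_eq_iff)
        then have "det A = 0" by (rule det_zero_row)
        then show False using Suc.prems by (simp add: SL_def)
      qed
      then show ?thesis using cleared Suc.prems True by blast
    next
      case False
      then obtain l where l: "l \<notin> K" "l \<noteq> k" by auto
      have main: "P B" if B: "B \<in> SL" "\<And>i j. j \<in> K \<Longrightarrow> B $ i $ j = (if i = j then 1 else 0)"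
        and i: "i \<notin> K" "i \<noteq> k" "B $ i $ k \<noteq> 0" for B i
      proof -
        \<comment> \<open>The multiple of row \<open>i\<close> is chosen to turn the pivot into
          1.\<close>
        let ?e = "elem k i ((1 - B $ k $ k) / B $ i $ k)"
        have "P (?e ** B)"
          by (rule cleared) (use B i k in \<open>auto simp: elem_mult_nth intro!: SL_mult elem_in_SL\<close>)
        then show ?thesis using red[of k i B] i B by auto
      qed
      have "\<exists>i. i \<notin> K \<and> A $ i $ k \<noteq> 0"
      proof (rule ccontr)
        assume *: "\<not> ?thesis"
        \<comment> \<open>If column \<open>k\<close> vanished outside \<open>K\<close>, it would be
          a combination of the unit columns in \<open>K\<close>; \<open>x\<close> is the resulting
          kernel vector.\<close>
        define x where "x = (\<chi> j. if j = k then 1 else if j \<in> K then - A $ j $ k else 0)"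
        have "A *v x = 0"
        proof (simp add: vec_eq_iff, intro allI)
          fix i
          have "(A *v x) $ i = (\<Sum>j\<in>UNIV. (if j = k then A $ i $ k else 0) +
              (if j = i then (if i \<in> K then - A $ i $ k else 0) else 0))"
          proof -
            have "A $ i $ j * x $ j = (if j = k then A $ i $ k else 0) +
                (if j = i then (if i \<in> K then - A $ i $ k else 0) else 0)" for j
              using k Suc.prems(2)[of j i] by (auto simp: x_def)
            then show ?thesis by (simp only: matrix_vector_mult_def vec_lambda_beta)
          qed
          also have "\<dots> = 0" using * by (auto simp: sum.distrib)
          finally show "(A *v x) $ i = 0" .
        qed
        moreover obtain B where "B ** A = mat 1" using SL_inverse[OF Suc.prems(1)] by blast
        ultimately have "x = 0"
          by (metis matrix_vector_mul_assoc matrix_vector_mul_lid matrix_vector_mult_0_right)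
        then have "x $ k = 0" by simp
        then show False by (simp add: x_def)
      qed
      then obtain i where i: "i \<notin> K" "A $ i $ k \<noteq> 0" by blast
      show ?thesis
      proof (cases "i = k")
        case False
        then show ?thesis using main Suc.prems i by blast
      next
        case True
        show ?thesis
        proof (cases "A $ l $ k = 0")
          case False
          then show ?thesis using main Suc.prems l by blast
        next
          case lk: True
          \<comment> \<open>Adding row \<open>k\<close> to row \<open>l\<close> produces the nonzero
            entry outside the pivot row that \<open>main\<close> asks for.\<close>
          have "P (elem l k 1 ** A)"
            by (rule main[of _ l])
              (use Suc.prems l lk k i True in \<open>auto simp: elem_mult_nth intro!: SL_mult elem_in_SL\<close>)
          then show ?thesis using red[OF l(2)] Suc.prems by blast
        qed
      qed
    qed
  qed
  from this[OF assms(1), of "{}"] show ?thesis by simp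
qed

subsection \<open>One-parameter families and the derived representation\<close>

lemma if_one_mult: "(if b then 1 else 0) * x = (if b then x else (0::'a::semiring_1))"
  "x * (if b then 1 else 0) = (if b then x else (0::'a::semiring_1))"
  by simp_all

abbreviation entry_deriv :: "(complex \<Rightarrow> complex^'n^'n) \<Rightarrow> complex^'n^'n \<Rightarrow> bool" where
  "entry_deriv \<gamma> X \<equiv> \<forall>i j. ((\<lambda>t. \<gamma> t $ i $ j) has_field_derivative X $ i $ j) (at 0)"

text \<open>\<open>c i j\<close> is the partial derivative of \<open>p\<close> at \<open>g\<close>.
  It is chosen before the curve, which makes the derivative linear in the velocity \<open>X\<close>;
  linearity of the derived action in the matrix rests on this.\<close>

lemma entry_polynomial_has_derivative:
  assumes "entry_polynomial p"
  shows "\<exists>c. \<forall>\<gamma> X. \<gamma> 0 = g \<longrightarrow>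
    entry_deriv \<gamma> X \<longrightarrow>
    ((\<lambda>t::complex. p (\<gamma> t)) has_field_derivative (\<Sum>i\<in>UNIV. \<Sum>j\<in>UNIV. c i j * X $ i $ j)) (at 0)"
  using assms
proof induction
  case (const c)
  show ?case by (rule exI[of _ "\<lambda>i j. 0"]) simp
next
  case (entry i j)
  have "(\<Sum>k\<in>UNIV. \<Sum>l\<in>UNIV. (if k = i \<and> l = j then 1 else 0) * X $ k $ l) = X $ i $ j" for X :: "complex^'a^'a"
  proof -
    have "(\<Sum>k\<in>UNIV. \<Sum>l\<in>UNIV. (if k = i \<and> l = j then 1 else 0) * X $ k $ l) =
        (\<Sum>k\<in>UNIV. if k = i then \<Sum>l\<in>UNIV. if l = j then X $ k $ l else 0 else 0)"
      by (intro sum.cong refl) (auto simp: if_one_mult)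
    then show ?thesis by simp
  qed
  then show ?case by (intro exI[of _ "\<lambda>k l. if k = i \<and> l = j then 1 else 0"]) simp
next
  case (add p q)
  then obtain c d where c: "\<And>\<gamma> X. \<gamma> 0 = g \<Longrightarrow> entry_deriv \<gamma> X \<Longrightarrow>
      ((\<lambda>t. p (\<gamma> t)) has_field_derivative (\<Sum>i\<in>UNIV. \<Sum>j\<in>UNIV. c i j * X $ i $ j)) (at 0)"
    and d: "\<And>\<gamma> X. \<gamma> 0 = g \<Longrightarrow> entry_deriv \<gamma> X \<Longrightarrow>
      ((\<lambda>t. q (\<gamma> t)) has_field_derivative (\<Sum>i\<in>UNIV. \<Sum>j\<in>UNIV. d i j * X $ i $ j)) (at 0)"
    by blast
  have "((\<lambda>t. p (\<gamma> t) + q (\<gamma> t)) has_field_derivative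
      (\<Sum>i\<in>UNIV. \<Sum>j\<in>UNIV. (c i j + d i j) * X $ i $ j)) (at 0)"
    if "\<gamma> 0 = g" "entry_deriv \<gamma> X" for \<gamma> X
    using DERIV_add[OF c[OF that] d[OF that]] by (simp add: distrib_right sum.distrib)
  then show ?case by (intro exI[of _ "\<lambda>i j. c i j + d i j"]) blast
next
  case (mult p q)
  then obtain c d where c: "\<And>\<gamma> X. \<gamma> 0 = g \<Longrightarrow> entry_deriv \<gamma> X \<Longrightarrow>
      ((\<lambda>t. p (\<gamma> t)) has_field_derivative (\<Sum>i\<in>UNIV. \<Sum>j\<in>UNIV. c i j * X $ i $ j)) (at 0)"
    and d: "\<And>\<gamma> X. \<gamma> 0 = g \<Longrightarrow> entry_deriv \<gamma> X \<Longrightarrow>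
      ((\<lambda>t. q (\<gamma> t)) has_field_derivative (\<Sum>i\<in>UNIV. \<Sum>j\<in>UNIV. d i j * X $ i $ j)) (at 0)"
    by blast
  have "((\<lambda>t. p (\<gamma> t) * q (\<gamma> t)) has_field_derivative
      (\<Sum>i\<in>UNIV. \<Sum>j\<in>UNIV. (c i j * q g + d i j * p g) * X $ i $ j)) (at 0)"
    if "\<gamma> 0 = g" "entry_deriv \<gamma> X" for \<gamma> X
    using DERIV_mult[OF c[OF that] d[OF that]] that(1)
    by (simp add: algebra_simps sum.distrib sum_distrib_left)
  then show ?case by (intro exI[of _ "\<lambda>i j. c i j * q g + d i j * p g"]) blast
qed

lemma entry_polynomial_poly:
  assumes "entry_polynomial p" "\<And>i j. \<exists>q. \<forall>s. \<gamma> s $ i $ j = poly q s"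
  shows "\<exists>q. \<forall>s. p (\<gamma> s) = poly q s"
  using assms(1)
proof induction
  case (const c)
  show ?case by (rule exI[of _ "[:c:]"]) simp
next
  case (entry i j)
  show ?case using assms(2) by blast
next
  case (add p q)
  then show ?case by (metis poly_add)
next
  case (mult p q)
  then show ?case by (metis poly_mult)
qed

section \<open>Matrix units and curves through the identity\<close>

definition munit :: "'n::finite \<Rightarrow> 'n \<Rightarrow> complex^'n^'n" where
  "munit i j = (\<chi> k l. if k = i \<and> l = j then 1 else 0)"

definition mscale :: "complex \<Rightarrow> complex^'n^'n \<Rightarrow> complex^'n::finite^'n" where
  "mscale c X = (\<chi> i j. c * X $ i $ j)"

lemma mscale_nth [simp]: "mscale c X $ i $ j = c * X $ i $ j"
  by (simp add: mscale_def)

lemma munit_nth [simp]: "munit i j $ k $ l = (if k = i \<and> l = j then 1 else 0)"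
  by (simp add: munit_def)

lemma mscale_mult: "mscale k A ** B = mscale k (A ** B)" "A ** mscale k B = mscale k (A ** B)"
  by (simp_all add: vec_eq_iff matrix_matrix_mult_def sum_distrib_left mult_ac)

lemma matrix_diff_distrib:
  fixes A B C :: "complex^'n^'n"
  shows "A ** (B - C) = A ** B - A ** C" "(B - C) ** A = B ** A - C ** A"
  by (simp_all add: vec_eq_iff matrix_matrix_mult_def algebra_simps sum_subtractf)

lemma trace_mscale: "trace (mscale k X) = k * trace X"
  by (simp add: trace_def sum_distrib_left)

text \<open>Arbitrary curves are allowed, not only one-parameter subgroups, so that sums of
  velocities are realised by pointwise products of curves.\<close>

definition tangent :: "(complex \<Rightarrow> complex^'n^'n) \<Rightarrow> complex^'n::finite^'n \<Rightarrow> bool" where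
  "tangent \<gamma> X \<longleftrightarrow> (\<forall>t. \<gamma> t \<in> SL) \<and> \<gamma> 0 = mat 1 \<and>
     entry_deriv \<gamma> X"

lemma tangent_elem:
  assumes "i \<noteq> j"
  shows "tangent (elem i j) (munit i j)"
  unfolding tangent_def
proof (intro conjI allI)
  fix k l
  show "((\<lambda>t. elem i j t $ k $ l) has_field_derivative munit i j $ k $ l) (at 0)"
    by (cases "k = i \<and> l = j") (auto simp: elem_def intro!: derivative_eq_intros)
qed (simp_all add: elem_in_SL[OF assms] elem_0)

lemma tangent_mult:
  assumes "tangent \<gamma> X" "tangent \<delta> Y"
  shows "tangent (\<lambda>t. \<gamma> t ** \<delta> t) (X + Y)"
  unfolding tangent_def
proof (intro conjI allI)
  fix i j
  have "((\<lambda>t. \<Sum>k\<in>UNIV. \<gamma> t $ i $ k * \<delta> t $ k $ j) has_field_derivative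
      (\<Sum>k\<in>UNIV. X $ i $ k * \<delta> 0 $ k $ j + Y $ k $ j * \<gamma> 0 $ i $ k)) (at 0)"
    using assms unfolding tangent_def by (intro DERIV_sum DERIV_mult) auto
  also have "(\<Sum>k\<in>UNIV. X $ i $ k * \<delta> 0 $ k $ j + Y $ k $ j * \<gamma> 0 $ i $ k) = (X + Y) $ i $ j"
    using assms by (simp add: tangent_def mat_def sum.distrib if_one_mult)
  finally show "((\<lambda>t. (\<gamma> t ** \<delta> t) $ i $ j) has_field_derivative (X + Y) $ i $ j) (at 0)"
    by (simp add: matrix_matrix_mult_def)
qed (use assms in \<open>simp_all add: tangent_def SL_mult\<close>)

lemma tangent_scale:
  assumes "tangent \<gamma> X"
  shows "tangent (\<lambda>t. \<gamma> (c * t)) (mscale c X)"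
  unfolding tangent_def
proof (intro conjI allI)
  fix i j
  have "((\<lambda>t. \<gamma> t $ i $ j) has_field_derivative X $ i $ j) (at (c * 0))"
    using assms by (simp add: tangent_def)
  from DERIV_chain2[where f = "\<lambda>t. \<gamma> t $ i $ j" and g = "\<lambda>t. c * t" and x = 0, OF this DERIV_cmult_Id]
  show "((\<lambda>t. \<gamma> (c * t) $ i $ j) has_field_derivative mscale c X $ i $ j) (at 0)"
    by (simp add: mult.commute)
qed (use assms in \<open>simp_all add: tangent_def\<close>)

definition diag2 :: "'n::finite \<Rightarrow> 'n \<Rightarrow> complex \<Rightarrow> complex^'n^'n" where
  "diag2 i k t = (\<chi> m l. if m = l then (if m = i then exp t else if m = k then exp (- t) else 1) else 0)"

lemma tangent_diag2:
  assumes "i \<noteq> k"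
  shows "tangent (diag2 i k) (munit i i - munit k k)"
  unfolding tangent_def
proof (intro conjI allI)
  fix t
  have "det (diag2 i k t) = (\<Prod>m\<in>UNIV. if m = i then exp t else if m = k then exp (- t) else 1)"
    by (subst det_diagonal) (simp_all add: diag2_def)
  also have "\<dots> = exp t * (\<Prod>m\<in>UNIV - {i}. if m = k then exp (- t) else 1)"
    by (subst prod.remove[of _ i]) (auto intro!: prod.cong)
  also have "(\<Prod>m\<in>UNIV - {i}. if m = k then exp (- t) else 1) = exp (- t)"
    using assms by (subst prod.remove[of _ k]) auto
  finally show "diag2 i k t \<in> SL" by (simp add: SL_def exp_minus)
next
  show "diag2 i k 0 = mat 1" by (simp add: diag2_def mat_def vec_eq_iff)
next
  fix m l
  show "((\<lambda>t. diag2 i k t $ m $ l) has_field_derivative (munit i i - munit k k) $ m $ l) (at 0)"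
    by (cases "m = l"; cases "m = i"; cases "m = k")
      (use assms in \<open>auto simp: diag2_def intro!: derivative_eq_intros\<close>)
qed

text \<open>The attainable velocities form a subspace containing the off-diagonal matrix units and
  the differences of diagonal ones, and these span the matrices of trace 0.\<close>

lemma ex_tangent:
  fixes X :: "complex^'n^'n"
  assumes "trace X = 0"
  shows "\<exists>\<gamma>. tangent \<gamma> X"
proof -
  define T where "T = {X :: complex^'n^'n. \<exists>\<gamma>. tangent \<gamma> X}"
  have zero: "0 \<in> T"
    unfolding T_def by (auto intro!: exI[of _ "\<lambda>t. mat 1"] simp: tangent_def one_in_SL)
  have add: "X + Y \<in> T" if "X \<in> T" "Y \<in> T" for X Y
    using that tangent_mult unfolding T_def by blast
  have scale: "mscale c X \<in> T" if "X \<in> T" for c X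
    using that tangent_scale unfolding T_def by blast
  have sum: "sum F A \<in> T" if "finite A" "\<And>x. x \<in> A \<Longrightarrow> F x \<in> T" for F :: "'b \<Rightarrow> complex^'n^'n" and A
    using that by (induction A) (auto intro: zero add)
  obtain k :: 'n where True by simp
  have off: "mscale c (munit i j) \<in> T" if "i \<noteq> j" for c i j
    using scale tangent_elem[OF that] unfolding T_def by blast
  have diag: "mscale c (munit i i - munit k k) \<in> T" for c i
  proof (cases "i = k")
    case True
    then have "mscale c (munit i i - munit k k) = 0" by (simp add: vec_eq_iff)
    then show ?thesis using zero by simp
  next
    case False
    then show ?thesis using scale tangent_diag2[OF False] unfolding T_def by blast
  qed
  \<comment> \<open>Subtracting \<open>munit k k\<close> in the diagonal terms changes the sum by
    \<open>trace X\<close> times this unit, hence by nothing.\<close>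
  let ?S = "\<lambda>i j. if i = j then mscale (X $ i $ i) (munit i i - munit k k) else mscale (X $ i $ j) (munit i j)"
  have "X = (\<Sum>i\<in>UNIV. \<Sum>j\<in>UNIV. ?S i j)"
  proof (simp only: vec_eq_iff, intro allI)
    fix a b
    have inner: "(\<Sum>j\<in>UNIV. ?S i j $ a $ b) = (if i = a then X $ a $ b else 0) -
        (if k = a \<and> k = b then X $ i $ i else 0)" for i
    proof -
      have "(\<Sum>j\<in>UNIV. ?S i j $ a $ b) = (\<Sum>j\<in>UNIV. (if j = b then (if i = a then X $ a $ b else 0) else 0) -
          (if j = i then (if k = a \<and> k = b then X $ i $ i else 0) else 0))"
        by (intro sum.cong refl) auto
      then show ?thesis by (simp add: sum_subtractf)
    qed
    have "(\<Sum>i\<in>UNIV. \<Sum>j\<in>UNIV. ?S i j) $ a $ b = (\<Sum>i\<in>UNIV. \<Sum>j\<in>UNIV. ?S i j $ a $ b)"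
      by simp
    also have "\<dots> = X $ a $ b - (if k = a \<and> k = b then trace X else 0)"
    proof -
      have "(\<Sum>i\<in>UNIV. (if i = a then X $ a $ b else 0) - (if c then X $ i $ i else 0)) =
          X $ a $ b - (if c then trace X else 0)" for c
        by (cases c) (simp_all add: sum_subtractf trace_def)
      then show ?thesis unfolding inner .
    qed
    finally show "X $ a $ b = (\<Sum>i\<in>UNIV. \<Sum>j\<in>UNIV. ?S i j) $ a $ b"
      by (simp add: assms)
  qed
  also have "\<dots> \<in> T" by (intro sum) (simp_all add: off diag)
  finally show ?thesis by (simp add: T_def)
qed

lemma tangent_conj:
  assumes "tangent \<gamma> X" "g \<in> SL" "h \<in> SL" "g ** h = mat 1"
  shows "tangent (\<lambda>t. g ** \<gamma> t ** h) (g ** X ** h)"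
  unfolding tangent_def
proof (intro conjI allI)
  fix i j
  have "((\<lambda>t. \<Sum>l\<in>UNIV. (\<Sum>k\<in>UNIV. g $ i $ k * \<gamma> t $ k $ l) * h $ l $ j) has_field_derivative
      (\<Sum>l\<in>UNIV. (\<Sum>k\<in>UNIV. g $ i $ k * X $ k $ l) * h $ l $ j)) (at 0)"
    using assms(1) unfolding tangent_def by (intro DERIV_sum DERIV_cmult DERIV_cmult_right) auto
  then show "((\<lambda>t. (g ** \<gamma> t ** h) $ i $ j) has_field_derivative (g ** X ** h) $ i $ j) (at 0)"
    by (simp add: matrix_matrix_mult_def)
qed (use assms in \<open>simp_all add: tangent_def SL_mult\<close>)

section \<open>Linear forms and the derived representation\<close>

context SL_rep
begin

definition lin_form :: "('v \<Rightarrow> complex) \<Rightarrow> bool" where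
  "lin_form f \<longleftrightarrow> Vector_Spaces.linear smul (*) f"

lemma lin_form_iff:
  "lin_form f \<longleftrightarrow> (\<forall>x y. f (x + y :: 'v) = f x + f y) \<and> (\<forall>c x. f (smul c x) = c * f x)"
proof -
  have "vector_space ((*) :: complex \<Rightarrow> complex \<Rightarrow> complex)"
    by unfold_locales (simp_all add: algebra_simps)
  then show ?thesis
    unfolding lin_form_def Vector_Spaces.linear_iff using vector_space_axioms by blast
qed

lemma lin_formD:
  assumes "lin_form f"
  shows "f (x + y) = f x + f y" "f (smul c x) = c * f x" "f 0 = 0" "f (x - y) = f x - f y"
    "f (\<Sum>i\<in>A. g i) = (\<Sum>i\<in>A. f (g i))"
proof -
  show add: "f (x + y) = f x + f y" for x y
    using assms by (auto simp: lin_form_iff)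
  show scale: "f (smul c x) = c * f x" for c x
    using assms by (auto simp: lin_form_iff)
  show 0: "f 0 = 0" using scale[of 0 0] by simp
  show "f (x - y) = f x - f y" using add[of "x - y" y] by simp
  show "f (\<Sum>i\<in>A. g i) = (\<Sum>i\<in>A. f (g i))"
    by (induction A rule: infinite_finite_induct) (simp_all add: 0 add)
qed

lemma ex_lin_form_separating:
  assumes "subspace W" "x \<notin> W"
  shows "\<exists>f. lin_form f \<and> (\<forall>w\<in>W. f w = 0) \<and> f x = 1"
proof -
  obtain B where B: "B \<subseteq> W" "independent B" "W \<subseteq> span B"
    by (rule maximal_independent_subset)
  have "span B \<subseteq> W" using B(1) assms(1) by (simp add: span_minimal)
  then have x: "x \<notin> span B" using assms(2) by blast
  then have ind: "independent (insert x B)"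
    using B(2) by (simp add: independent_insert)
  define D where "D = extend_basis (insert x B)"
  have D: "insert x B \<subseteq> D" "independent D" "span D = UNIV"
    unfolding D_def using extend_basis_superset[OF ind] independent_extend_basis[OF ind]
      span_extend_basis[OF ind] by auto
  have "lin_form (\<lambda>v. representation D v x)"
    unfolding lin_form_def by (rule linear_representation[OF D(2,3)])
  moreover have "representation D w x = 0" if "w \<in> W" for w
  proof -
    have "w \<in> span B" using B(3) that by blast
    then have "representation D w = representation B w"
      using D by (intro representation_extend) auto
    moreover have "x \<notin> B" using x span_base by blast
    ultimately show ?thesis using representation_ne_zero[of B w x] by auto
  qed
  moreover have "representation D x x = 1"
    using representation_basis[OF D(2), of x] D(1) by simp
  ultimately show ?thesis by blast
qed

lemma lin_form_eqI:
  assumes "\<And>f. lin_form f \<Longrightarrow> f x = f y"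
  shows "x = y"
proof (rule ccontr)
  assume "x \<noteq> y"
  then have "x - y \<notin> {0}" by simp
  from ex_lin_form_separating[OF subspace_single_0 this]
  obtain f where f: "lin_form f" "f (x - y) = 1" by blast
  then show False using assms[OF f(1)] lin_formD(4)[OF f(1), of x y] by simp
qed

lemma ex_basis: "\<exists>B. finite B \<and> independent B \<and> span B = V"
proof -
  obtain B0 where B0: "finite B0" "V = span B0" using finite_dim by blast
  obtain B where B: "B \<subseteq> B0" "independent B" "B0 \<subseteq> span B"
    by (rule maximal_independent_subset)
  have "span B = V" using B B0 span_mono[of B B0] span_minimal[of B0 "span B"] by auto
  then show ?thesis using B B0 finite_subset by blast
qed

definition basis where "basis = (SOME B. finite B \<and> independent B \<and> span B = V)"

lemma basis: "finite basis" "independent basis" "span basis = V"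
  using someI_ex[OF ex_basis] unfolding basis_def[symmetric] by auto

text \<open>Coordinates are taken in a basis of the whole ambient space, since
  \<open>rep_regular\<close> speaks of linear forms defined everywhere.\<close>

definition coord where "coord b v = representation (extend_basis basis) v b"

lemma lin_form_coord: "lin_form (coord b)"
  unfolding lin_form_def coord_def using basis
  by (intro linear_representation) (simp_all add: independent_extend_basis span_extend_basis)

lemma sum_coord: "v \<in> V \<Longrightarrow> (\<Sum>b\<in>basis. smul (coord b v) b) = v"
proof -
  assume v: "v \<in> V"
  have "representation (extend_basis basis) v = representation basis v"
    using basis v
    by (intro representation_extend) (simp_all add: independent_extend_basis extend_basis_superset)
  then show ?thesis
    unfolding coord_def using sum_representation_eq[of basis v basis] basis v by simp
qed

lemma basis_in_V: "b \<in> basis \<Longrightarrow> b \<in> V"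
  using basis span_base by blast

lemmas V_closed = subspace_0[OF subspace_V] subspace_add[OF subspace_V] subspace_diff[OF subspace_V]
  subspace_scale[OF subspace_V] subspace_sum[OF subspace_V] subspace_neg[OF subspace_V]

text \<open>Maps such as \<open>f (\<rho> g v)\<close> are linear in \<open>v\<close> only on
  \<open>V\<close>; replacing them by forms on the ambient space makes the derivative of the action
  applicable to them.\<close>

lemma ex_lin_form_extending:
  assumes "\<And>v w. v \<in> V \<Longrightarrow> w \<in> V \<Longrightarrow> f (v + w) = f v + f w"
    "\<And>c v. v \<in> V \<Longrightarrow> f (smul c v) = c * f v"
  shows "\<exists>g. lin_form g \<and> (\<forall>v\<in>V. g v = f v)"
proof -
  let ?g = "\<lambda>v. \<Sum>b\<in>basis. coord b v * f b"
  have "lin_form ?g"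
    unfolding lin_form_iff
    by (simp add: lin_formD[OF lin_form_coord] algebra_simps sum.distrib sum_distrib_left)
  moreover have "?g v = f v" if "v \<in> V" for v
  proof -
    have f0: "f 0 = 0" using assms(2)[of 0 0] V_closed(1) by simp
    have sum: "f (\<Sum>b\<in>A. smul (c b) b) = (\<Sum>b\<in>A. c b * f b)" if "finite A" "A \<subseteq> basis" for A c
      using that by (induction A rule: finite_induct) (auto simp: f0 assms basis_in_V V_closed subset_iff)
    show ?thesis using sum[of basis "\<lambda>b. coord b v"] basis sum_coord[OF that] by simp
  qed
  ultimately show ?thesis by blast
qed

text \<open>A weak derivative: it is tested by linear forms, since the abstract space carries no
  topology.\<close>

definition is_lie where
  "is_lie X v w \<longleftrightarrow> w \<in> V \<and> (\<forall>f \<gamma>. lin_form f \<longrightarrow> tangent \<gamma> X \<longrightarrow>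
     ((\<lambda>t. f (\<rho> (\<gamma> t) v)) has_field_derivative f w) (at 0))"

lemma tangent_in_SL: "tangent \<gamma> X \<Longrightarrow> \<gamma> t \<in> SL"
  by (simp add: tangent_def)

text \<open>The vectors \<open>M i j\<close> depend on \<open>v\<close> alone and serve for all
  \<open>X\<close> simultaneously, from which linearity in \<open>X\<close> follows.\<close>

lemma ex_lie:
  assumes "v \<in> V"
  shows "\<exists>M. \<forall>X. is_lie X v (\<Sum>i\<in>UNIV. \<Sum>j\<in>UNIV. smul (X $ i $ j) (M i j))
    \<and> (\<forall>i j. M i j \<in> V)"
proof -
  have ex: "\<exists>c. \<forall>\<gamma> X. tangent \<gamma> X \<longrightarrow> ((\<lambda>t. coord b (\<rho> (\<gamma> t) v)) has_field_derivative
     (\<Sum>i\<in>UNIV. \<Sum>j\<in>UNIV. c i j * X $ i $ j)) (at 0)" for b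
  proof -
    have "regular_on_SL (\<lambda>g. coord b (\<rho> g v))"
      using rep_regular[OF assms lin_form_coord[unfolded lin_form_def]] .
    then obtain p where p: "entry_polynomial p" "\<And>g. g \<in> SL \<Longrightarrow> coord b (\<rho> g v) = p g"
      by (auto simp: regular_on_SL_def)
    obtain c where "\<And>\<gamma> X. \<gamma> 0 = mat 1 \<Longrightarrow>
        entry_deriv \<gamma> X \<Longrightarrow>
        ((\<lambda>t. p (\<gamma> t)) has_field_derivative (\<Sum>i\<in>UNIV. \<Sum>j\<in>UNIV. c i j * X $ i $ j)) (at 0)"
      using entry_polynomial_has_derivative[OF p(1), of "mat 1"] by blast
    then show ?thesis
      unfolding tangent_def by (intro exI[of _ c]) (simp add: p(2))
  qed
  have "\<exists>c. \<forall>b. \<forall>\<gamma> X. tangent \<gamma> X \<longrightarrow> ((\<lambda>t. coord b (\<rho> (\<gamma> t) v)) has_field_derivative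
     (\<Sum>i\<in>UNIV. \<Sum>j\<in>UNIV. c b i j * X $ i $ j)) (at 0)"
    by (rule choice, rule allI, rule ex)
  then obtain c where c: "\<And>b \<gamma> X. tangent \<gamma> X \<Longrightarrow> ((\<lambda>t. coord b (\<rho> (\<gamma> t) v)) has_field_derivative
     (\<Sum>i\<in>UNIV. \<Sum>j\<in>UNIV. c b i j * X $ i $ j)) (at 0)" by blast
  define M where "M i j = (\<Sum>b\<in>basis. smul (c b i j) b)" for i j
  have M: "M i j \<in> V" for i j
    unfolding M_def by (intro V_closed) (simp add: basis_in_V)
  have "is_lie X v (\<Sum>i\<in>UNIV. \<Sum>j\<in>UNIV. smul (X $ i $ j) (M i j))" for X
    unfolding is_lie_def
  proof (intro conjI allI impI)
    show "(\<Sum>i\<in>UNIV. \<Sum>j\<in>UNIV. smul (X $ i $ j) (M i j)) \<in> V"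
      by (intro V_closed M)
  next
    fix f \<gamma> assume f: "lin_form f" and \<gamma>: "tangent \<gamma> X"
    note f' = lin_formD[OF f]
    have "((\<lambda>t. \<Sum>b\<in>basis. coord b (\<rho> (\<gamma> t) v) * f b) has_field_derivative
        (\<Sum>b\<in>basis. (\<Sum>i\<in>UNIV. \<Sum>j\<in>UNIV. c b i j * X $ i $ j) * f b)) (at 0)"
      by (intro DERIV_sum DERIV_cmult_right c \<gamma>)
    also have "(\<lambda>t. \<Sum>b\<in>basis. coord b (\<rho> (\<gamma> t) v) * f b) = (\<lambda>t. f (\<rho> (\<gamma> t) v))"
    proof
      fix t
      have "\<rho> (\<gamma> t) v \<in> V" using rep_closed[OF tangent_in_SL[OF \<gamma>] assms] .
      from arg_cong[OF sum_coord[OF this], of f]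
      show "(\<Sum>b\<in>basis. coord b (\<rho> (\<gamma> t) v) * f b) = f (\<rho> (\<gamma> t) v)"
        by (simp add: f')
    qed
    also have "(\<Sum>b\<in>basis. (\<Sum>i\<in>UNIV. \<Sum>j\<in>UNIV. c b i j * X $ i $ j) * f b) =
        f (\<Sum>i\<in>UNIV. \<Sum>j\<in>UNIV. smul (X $ i $ j) (M i j))"
    proof -
      have "(\<Sum>b\<in>basis. (\<Sum>i\<in>UNIV. \<Sum>j\<in>UNIV. c b i j * X $ i $ j) * f b) =
          (\<Sum>i\<in>UNIV. \<Sum>b\<in>basis. \<Sum>j\<in>UNIV. c b i j * X $ i $ j * f b)"
        unfolding sum_distrib_right by (rule sum.swap)
      also have "\<dots> = (\<Sum>i\<in>UNIV. \<Sum>j\<in>UNIV. \<Sum>b\<in>basis. c b i j * X $ i $ j * f b)"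
        by (intro sum.cong refl sum.swap)
      finally show ?thesis
        by (simp add: M_def f' sum_distrib_left mult_ac)
    qed
    finally show "((\<lambda>t. f (\<rho> (\<gamma> t) v)) has_field_derivative
        f (\<Sum>i\<in>UNIV. \<Sum>j\<in>UNIV. smul (X $ i $ j) (M i j))) (at 0)" .
  qed
  with M show ?thesis by blast
qed

text \<open>For \<open>trace X = 0\<close> the value is unique. For other matrices \<open>SL\<close>
  has no tangent curve with velocity \<open>X\<close>, and the choice is arbitrary.\<close>

definition lie where "lie X v = (SOME w. is_lie X v w)"

lemma is_lie_unique:
  assumes "trace X = 0" "is_lie X v w" "is_lie X v w'"
  shows "w = w'"
proof (rule lin_form_eqI)
  fix f assume f: "lin_form f"
  obtain \<gamma> where "tangent \<gamma> X" using ex_tangent[OF assms(1)] by blast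
  then show "f w = f w'"
    using assms(2,3) f unfolding is_lie_def by (metis DERIV_unique)
qed

lemma is_lie_lie: "v \<in> V \<Longrightarrow> is_lie X v (lie X v)"
  unfolding lie_def using ex_lie by (metis someI_ex)

lemma lie_eqI:
  assumes "trace X = 0" "v \<in> V" "is_lie X v w"
  shows "lie X v = w"
  using is_lie_unique[OF assms(1) is_lie_lie[OF assms(2)] assms(3)] .

lemma lie_in_V: "v \<in> V \<Longrightarrow> lie X v \<in> V"
  using is_lie_lie unfolding is_lie_def by blast

lemma lie_derivative:
  assumes "v \<in> V" "tangent \<gamma> X" "lin_form f"
  shows "((\<lambda>t. f (\<rho> (\<gamma> t) v)) has_field_derivative f (lie X v)) (at 0)"
  using is_lie_lie[OF assms(1)] assms(2,3) unfolding is_lie_def by blast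

lemma lie_eqI_curve:
  assumes "tangent \<gamma> X" "v \<in> V" "w \<in> V"
    and "\<And>f. lin_form f \<Longrightarrow> ((\<lambda>t. f (\<rho> (\<gamma> t) v)) has_field_derivative f w) (at 0)"
  shows "lie X v = w"
proof (rule lin_form_eqI)
  fix f assume f: "lin_form f"
  show "f (lie X v) = f w"
    using lie_derivative[OF assms(2,1) f] assms(4)[OF f] by (rule DERIV_unique)
qed

lemma lie_derivative_V:
  assumes "v \<in> V" "tangent \<gamma> X"
    and "\<And>v w. v \<in> V \<Longrightarrow> w \<in> V \<Longrightarrow> f (v + w) = f v + f w"
    and "\<And>c v. v \<in> V \<Longrightarrow> f (smul c v) = c * f v"
  shows "((\<lambda>t. f (\<rho> (\<gamma> t) v)) has_field_derivative f (lie X v)) (at 0)"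
proof -
  obtain g where g: "lin_form g" "\<And>v. v \<in> V \<Longrightarrow> g v = f v"
    using ex_lin_form_extending[of f] assms(3,4) by blast
  show ?thesis
    using lie_derivative[OF assms(1,2) g(1)] rep_closed[OF tangent_in_SL[OF assms(2)] assms(1)]
      lie_in_V[OF assms(1)] by (simp add: g(2))
qed

lemma lie_linear_left:
  assumes "v \<in> V" "trace X = 0" "trace Y = 0"
  shows "lie (X + Y) v = lie X v + lie Y v" "lie (mscale c X) v = smul c (lie X v)"
proof -
  obtain M where M: "\<And>X. is_lie X v (\<Sum>i\<in>UNIV. \<Sum>j\<in>UNIV. smul (X $ i $ j) (M i j))"
    using ex_lie[OF assms(1)] by blast
  have lie: "lie X v = (\<Sum>i\<in>UNIV. \<Sum>j\<in>UNIV. smul (X $ i $ j) (M i j))" if "trace X = 0" for X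
    using lie_eqI[OF that assms(1) M] .
  show "lie (X + Y) v = lie X v + lie Y v"
    using assms by (simp add: lie trace_add scale_left_distrib sum.distrib)
  have "trace (mscale c X) = 0"
    using assms(2) by (simp add: trace_mscale)
  then show "lie (mscale c X) v = smul c (lie X v)"
    using assms by (simp add: lie scale_sum_right)
qed

lemma lie_0: "v \<in> V \<Longrightarrow> lie 0 v = 0"
  using lie_linear_left(2)[of v 0 0 0] by (simp add: trace_0[unfolded mat_0] trace_def mscale_def zero_vec_def vec_eq_iff)

lemma lie_diff_left:
  assumes "v \<in> V" "trace X = 0" "trace Y = 0"
  shows "lie (X - Y) v = lie X v - lie Y v"
  using lie_linear_left(1)[of v "X - Y" Y] assms by (simp add: trace_sub)

lemma lie_mscale: "v \<in> V \<Longrightarrow> trace X = 0 \<Longrightarrow> lie (mscale k X) v = smul k (lie X v)"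
  using lie_linear_left(2)[of v X 0] by (simp add: trace_def)

lemma lie_linear_right:
  assumes "v \<in> V" "w \<in> V" "trace X = 0"
  shows "lie X (v + w) = lie X v + lie X w" "lie X (smul c v) = smul c (lie X v)"
proof -
  obtain \<gamma> where \<gamma>: "tangent \<gamma> X" using ex_tangent[OF assms(3)] by blast
  note SL = tangent_in_SL[OF \<gamma>]
  show "lie X (v + w) = lie X v + lie X w"
  proof (rule lie_eqI_curve[OF \<gamma>])
    fix f assume f: "lin_form f"
    show "((\<lambda>t. f (\<rho> (\<gamma> t) (v + w))) has_field_derivative f (lie X v + lie X w)) (at 0)"
      using DERIV_add[OF lie_derivative[OF assms(1) \<gamma> f] lie_derivative[OF assms(2) \<gamma> f]] assms
      by (simp add: rep_add[OF SL] lin_formD[OF f])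
  qed (use assms in \<open>auto intro!: V_closed lie_in_V\<close>)
  show "lie X (smul c v) = smul c (lie X v)"
  proof (rule lie_eqI_curve[OF \<gamma>])
    fix f assume f: "lin_form f"
    show "((\<lambda>t. f (\<rho> (\<gamma> t) (smul c v))) has_field_derivative f (smul c (lie X v))) (at 0)"
      using DERIV_cmult[OF lie_derivative[OF assms(1) \<gamma> f], of c] assms
      by (simp add: rep_smul[OF SL] lin_formD[OF f])
  qed (use assms in \<open>auto intro!: V_closed lie_in_V\<close>)
qed

lemma lie_0_right: "trace X = 0 \<Longrightarrow> lie X 0 = 0"
  using lie_linear_right(2)[of 0 0 X 0] by (simp add: V_closed)

text \<open>Conjugating a curve by \<open>g\<close> conjugates its velocity.\<close>

lemma lie_Ad:
  assumes "v \<in> V" "trace X = 0" "g \<in> SL" "h \<in> SL" "g ** h = mat 1" "h ** g = mat 1"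
  shows "\<rho> g (lie X v) = lie (g ** X ** h) (\<rho> g v)"
proof -
  obtain \<gamma> where \<gamma>: "tangent \<gamma> X" using ex_tangent[OF assms(2)] by blast
  note SL = tangent_in_SL[OF \<gamma>]
  have conj: "\<rho> (g ** \<gamma> t ** h) (\<rho> g v) = \<rho> g (\<rho> (\<gamma> t) v)" for t
  proof -
    have "\<rho> (g ** \<gamma> t ** h) (\<rho> g v) = \<rho> (g ** \<gamma> t ** h ** g) v"
      using assms SL by (simp add: rep_mult SL_mult)
    also have "g ** \<gamma> t ** h ** g = g ** \<gamma> t"
      using assms(6) by (simp flip: matrix_mul_assoc)
    finally show ?thesis using assms SL by (simp add: rep_mult)
  qed
  show ?thesis
  proof (rule lie_eqI_curve[OF tangent_conj[OF \<gamma> assms(3-5)], symmetric])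
    fix f assume f: "lin_form f"
    have "((\<lambda>t. f (\<rho> g (\<rho> (\<gamma> t) v))) has_field_derivative f (\<rho> g (lie X v))) (at 0)"
      by (rule lie_derivative_V[OF assms(1) \<gamma>, of "\<lambda>v. f (\<rho> g v)"])
        (use assms in \<open>simp_all add: rep_add rep_smul lin_formD[OF f]\<close>)
    then show "((\<lambda>t. f (\<rho> (g ** \<gamma> t ** h) (\<rho> g v))) has_field_derivative f (\<rho> g (lie X v))) (at 0)"
      by (simp add: conj)
  qed (use assms in \<open>auto intro!: rep_closed lie_in_V\<close>)
qed

lemma lie_eq_smul:
  assumes "tangent \<gamma> X" "v \<in> V" "\<And>t. \<rho> (\<gamma> t) v = smul (e t) v" "(e has_field_derivative m) (at 0)"
  shows "lie X v = smul m v"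
proof (rule lie_eqI_curve[OF assms(1,2)])
  fix f assume f: "lin_form f"
  show "((\<lambda>t. f (\<rho> (\<gamma> t) v)) has_field_derivative f (smul m v)) (at 0)"
    using DERIV_cmult_right[OF assms(4), of "f v"] by (simp add: assms(3) lin_formD[OF f])
qed (use assms in \<open>auto intro!: V_closed\<close>)

lemma lie_eq_0:
  assumes "tangent \<gamma> X" "v \<in> V" "\<And>t. \<rho> (\<gamma> t) v = v"
  shows "lie X v = 0"
  using lie_eq_smul[OF assms(1,2), of "\<lambda>t. 1" 0] assms(3) by simp

lemma flow_derivative:
  assumes "tangent \<gamma> X" "\<And>s t. \<gamma> (s + t) = \<gamma> s ** \<gamma> t" "v \<in> V" "lin_form f"
  shows "((\<lambda>s. f (\<rho> (\<gamma> s) v)) has_field_derivative f (\<rho> (\<gamma> s) (lie X v))) (at s)"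
proof -
  note SL = tangent_in_SL[OF assms(1)]
  have "((\<lambda>t. f (\<rho> (\<gamma> s) (\<rho> (\<gamma> t) v))) has_field_derivative f (\<rho> (\<gamma> s) (lie X v))) (at 0)"
    by (rule lie_derivative_V[OF assms(3,1), of "\<lambda>v. f (\<rho> (\<gamma> s) v)"])
      (use SL in \<open>simp_all add: rep_add rep_smul lin_formD[OF assms(4)]\<close>)
  then have "((\<lambda>t. f (\<rho> (\<gamma> (t + s)) v)) has_field_derivative f (\<rho> (\<gamma> s) (lie X v))) (at 0)"
    using SL assms(2)[of s] assms(3) by (simp add: rep_mult add.commute)
  then show ?thesis
    using DERIV_shift[of "\<lambda>s. f (\<rho> (\<gamma> s) v)" _ 0 s] by simp
qed

text \<open>By the homomorphism property the velocity at every \<open>s\<close> is the image of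
  \<open>lie X v\<close>, hence 0.\<close>

lemma fixed_if_lie_eq_0:
  assumes "tangent \<gamma> X" "\<And>s t. \<gamma> (s + t) = \<gamma> s ** \<gamma> t" "v \<in> V" "lie X v = 0"
  shows "\<rho> (\<gamma> s) v = v"
proof (rule lin_form_eqI)
  fix f assume f: "lin_form f"
  have "\<rho> (\<gamma> s) 0 = 0" for s
    using rep_smul[OF tangent_in_SL[OF assms(1)] V_closed(1), of s 0] by simp
  then have "((\<lambda>s. f (\<rho> (\<gamma> s) v)) has_field_derivative 0) (at s)" for s
    using flow_derivative[OF assms(1-3) f] by (simp add: assms(4) lin_formD[OF f])
  then obtain c where "\<And>s. f (\<rho> (\<gamma> s) v) = c"
    using has_field_derivative_zero_constant[of UNIV "\<lambda>s. f (\<rho> (\<gamma> s) v)"] by auto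
  then have "f (\<rho> (\<gamma> s) v) = f (\<rho> (\<gamma> 0) v)" by simp
  then show "f (\<rho> (\<gamma> s) v) = f v"
    using assms by (simp add: tangent_def rep_one)
qed

text \<open>A linear form that vanishes on \<open>W\<close> is a polynomial along the flow of a vector of \<open>W\<close>, and
  its derivative is a polynomial of the same kind, of smaller degree.\<close>

lemma stable_flow:
  assumes "i \<noteq> j" "subspace W" "W \<subseteq> V" "\<And>w. w \<in> W \<Longrightarrow> lie (munit i j) w \<in> W" "w \<in> W"
  shows "\<rho> (elem i j s) w \<in> W"
proof (rule ccontr)
  assume "\<rho> (elem i j s) w \<notin> W"
  from ex_lin_form_separating[OF assms(2) this]
  obtain f where f: "lin_form f" "\<And>w. w \<in> W \<Longrightarrow> f w = 0" "f (\<rho> (elem i j s) w) = 1"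
    by blast
  have "q = 0" if "w \<in> W" "\<And>s. f (\<rho> (elem i j s) w) = poly q s" for w q
    using that
  proof (induction "degree q" arbitrary: q w rule: less_induct)
    case less
    have q0: "poly q 0 = 0"
      using less.prems(2)[of 0] f(2)[OF less.prems(1)] less.prems(1) assms(3)
      by (auto simp: elem_0 rep_one)
    have "pderiv q = 0" if "degree q \<noteq> 0"
    proof (rule less.hyps)
      show "degree (pderiv q) < degree q" using that by (simp add: degree_pderiv)
      show "lie (munit i j) w \<in> W" using assms(4) less.prems(1) .
      fix s
      have "((\<lambda>s. f (\<rho> (elem i j s) w)) has_field_derivative f (\<rho> (elem i j s) (lie (munit i j) w))) (at s)"
        by (rule flow_derivative[OF tangent_elem[OF assms(1)]])
          (use assms less.prems f in \<open>auto simp: elem_mult_elem\<close>)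
      then have "(poly q has_field_derivative f (\<rho> (elem i j s) (lie (munit i j) w))) (at s)"
        by (simp add: less.prems(2))
      then show "f (\<rho> (elem i j s) (lie (munit i j) w)) = poly (pderiv q) s"
        using poly_DERIV DERIV_unique by blast
    qed
    then have "degree q = 0" using pderiv_eq_0_iff by blast
    then obtain c where "q = [:c:]" by (rule degree_eq_zeroE)
    then show ?case using q0 by simp
  qed
  moreover have "\<exists>q. \<forall>s. f (\<rho> (elem i j s) w) = poly q s"
  proof -
    have "w \<in> V" using assms by blast
    from rep_regular[OF this f(1)[unfolded lin_form_def]]
    obtain p where p: "entry_polynomial p" "\<And>g. g \<in> SL \<Longrightarrow> f (\<rho> g w) = p g"
      by (auto simp: regular_on_SL_def)
    have "\<exists>q. \<forall>s. elem i j s $ k $ l = poly q s" for k l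
      by (rule exI[of _ "[:if k = l then 1 else 0, if k = i \<and> l = j then 1 else 0:]"])
        (auto simp: elem_def)
    from entry_polynomial_poly[OF p(1) this] show ?thesis
      using p(2) elem_in_SL[OF assms(1)] by simp
  qed
  ultimately have "f (\<rho> (elem i j s) w) = 0" using assms(5) by fastforce
  then show False using f(3) by simp
qed

text \<open>Stability under the nilpotent matrix units integrates to stability under elementary
  matrices by \<open>stable_flow\<close>, hence under the group that they generate.\<close>

lemma irreducible_lie_stable:
  assumes "irreducible_rep" "subspace W" "W \<subseteq> V" "W \<noteq> {0}"
    and "\<And>i j w. i \<noteq> j \<Longrightarrow> w \<in> W \<Longrightarrow> lie (munit i j) w \<in> W"
  shows "W = V"
proof -
  have "\<rho> g w \<in> W" if "g \<in> SL" "w \<in> W" for g w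
  proof -
    have "\<forall>w\<in>W. \<rho> g w \<in> W" using that(1)
    proof (induction rule: SL_induct)
      case (step i j s A)
      show ?case
      proof
        fix w assume w: "w \<in> W"
        then have "\<rho> (elem i j s ** A) w = \<rho> (elem i j s) (\<rho> A w)"
          using step assms(3) by (intro rep_mult elem_in_SL) auto
        then show "\<rho> (elem i j s ** A) w \<in> W"
          using stable_flow[OF step(1) assms(2,3)] assms(5) step w by simp
      qed
    qed (use assms(3) rep_one in auto)
    then show ?thesis using that(2) by blast
  qed
  then show ?thesis using assms(1-4) unfolding irreducible_rep_def by blast
qed

text \<open>The equivariance \<open>lie_Ad\<close> is differentiated along
  \<open>elem i j t\<close>. As \<open>munit i j\<close> squares to 0, the conjugate of
  \<open>Y\<close> is exactly quadratic in \<open>t\<close>, and its linear term is the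
  commutator.\<close>

lemma lie_bracket:
  assumes "i \<noteq> j" "trace Y = 0" "v \<in> V"
  shows "lie (munit i j) (lie Y v) = lie Y (lie (munit i j) v) + lie (munit i j ** Y - Y ** munit i j) v"
proof -
  let ?E = "munit i j" and ?x = "elem i j"
  let ?Z = "?E ** Y - Y ** ?E" and ?W = "?E ** Y ** ?E"
  have x: "?x s = mat 1 + mscale s ?E" for s
    by (auto simp: vec_eq_iff elem_def mat_def)
  have tZ: "trace ?Z = 0" using trace_mul_sym[of ?E Y] by (simp add: trace_sub)
  have EE: "?E ** ?E = 0"
    using assms(1) by (auto simp: vec_eq_iff matrix_matrix_mult_def intro!: sum.neutral)
  have "trace ?W = trace (?E ** ?E ** Y)"
    using trace_mul_sym[of "?E ** Y" ?E] by (simp add: matrix_mul_assoc)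
  then have tW: "trace ?W = 0" by (simp add: EE trace_def)
  have Ad: "?x t ** Y ** ?x (- t) = Y + mscale t ?Z + mscale (- (t ^ 2)) ?W" for t
  proof -
    have d: "(A + B) ** C = A ** C + B ** C" for A B C :: "complex^'n^'n"
      by (simp add: vec_eq_iff matrix_matrix_mult_def distrib_right sum.distrib)
    show ?thesis
      unfolding x d matrix_add_ldistrib matrix_mul_lid matrix_mul_rid mscale_mult
      by (simp add: vec_eq_iff power2_eq_square algebra_simps)
  qed
  note SL = elem_in_SL[OF assms(1)]
  have key: "\<rho> (?x t) (lie Y v) = lie Y (\<rho> (?x t) v) + smul t (lie ?Z (\<rho> (?x t) v))
      + smul (- (t ^ 2)) (lie ?W (\<rho> (?x t) v))" for t
  proof -
    have u: "\<rho> (?x t) v \<in> V" using SL assms(3) by (rule rep_closed)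
    have "\<rho> (?x t) (lie Y v) = lie (?x t ** Y ** ?x (- t)) (\<rho> (?x t) v)"
      by (intro lie_Ad) (use assms SL in \<open>simp_all add: elem_mult_elem elem_0\<close>)
    then show ?thesis
      unfolding Ad using u assms(2) tZ tW by (simp add: lie_linear_left trace_add trace_mscale)
  qed
  show ?thesis
  proof (rule lie_eqI_curve[OF tangent_elem[OF assms(1)]])
    fix f assume f: "lin_form f"
    note f' = lin_formD[OF f]
    have d: "((\<lambda>t. f (lie X (\<rho> (?x t) v))) has_field_derivative f (lie X (lie ?E v))) (at 0)"
      if "trace X = 0" for X
      by (rule lie_derivative_V[OF assms(3) tangent_elem[OF assms(1)], of "\<lambda>v. f (lie X v)"])
        (use that in \<open>simp_all add: lie_linear_right f'\<close>)
    have "((\<lambda>t. f (lie Y (\<rho> (?x t) v)) + t * f (lie ?Z (\<rho> (?x t) v)) + (- (t ^ 2)) * f (lie ?W (\<rho> (?x t) v)))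
        has_field_derivative f (lie Y (lie ?E v)) + f (lie ?Z v)) (at 0)"
      by (rule derivative_eq_intros d assms(2) tZ tW refl)+ (use assms in \<open>simp add: elem_0 rep_one\<close>)
    then show "((\<lambda>t. f (\<rho> (?x t) (lie Y v))) has_field_derivative f (lie Y (lie ?E v) + lie ?Z v)) (at 0)"
      by (simp add: key f')
  qed (use assms in \<open>auto intro!: V_closed lie_in_V\<close>)
qed

end

subsection \<open>Dimension of the invariants of an sl2-triple\<close>

context vector_space
begin

lemma independent_sum_eq_0D:
  assumes "independent S" "finite S" "(\<Sum>v\<in>S. scale (u v) v) = 0" "v \<in> S"
  shows "u v = 0"
  using assms unfolding dependent_finite[OF assms(2)] by blast

lemma span_subset_if_card_ge:
  assumes "independent S" "finite B" "S \<subseteq> span B" "card S \<ge> card B"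
  shows "span B \<subseteq> span S"
proof
  fix x assume x: "x \<in> span B"
  show "x \<in> span S"
  proof (rule ccontr)
    assume "x \<notin> span S"
    then have "independent (insert x S)" "x \<notin> S"
      using assms(1) span_base by (auto simp: independent_insert)
    moreover have "finite S" using independent_span_bound[OF assms(2,1,3)] by simp
    ultimately show False
      using independent_span_bound[OF assms(2), of "insert x S"] x assms(3,4) by simp
  qed
qed

lemma independent_image_subspace:
  assumes "subspace V" "finite A" "independent A" "A \<subseteq> V"
    and add: "\<And>v w. v \<in> V \<Longrightarrow> w \<in> V \<Longrightarrow> T (v + w) = T v + T w"
    and smul: "\<And>c v. v \<in> V \<Longrightarrow> T (scale c v) = scale c (T v)"
    and ker: "\<And>v. v \<in> span A \<Longrightarrow> T v = 0 \<Longrightarrow> v = 0"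
  shows "independent (T ` A)" "card (T ` A) = card A"
proof -
  have spanV: "span A \<subseteq> V" by (rule span_minimal[OF assms(4,1)])
  have inj: "inj_on T A"
  proof (rule inj_onI)
    fix x y assume xy: "x \<in> A" "y \<in> A" "T x = T y"
    then have V: "x - y \<in> V" "y \<in> V" using assms(1,4) by (auto intro: subspace_diff)
    have "T (x - y) = 0" using add[OF V] xy by simp
    moreover have "x - y \<in> span A" using xy by (intro span_diff span_base)
    ultimately show "x = y" using ker[of "x - y"] by simp
  qed
  have T0: "T 0 = 0" using smul[OF subspace_0[OF assms(1)], of 0] by simp
  have Tsum: "T (\<Sum>x\<in>A'. scale (c x) x) = (\<Sum>x\<in>A'. scale (c x) (T x))" if "finite A'" "A' \<subseteq> A" for A' c
    using that
  proof (induction A' rule: finite_induct)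
    case (insert x A')
    then have "x \<in> V" "(\<Sum>x\<in>A'. scale (c x) x) \<in> V"
      using assms(1,4) by (auto intro!: subspace_sum subspace_scale)
    then show ?case using insert assms(1) by (simp add: add smul subspace_scale)
  qed (simp add: T0)
  show "independent (T ` A)"
  proof
    assume "dependent (T ` A)"
    then obtain u x where u: "x \<in> T ` A" "u x \<noteq> 0" "(\<Sum>v\<in>T ` A. scale (u v) v) = 0"
      using dependent_finite[of "T ` A"] assms(2) by auto
    have "(\<Sum>v\<in>T ` A. scale (u v) v) = T (\<Sum>b\<in>A. scale (u (T b)) b)"
      using inj assms(2) by (simp add: sum.reindex Tsum)
    then have "T (\<Sum>b\<in>A. scale (u (T b)) b) = 0" using u(3) by simp
    moreover have "(\<Sum>b\<in>A. scale (u (T b)) b) \<in> span A"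
      by (intro span_sum span_scale span_base)
    ultimately have "(\<Sum>b\<in>A. scale (u (T b)) b) = 0" by (rule ker[rotated])
    then have "\<forall>b\<in>A. u (T b) = 0"
      using independent_sum_eq_0D[OF assms(3,2), of "\<lambda>b. u (T b)"] by blast
    then show False using u(1,2) by blast
  qed
  show "card (T ` A) = card A" using inj by (rule card_image)
qed

end

section \<open>Modules of sl2 with a weight basis\<close>

locale sl2_weight_module = vector_space smul
  for smul :: "complex \<Rightarrow> 'v::ab_group_add \<Rightarrow> 'v" +
  fixes V :: "'v set" and E F H :: "'v \<Rightarrow> 'v" and B :: "'v set" and hb :: "'v \<Rightarrow> int"
  assumes B: "finite B" "independent B" "span B = V"
    and E_in_V: "v \<in> V \<Longrightarrow> E v \<in> V" and F_in_V: "v \<in> V \<Longrightarrow> F v \<in> V"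
    and E_linear: "v \<in> V \<Longrightarrow> w \<in> V \<Longrightarrow> E (v + w) = E v + E w" "v \<in> V \<Longrightarrow> E (smul c v) = smul c (E v)"
    and F_linear: "v \<in> V \<Longrightarrow> w \<in> V \<Longrightarrow> F (v + w) = F v + F w" "v \<in> V \<Longrightarrow> F (smul c v) = smul c (F v)"
    and H_linear: "v \<in> V \<Longrightarrow> w \<in> V \<Longrightarrow> H (v + w) = H v + H w" "v \<in> V \<Longrightarrow> H (smul c v) = smul c (H v)"
    and EF: "v \<in> V \<Longrightarrow> E (F v) = F (E v) + H v"
    and HE: "v \<in> V \<Longrightarrow> H (E v) = E (H v) + smul 2 (E v)"
    and HF: "v \<in> V \<Longrightarrow> H (F v) = F (H v) - smul 2 (F v)"
    and H_basis: "b \<in> B \<Longrightarrow> H b = smul (of_int (hb b)) b"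
begin

lemma subspace_V: "subspace V"
  using B(3) subspace_span by blast

lemmas V_closed = subspace_0[OF subspace_V] subspace_add[OF subspace_V] subspace_diff[OF subspace_V]
  subspace_scale[OF subspace_V] subspace_sum[OF subspace_V] subspace_neg[OF subspace_V]

lemma zero: "E 0 = 0" "F 0 = 0" "H 0 = 0"
  using E_linear(2)[OF V_closed(1), of 0] F_linear(2)[OF V_closed(1), of 0]
    H_linear(2)[OF V_closed(1), of 0] by simp_all

lemma H_in_V:
  assumes "v \<in> V"
  shows "H v \<in> V"
proof -
  have "H v = E (F v) - F (E v)" using EF[OF assms] by simp
  then show ?thesis using V_closed(3) E_in_V F_in_V assms by simp
qed

lemma neg: "v \<in> V \<Longrightarrow> E (- v) = - E v" "v \<in> V \<Longrightarrow> F (- v) = - F v"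
  using E_linear(2)[of v "- 1"] F_linear(2)[of v "- 1"] by simp_all

lemma diff: "v \<in> V \<Longrightarrow> w \<in> V \<Longrightarrow> E (v - w) = E v - E w" "v \<in> V \<Longrightarrow> w \<in> V \<Longrightarrow> F (v - w) = F v - F w"
  using E_linear(1)[of "v - w" w] F_linear(1)[of "v - w" w] V_closed(3)[of v w]
  by (simp_all add: algebra_simps)

definition Vn :: "int \<Rightarrow> 'v set" where "Vn n = {v \<in> V. H v = smul (of_int n) v}"

definition Bn :: "int \<Rightarrow> 'v set" where "Bn n = {b \<in> B. hb b = n}"

lemma finite_Bn: "finite (Bn n)"
  using B(1) by (simp add: Bn_def)

lemma independent_Bn: "independent (Bn n)"
  using independent_mono[OF B(2)] by (simp add: Bn_def)

lemma B_in_V: "b \<in> B \<Longrightarrow> b \<in> V"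
  using B(3) span_base by blast

lemma Vn_subspace: "subspace (Vn n)"
  by (rule subspaceI) (auto simp: Vn_def V_closed zero H_linear scale_right_distrib mult.commute)

lemma Vn_eq_span: "Vn n = span (Bn n)"
proof
  show "span (Bn n) \<subseteq> Vn n"
    by (rule span_minimal[OF _ Vn_subspace]) (auto simp: Bn_def Vn_def B_in_V H_basis)
  show "Vn n \<subseteq> span (Bn n)"
  proof
    fix v assume v: "v \<in> Vn n"
    define c where "c = representation B v"
    have vB: "v = (\<Sum>b\<in>B. smul (c b) b)"
      using sum_representation_eq[OF B(2), of v B] v B(1,3) by (simp add: Vn_def c_def)
    have Hsum: "H (\<Sum>b\<in>A. smul (c b) b) = (\<Sum>b\<in>A. smul (c b * of_int (hb b)) b)" if "finite A" "A \<subseteq> B" for A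
      using that
    proof (induction A rule: finite_induct)
      case (insert x A)
      have "x \<in> V" using insert B_in_V by blast
      moreover have "(\<Sum>b\<in>A. smul (c b) b) \<in> V"
        by (intro V_closed(4,5)) (use insert B_in_V in blast)
      ultimately show ?case using insert by (simp add: H_linear V_closed H_basis)
    qed (simp add: zero)
    have "(\<Sum>b\<in>B. smul (c b * of_int (hb b)) b) = smul (of_int n) v"
      using Hsum[OF B(1)] v vB by (simp add: Vn_def)
    also have "\<dots> = (\<Sum>b\<in>B. smul (c b * of_int n) b)"
      by (subst vB) (simp add: scale_sum_right mult.commute)
    finally have "(\<Sum>b\<in>B. smul (c b * of_int (hb b - n)) b) = 0"
      by (simp add: right_diff_distrib scale_left_diff_distrib sum_subtractf)
    then have "c b * of_int (hb b - n) = 0" if "b \<in> B" for b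
      by (rule independent_sum_eq_0D[OF B(2,1) _ that])
    then have "c b = 0" if "b \<in> B - Bn n" for b
      using that by (auto simp: Bn_def)
    then have "v = (\<Sum>b\<in>Bn n. smul (c b) b)"
      using vB sum.mono_neutral_right[OF B(1), of "Bn n" "\<lambda>b. smul (c b) b"] by (auto simp: Bn_def)
    then show "v \<in> span (Bn n)"
      by (simp add: span_sum span_scale span_base)
  qed
qed

lemma E_Vn: "v \<in> Vn n \<Longrightarrow> E v \<in> Vn (n + 2)"
  by (simp add: Vn_def E_in_V HE E_linear scale_left_distrib)

lemma F_Vn: "v \<in> Vn n \<Longrightarrow> F v \<in> Vn (n - 2)"
  by (simp add: Vn_def F_in_V HF F_linear scale_left_diff_distrib)

text \<open>Under the assumption \<open>E (F w) = 0\<close>, applying \<open>F\<close> to a raised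
  vector gives a nonzero multiple of the previous one. Raising reaches 0 eventually, so
  \<open>w\<close> itself is 0.\<close>

lemma EF_injective:
  assumes "w \<in> Vn 2" "E (F w) = 0"
  shows "w = 0"
proof -
  have wn: "(E ^^ k) w \<in> Vn (2 + 2 * int k)" for k
    using assms(1) by (induction k) (auto dest: E_Vn simp: algebra_simps)
  \<comment> \<open>\<open>(k + 1) * (k + 2)\<close> is the sum of the weights
    \<open>2, 4, ..., 2 + 2 k\<close> of the vectors passed on the way up.\<close>
  have F: "F ((E ^^ Suc k) w) = smul (- of_nat ((k + 1) * (k + 2))) ((E ^^ k) w)" for k
  proof (induction k)
    case 0
    have "E (F w) = F (E w) + H w" using assms(1) by (intro EF) (simp add: Vn_def)
    then show ?case using assms by (simp add: Vn_def eq_neg_iff_add_eq_0)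
  next
    case (Suc k)
    let ?x = "(E ^^ Suc k) w"
    have x: "?x \<in> V" "(E ^^ k) w \<in> V" "H ?x = smul (of_int (2 + 2 * int (Suc k))) ?x"
      using wn[of "Suc k"] wn[of k] by (simp_all add: Vn_def)
    have "F (E ?x) = E (F ?x) - H ?x" using EF[OF x(1)] by simp
    also have "E (F ?x) = smul (- of_nat ((k + 1) * (k + 2))) ?x"
      unfolding Suc using x(2) by (simp only: E_linear funpow.simps o_apply)
    finally have "F (E ?x) = smul (- of_nat ((k + 1) * (k + 2)) - of_int (2 + 2 * int (Suc k))) ?x"
      unfolding x(3) by (simp only: scale_left_diff_distrib)
    also have "- of_nat ((k + 1) * (k + 2)) - of_int (2 + 2 * int (Suc k)) =
        (- of_nat ((Suc k + 1) * (Suc k + 2)) :: complex)"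
      by (simp add: algebra_simps)
    finally show ?case by (simp only: funpow.simps o_apply)
  qed
  \<comment> \<open>Beyond the largest weight the raised vector vanishes; the formula
    \<open>F\<close> then carries the vanishing down to \<open>w\<close>.\<close>
  obtain k where "\<forall>b\<in>B. hb b < 2 + 2 * int k"
  proof -
    obtain m where "\<forall>b\<in>B. hb b \<le> m" using B(1) by (metis finite_imageI bdd_above_finite bdd_above_def imageI)
    then have "\<forall>b\<in>B. hb b < 2 + 2 * int (nat m)" by force
    then show ?thesis using that by blast
  qed
  then have "Bn (2 + 2 * int k) = {}" by (auto simp: Bn_def)
  then have "(E ^^ k) w = 0" using wn[of k] by (simp add: Vn_eq_span)
  then show ?thesis
  proof (induction k)
    case (Suc k)
    have "smul (- of_nat ((k + 1) * (k + 2))) ((E ^^ k) w) = 0"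
      using F[of k] unfolding Suc.prems zero by simp
    moreover have "- (of_nat ((k + 1) * (k + 2)) :: complex) \<noteq> 0"
      unfolding neg_equal_0_iff_equal of_nat_eq_0_iff by simp
    ultimately have "(E ^^ k) w = 0" by (metis scale_eq_0_iff)
    then show ?case by (rule Suc.IH)
  qed simp
qed

end

context sl2_weight_module
begin

text \<open>Exchanging \<open>E\<close> with \<open>F\<close> and negating \<open>H\<close> gives
  another module of the same kind. There \<open>F u\<close> has weight 2, so
  \<open>EF_injective\<close> applies to it.\<close>

lemma F_eq_0:
  assumes "u \<in> Vn 0" "E u = 0"
  shows "F u = 0"
proof -
  interpret m: sl2_weight_module smul V F E "\<lambda>v. - H v" B "\<lambda>b. - hb b"
    by unfold_locales
      (simp_all add: B E_in_V F_in_V E_linear F_linear H_linear EF HE HF H_basis diff neg H_in_V)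
  have "F u \<in> Vn (- 2)" using F_Vn[OF assms(1)] by simp
  then have "F u \<in> m.Vn 2" by (simp add: Vn_def m.Vn_def)
  moreover have "E (F u) = 0"
    using EF[of u] assms by (simp add: Vn_def zero)
  ultimately show ?thesis using m.EF_injective by (simp add: zero)
qed

text \<open>The invariants are the kernel of \<open>E\<close> on \<open>Vn 0\<close>. Since
  \<open>E\<close> after \<open>F\<close> is injective, hence bijective, on \<open>Vn 2\<close>, the
  space \<open>Vn 0\<close> is the direct sum of this kernel and of an injective image of
  \<open>Vn 2\<close> under \<open>F\<close>.\<close>

lemma dim_invariants:
  "int (dim {v \<in> V. E v = 0 \<and> F v = 0}) = int (card (Bn 0)) - int (card (Bn 2))"
proof -
  let ?I = "{v \<in> V. E v = 0 \<and> F v = 0}"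
  have I: "?I = {v \<in> Vn 0. E v = 0}"
  proof
    show "?I \<subseteq> {v \<in> Vn 0. E v = 0}"
    proof
      fix v assume "v \<in> ?I"
      then show "v \<in> {v \<in> Vn 0. E v = 0}" using EF[of v] by (simp add: Vn_def zero)
    qed
    show "{v \<in> Vn 0. E v = 0} \<subseteq> ?I" using F_eq_0 by (auto simp: Vn_def)
  qed
  obtain C where C: "C \<subseteq> ?I" "independent C" "?I \<subseteq> span C" "card C = dim ?I"
    by (rule basis_exists)
  have CV: "C \<subseteq> Vn 0" using C(1) I by blast
  have finC: "finite C"
    using independent_span_bound[OF finite_Bn C(2)] CV Vn_eq_span[of 0] by blast
  have V2: "Vn 2 \<subseteq> V" "Bn 2 \<subseteq> Vn 2" "Bn 2 \<subseteq> V"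
    using span_superset[of "Bn 2"] by (auto simp: Vn_def simp flip: Vn_eq_span)
  have EF2: "w \<in> Vn 2 \<Longrightarrow> E (F w) \<in> Vn 2" for w
    using E_Vn[of "F w" 0] F_Vn[of w 2] by simp
  have EFB: "independent ((\<lambda>v. E (F v)) ` Bn 2)" "card ((\<lambda>v. E (F v)) ` Bn 2) = card (Bn 2)"
  proof -
    show "independent ((\<lambda>v. E (F v)) ` Bn 2)" "card ((\<lambda>v. E (F v)) ` Bn 2) = card (Bn 2)"
      by (rule independent_image_subspace[OF subspace_V finite_Bn independent_Bn V2(3)];
          use EF_injective in \<open>simp add: E_linear F_linear F_in_V V_closed Vn_eq_span\<close>)+
  qed
  have FB: "independent (F ` Bn 2)" "card (F ` Bn 2) = card (Bn 2)"
    by (rule independent_image_subspace[OF subspace_V finite_Bn independent_Bn V2(3)];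
        use EF_injective in \<open>simp add: F_linear Vn_eq_span zero\<close>)+
  have FB0: "F ` Bn 2 \<subseteq> Vn 0"
    using F_Vn[of _ 2] V2(2) by force
  have disj: "C \<inter> F ` Bn 2 = {}"
  proof (rule ccontr)
    assume "C \<inter> F ` Bn 2 \<noteq> {}"
    then obtain b where "b \<in> Bn 2" "E (F b) = 0" using C(1) by auto
    then have "b = 0" using EF_injective V2(2) by blast
    then show False using independent_Bn[of 2] \<open>b \<in> Bn 2\<close> dependent_zero by blast
  qed
  have ind: "independent (C \<union> F ` Bn 2)"
  proof
    assume "dependent (C \<union> F ` Bn 2)"
    moreover have fin: "finite (C \<union> F ` Bn 2)" using finC finite_Bn by simp
    ultimately obtain u x where u: "x \<in> C \<union> F ` Bn 2" "u x \<noteq> 0"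
      "(\<Sum>v\<in>C \<union> F ` Bn 2. smul (u v) v) = 0"
      using dependent_finite[OF fin] by auto
    have split: "(\<Sum>v\<in>C. smul (u v) v) + (\<Sum>v\<in>F ` Bn 2. smul (u v) v) = 0"
      using u(3) finC finite_Bn disj by (simp add: sum.union_disjoint)
    define w where "w = (\<Sum>v\<in>F ` Bn 2. smul (u v) v)"
    have "- (\<Sum>v\<in>C. smul (u v) v) = w"
      using split by (simp add: w_def neg_eq_iff_add_eq_0)
    moreover have "subspace ?I"
      by (rule subspaceI) (auto simp: V_closed zero E_linear F_linear)
    ultimately have "w \<in> ?I"
      using C(1) by (metis (no_types, lifting) subset_iff subspace_neg subspace_scale subspace_sum)
    moreover have "w \<in> F ` Vn 2"
    proof -
      have "F ` Bn 2 \<subseteq> F ` Vn 2" using V2(2) by blast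
      moreover have "subspace (F ` Vn 2)"
      proof (rule subspaceI)
        show "0 \<in> F ` Vn 2" using subspace_0[OF Vn_subspace, of 2] zero(2) by force
        show "x + y \<in> F ` Vn 2" if "x \<in> F ` Vn 2" "y \<in> F ` Vn 2" for x y
        proof -
          obtain a b where "a \<in> Vn 2" "b \<in> Vn 2" "x = F a" "y = F b" using \<open>x \<in> F ` Vn 2\<close> \<open>y \<in> F ` Vn 2\<close> by blast
          then show ?thesis
            using F_linear(1)[of a b] V2(1) subspace_add[OF Vn_subspace, of a 2 b] by (metis image_eqI subsetD)
        qed
        show "smul c x \<in> F ` Vn 2" if "x \<in> F ` Vn 2" for c x
        proof -
          obtain a where "a \<in> Vn 2" "x = F a" using \<open>x \<in> F ` Vn 2\<close> by blast
          then show ?thesis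
            using F_linear(2)[of a c] V2(1) subspace_scale[OF Vn_subspace, of a 2 c] by (metis image_eqI subsetD)
        qed
      qed
      ultimately show ?thesis unfolding w_def
        by (intro subspace_sum subspace_scale) auto
    qed
    ultimately obtain a where "a \<in> Vn 2" "w = F a" "E (F a) = 0" by auto
    then have "w = 0" using EF_injective zero(2) by metis
    then have "(\<Sum>v\<in>F ` Bn 2. smul (u v) v) = 0" "(\<Sum>v\<in>C. smul (u v) v) = 0"
      using split by (simp_all add: w_def)
    then have "\<forall>v\<in>F ` Bn 2. u v = 0" "\<forall>v\<in>C. u v = 0"
      using independent_sum_eq_0D[OF C(2) finC, of u]
        independent_sum_eq_0D[OF FB(1) finite_imageI[OF finite_Bn], of u] by blast+
    then show False using u(1,2) by blast
  qed
  have "Vn 0 \<subseteq> span (C \<union> F ` Bn 2)"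
  proof
    fix v assume v: "v \<in> Vn 0"
    have "E v \<in> Vn 2" using E_Vn[OF v] by simp
    also have "Vn 2 \<subseteq> span ((\<lambda>v. E (F v)) ` Bn 2)"
      unfolding Vn_eq_span
      by (rule span_subset_if_card_ge[OF EFB(1) finite_Bn]) (use EF2 V2(2) EFB(2) in \<open>auto simp: Vn_eq_span\<close>)
    finally obtain c where c: "E v = (\<Sum>x\<in>(\<lambda>v. E (F v)) ` Bn 2. smul (c x) x)"
      using span_finite[OF finite_imageI[OF finite_Bn]] by auto
    have inj: "inj_on (\<lambda>v. E (F v)) (Bn 2)"
      using EFB(2) finite_Bn by (metis eq_card_imp_inj_on)
    \<comment> \<open>\<open>c\<close> expresses \<open>E v\<close> through the vectors
      \<open>E (F b)\<close>; the same combination of the \<open>F b\<close> has the image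
      \<open>E v\<close>, so \<open>v - w\<close> is invariant.\<close>
    define w where "w = (\<Sum>b\<in>Bn 2. smul (c (E (F b))) (F b))"
    have wspan: "w \<in> span (F ` Bn 2)"
      unfolding w_def by (intro span_sum span_scale span_base) auto
    have FV: "F b \<in> V" if "b \<in> Bn 2" for b using that V2(3) F_in_V by blast
    have Esum: "E (\<Sum>b\<in>A. smul (k b) (F b)) = (\<Sum>b\<in>A. smul (k b) (E (F b)))"
      if "finite A" "A \<subseteq> Bn 2" for A k
      using that
    proof (induction A rule: finite_induct)
      case (insert x A)
      have "(\<Sum>b\<in>A. smul (k b) (F b)) \<in> V"
        using insert FV by (intro V_closed(4,5)) auto
      then show ?case using insert FV by (simp add: E_linear V_closed)
    qed (simp add: zero)
    have "E w = E v"
      unfolding w_def Esum[OF finite_Bn subset_refl] c using inj by (simp add: sum.reindex)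
    moreover have w0: "w \<in> Vn 0"
      unfolding w_def using FB0 by (intro subspace_sum[OF Vn_subspace] subspace_scale[OF Vn_subspace]) auto
    ultimately have "v - w \<in> ?I"
      unfolding I using v subspace_diff[OF Vn_subspace v w0] by (simp add: diff Vn_def)
    then have "v - w \<in> span (C \<union> F ` Bn 2)" using C(3) span_mono[of C "C \<union> F ` Bn 2"] by blast
    moreover have "w \<in> span (C \<union> F ` Bn 2)" using wspan span_mono[of "F ` Bn 2" "C \<union> F ` Bn 2"] by blast
    ultimately have "(v - w) + w \<in> span (C \<union> F ` Bn 2)" by (rule span_add)
    then show "v \<in> span (C \<union> F ` Bn 2)" by simp
  qed
  then have "dim (Vn 0) = card (C \<union> F ` Bn 2)"
    using CV FB0 ind by (intro dim_unique) auto
  moreover have "dim (Vn 0) = card (Bn 0)"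
    unfolding Vn_eq_span dim_span using independent_Bn by (rule dim_eq_card_independent)
  moreover have "card (C \<union> F ` Bn 2) = card C + card (Bn 2)"
    using finC finite_Bn disj FB(2) by (simp add: card_Un_disjoint)
  ultimately show ?thesis using C(4) by simp
qed

end

subsection \<open>Weight bases and the Casimir element\<close>

definition I4 :: "nat set" where "I4 = {1, 2, 3, 4}"

lemma finite_I4 [simp]: "finite I4"
  by (simp add: I4_def)

lemma sum_I4: "sum f I4 = f 1 + f 2 + f 3 + f 4"
  by (simp add: I4_def add.assoc)

text \<open>The part of the action of a simple reflection that is visible on weights: an injective
  linear map permuting the diagonal operators. It is all that the comparison of multiplicities takes
  from the group.\<close>

definition weyl_reflection ::
    "(complex \<Rightarrow> 'v::ab_group_add \<Rightarrow> 'v) \<Rightarrow> 'v set \<Rightarrow> (nat \<Rightarrow> nat \<Rightarrow> 'v \<Rightarrow> 'v) \<Rightarrow> nat \<Rightarrow> ('v \<Rightarrow> 'v) \<Rightarrow> bool" where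
  "weyl_reflection smul V e k s \<longleftrightarrow> (\<forall>v\<in>V. s v \<in> V \<and> (s v = 0 \<longrightarrow> v = 0)) \<and>
     (\<forall>v\<in>V. \<forall>w\<in>V. s (v + w) = s v + s w) \<and> (\<forall>c. \<forall>v\<in>V. s (smul c v) = smul c (s v)) \<and>
     (\<forall>i\<in>I4. \<forall>v\<in>V. s (e i i v) =
       e (Transposition.transpose k (Suc k) i) (Transposition.transpose k (Suc k) i) (s v))"

text \<open>Brackets are demanded for off-diagonal \<open>e i j\<close>, the ones that conjugation
  by elementary matrices delivers. Working with \<open>gl4\<close> makes weights integer vectors of
  length 4 instead of classes modulo \<open>(1, 1, 1, 1)\<close>.\<close>

locale gl4_module = vector_space smul
  for smul :: "complex \<Rightarrow> 'v::ab_group_add \<Rightarrow> 'v" +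
  fixes V :: "'v set" and e :: "nat \<Rightarrow> nat \<Rightarrow> 'v \<Rightarrow> 'v" and v0 :: 'v and hw :: "nat \<Rightarrow> int"
  assumes subspace_V: "subspace V"
    and finite_dim: "\<exists>B. finite B \<and> V = span B"
    and e_in_V: "v \<in> V \<Longrightarrow> e i j v \<in> V"
    and e_add: "v \<in> V \<Longrightarrow> w \<in> V \<Longrightarrow> e i j (v + w) = e i j v + e i j w"
    and e_smul: "v \<in> V \<Longrightarrow> e i j (smul c v) = smul c (e i j v)"
    and bracket: "v \<in> V \<Longrightarrow> i \<in> I4 \<Longrightarrow> j \<in> I4 \<Longrightarrow> k \<in> I4 \<Longrightarrow> l \<in> I4 \<Longrightarrow> i \<noteq> j \<Longrightarrow>
      e i j (e k l v) = e k l (e i j v) + (if j = k then e i l v else 0) - (if l = i then e k j v else 0)"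
    and v0: "v0 \<in> V" "v0 \<noteq> 0"
    and v0_pos: "i \<in> I4 \<Longrightarrow> j \<in> I4 \<Longrightarrow> i < j \<Longrightarrow> e i j v0 = 0"
    and v0_weight: "i \<in> I4 \<Longrightarrow> e i i v0 = smul (of_int (hw i)) v0"
    and irreducible: "subspace W \<Longrightarrow> W \<subseteq> V \<Longrightarrow> W \<noteq> {0} \<Longrightarrow>
      (\<And>i j w. i \<in> I4 \<Longrightarrow> j \<in> I4 \<Longrightarrow> i \<noteq> j \<Longrightarrow> w \<in> W \<Longrightarrow> e i j w \<in> W) \<Longrightarrow> W = V"
    and reflection: "k \<in> {1, 2, 3} \<Longrightarrow> \<exists>s. weyl_reflection smul V e k s"
begin

lemmas V_closed = subspace_0[OF subspace_V] subspace_add[OF subspace_V] subspace_diff[OF subspace_V]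
  subspace_scale[OF subspace_V] subspace_sum[OF subspace_V] subspace_neg[OF subspace_V]

lemma e_0: "e i j 0 = 0"
  using e_smul[OF V_closed(1), of i j 0] by simp

lemma e_diff: "v \<in> V \<Longrightarrow> w \<in> V \<Longrightarrow> e i j (v - w) = e i j v - e i j w"
  using e_add[of "v - w" w i j] V_closed(3) by (simp add: algebra_simps)

lemma e_sum: "(\<And>x. x \<in> A \<Longrightarrow> f x \<in> V) \<Longrightarrow> e i j (\<Sum>x\<in>A. f x) = (\<Sum>x\<in>A. e i j (f x))"
  by (induction A rule: infinite_finite_induct) (simp_all add: e_0 e_add V_closed)

inductive desc :: "'v \<Rightarrow> (nat \<Rightarrow> int) \<Rightarrow> bool" where
  top: "desc v0 hw"
| down: "desc x mu \<Longrightarrow> i \<in> {1, 2, 3} \<Longrightarrow> desc (e (Suc i) i x) (mu(i := mu i - 1, Suc i := mu (Suc i) + 1))"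

lemma Suc_in_I4: "i \<in> {1, 2, 3} \<Longrightarrow> i \<in> I4 \<and> Suc i \<in> I4"
  by (auto simp: I4_def)

lemma desc_in_V: "desc x mu \<Longrightarrow> x \<in> V"
  by (induction rule: desc.induct) (simp_all add: v0 e_in_V)

lemma weight_shift:
  assumes "x \<in> V" "i \<in> I4" "j \<in> I4" "k \<in> I4" "i \<noteq> j" "e k k x = smul c x"
  shows "e k k (e i j x) = smul (c + (if k = i then 1 else 0) - (if k = j then 1 else 0)) (e i j x)"
proof -
  have "e i j (e k k x) = e k k (e i j x) + (if j = k then e i k x else 0) - (if k = i then e k j x else 0)"
    by (rule bracket) (use assms in auto)
  then show ?thesis
    using assms by (auto simp: e_smul scale_left_distrib scale_left_diff_distrib)
qed

lemma desc_weight: "desc x mu \<Longrightarrow> k \<in> I4 \<Longrightarrow> e k k x = smul (of_int (mu k)) x"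
proof (induction rule: desc.induct)
  case (down x mu i)
  then have "e k k (e (Suc i) i x) = smul (of_int (mu k) + (if k = Suc i then 1 else 0) - (if k = i then 1 else 0)) (e (Suc i) i x)"
    using Suc_in_I4[of i] by (intro weight_shift) (auto intro: desc_in_V)
  then show ?case by auto
qed (simp add: v0_weight)

text \<open>The sum of the coefficients of \<open>hw - mu\<close> over the simple roots; each
  lowering step raises it by 1.\<close>

definition height :: "(nat \<Rightarrow> int) \<Rightarrow> int" where
  "height mu = (hw 1 - mu 1) + (hw 1 + hw 2 - mu 1 - mu 2) + (hw 1 + hw 2 + hw 3 - mu 1 - mu 2 - mu 3)"

definition dominated :: "(nat \<Rightarrow> int) \<Rightarrow> bool" where
  "dominated mu \<longleftrightarrow> mu 1 \<le> hw 1 \<and> mu 1 + mu 2 \<le> hw 1 + hw 2 \<and> mu 1 + mu 2 + mu 3 \<le> hw 1 + hw 2 + hw 3 \<and>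
     mu 1 + mu 2 + mu 3 + mu 4 = hw 1 + hw 2 + hw 3 + hw 4"

text \<open>Strict positivity of \<open>height\<close> away from \<open>v0\<close> later shows that
  the highest weight has multiplicity 1.\<close>

lemma desc_dominated: "desc x mu \<Longrightarrow> dominated mu \<and> (x = v0 \<and> mu = hw \<or> height mu > 0)"
proof (induction rule: desc.induct)
  case (down x mu i)
  then have "height mu \<ge> 0" by (auto simp: height_def)
  then show ?case using down by (auto simp: dominated_def height_def numeral_eq_Suc)
qed (simp add: dominated_def)

definition S where "S = {x. \<exists>mu. desc x mu}"

lemma S_subset_V: "S \<subseteq> V"
  by (auto simp: S_def desc_in_V)

lemma span_S_subset_V: "span S \<subseteq> V"
  by (rule span_minimal[OF S_subset_V subspace_V])

lemma stable_span:
  assumes "\<And>x. x \<in> S \<Longrightarrow> e i j x \<in> span S" "w \<in> span S"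
  shows "e i j w \<in> span S"
proof -
  have "w \<in> V \<and> e i j w \<in> span S"
    using assms(2)
  proof (induction rule: span_induct_alt)
    case base
    then show ?case by (simp add: e_0 span_zero V_closed)
  next
    case (step c x y)
    then have "x \<in> V" using S_subset_V by blast
    with step assms(1) show ?case
      by (auto simp: e_add e_smul V_closed intro!: span_add span_scale)
  qed
  then show ?thesis ..
qed

lemma span_S_down: "i \<in> {1, 2, 3} \<Longrightarrow> w \<in> span S \<Longrightarrow> e (Suc i) i w \<in> span S"
  by (rule stable_span) (use desc.down in \<open>auto simp: S_def intro!: span_base\<close>)

lemma span_S_diag: "k \<in> I4 \<Longrightarrow> w \<in> span S \<Longrightarrow> e k k w \<in> span S"
proof (rule stable_span)
  fix x assume x: "k \<in> I4" "x \<in> S"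
  then obtain mu where "desc x mu" by (auto simp: S_def)
  with x show "e k k x \<in> span S"
    by (simp add: desc_weight span_scale span_base)
qed

text \<open>Moving a raising operator past the last lowering operator produces only diagonal
  operators, which act on \<open>S\<close> by scalars.\<close>

lemma span_S_up:
  assumes "i \<in> {1, 2, 3}" "w \<in> span S"
  shows "e i (Suc i) w \<in> span S"
proof (rule stable_span[OF _ assms(2)])
  fix x assume "x \<in> S"
  then obtain mu where "desc x mu" by (auto simp: S_def)
  then show "e i (Suc i) x \<in> span S"
  proof (induction rule: desc.induct)
    case top
    then show ?case using v0_pos[of i "Suc i"] Suc_in_I4[OF assms(1)] by (simp add: span_zero)
  next
    case (down x mu j)
    have x: "x \<in> span S" using down by (auto simp: S_def intro: span_base)
    have "e i (Suc i) (e (Suc j) j x) = e (Suc j) j (e i (Suc i) x) +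
        (if Suc i = Suc j then e i j x else 0) - (if j = i then e (Suc j) (Suc i) x else 0)"
      by (rule bracket) (use down Suc_in_I4[of i] Suc_in_I4[of j] assms desc_in_V in auto)
    moreover have "e (Suc j) j (e i (Suc i) x) \<in> span S"
      using span_S_down down by blast
    moreover have "e j j x \<in> span S" "e (Suc j) (Suc j) x \<in> span S"
      using span_S_diag x Suc_in_I4[of j] down by blast+
    ultimately show ?case by (auto intro!: span_add span_diff)
  qed
qed

lemma span_S_e:
  assumes "i \<in> I4" "j \<in> I4" "i \<noteq> j" "w \<in> span S"
  shows "e i j w \<in> span S"
proof -
  have comp: "e i k w \<in> span S"
    if "\<And>w. w \<in> span S \<Longrightarrow> e i j w \<in> span S" "\<And>w. w \<in> span S \<Longrightarrow> e j k w \<in> span S"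
      "i \<in> I4" "j \<in> I4" "k \<in> I4" "i \<noteq> j" "i \<noteq> k" "w \<in> span S" for i j k w
  proof -
    have "e i j (e j k w) = e j k (e i j w) + (if j = j then e i k w else 0) - (if k = i then e j j w else 0)"
      by (rule bracket) (use that span_S_subset_V in auto)
    then have "e i k w = e i j (e j k w) - e j k (e i j w)" using that by simp
    also have "\<dots> \<in> span S" using that by (intro span_diff) auto
    finally show ?thesis .
  qed
  have 1: "e 1 2 w \<in> span S" "e 2 3 w \<in> span S" "e 3 4 w \<in> span S"
    "e 2 1 w \<in> span S" "e 3 2 w \<in> span S" "e 4 3 w \<in> span S" if "w \<in> span S" for w
    using span_S_up[of 1 w] span_S_up[of 2 w] span_S_up[of 3 w]
      span_S_down[of 1 w] span_S_down[of 2 w] span_S_down[of 3 w] that by (simp_all add: numeral_eq_Suc)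
  have 2: "e 1 3 w \<in> span S" "e 2 4 w \<in> span S" "e 3 1 w \<in> span S" "e 4 2 w \<in> span S"
    if "w \<in> span S" for w
    using comp[of 1 2 3 w] comp[of 2 3 4 w] comp[of 3 2 1 w] comp[of 4 3 2 w] 1 that
    by (simp_all add: I4_def)
  have 3: "e 1 4 w \<in> span S" "e 4 1 w \<in> span S" if "w \<in> span S" for w
    using comp[of 1 2 4 w] comp[of 4 2 1 w] 1 2 that by (simp_all add: I4_def)
  show ?thesis using assms 1 2 3 by (auto simp: I4_def)
qed

lemma span_S: "span S = V"
proof (rule irreducible)
  show "span S \<noteq> {0}"
    using v0(2) desc.top span_base[of v0 S] by (auto simp: S_def)
qed (use span_S_e span_S_subset_V in auto)

lemma ex_weight_basis: "\<exists>B. finite B \<and> independent B \<and> span B = V \<and> v0 \<in> B \<and> B \<subseteq> S"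
proof -
  have "{v0} \<subseteq> S" using desc.top by (auto simp: S_def)
  moreover have "independent {v0}" using v0(2) by simp
  ultimately obtain B where B: "{v0} \<subseteq> B" "B \<subseteq> S" "independent B" "S \<subseteq> span B"
    by (rule maximal_independent_subset_extend)
  have "span B = V"
    using B span_S span_mono[OF B(2)] span_minimal[OF B(4)] by auto
  moreover have "finite B"
    using finite_dim independent_span_bound[OF _ B(3)] B(2) S_subset_V by blast
  ultimately show ?thesis using B by blast
qed

definition B where "B = (SOME B. finite B \<and> independent B \<and> span B = V \<and> v0 \<in> B \<and> B \<subseteq> S)"

lemma B: "finite B" "independent B" "span B = V" "v0 \<in> B" "B \<subseteq> S"
  using someI_ex[OF ex_weight_basis] unfolding B_def[symmetric] by auto

definition wt where "wt b = (SOME mu. desc b mu)"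

lemma desc_wt: "b \<in> B \<Longrightarrow> desc b (wt b)"
  unfolding wt_def using B(5) someI_ex[of "desc b"] by (auto simp: S_def)

lemma B_in_V: "b \<in> B \<Longrightarrow> b \<in> V"
  using B S_subset_V by blast

lemma wt_e: "b \<in> B \<Longrightarrow> k \<in> I4 \<Longrightarrow> e k k b = smul (of_int (wt b k)) b"
  using desc_weight desc_wt by blast

lemma wt_v0: "k \<in> I4 \<Longrightarrow> wt v0 k = hw k"
  using wt_e[OF B(4)] v0_weight v0(2) by (metis of_int_eq_iff scale_cancel_right)

lemma wt_dominated: "b \<in> B \<Longrightarrow> dominated (wt b)"
  using desc_dominated desc_wt by blast

lemma wt_height: "b \<in> B \<Longrightarrow> b \<noteq> v0 \<Longrightarrow> height (wt b) > 0"
  using desc_dominated desc_wt by blast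

definition co where "co b v = representation B v b"

lemma co_sum: "v \<in> V \<Longrightarrow> (\<Sum>b\<in>B. smul (co b v) b) = v"
  unfolding co_def using B by (intro sum_representation_eq) auto

lemma co_linear:
  "v \<in> V \<Longrightarrow> w \<in> V \<Longrightarrow> co b (v + w) = co b v + co b w"
  "v \<in> V \<Longrightarrow> co b (smul c v) = c * co b v"
  "v \<in> V \<Longrightarrow> w \<in> V \<Longrightarrow> co b (v - w) = co b v - co b w"
  "(\<And>x. x \<in> A \<Longrightarrow> f x \<in> V) \<Longrightarrow> co b (\<Sum>x\<in>A. f x) = (\<Sum>x\<in>A. co b (f x))"
  unfolding co_def using B
  by (simp_all add: representation_add representation_scale representation_diff representation_sum add.commute)

lemma co_basis: "b \<in> B \<Longrightarrow> co d b = (if d = b then 1 else 0)"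
  unfolding co_def using B by (simp add: representation_basis)

lemma co_weight:
  assumes "x \<in> V" "k \<in> I4" "d \<in> B" "e k k x = smul c x" "co d x \<noteq> 0"
  shows "c = of_int (wt d k)"
proof -
  have "e k k x = e k k (\<Sum>b\<in>B. smul (co b x) b)" using co_sum[OF assms(1)] by simp
  also have "\<dots> = (\<Sum>b\<in>B. smul (co b x * of_int (wt b k)) b)"
    using assms(2) by (subst e_sum) (auto intro!: V_closed sum.cong simp: B_in_V e_smul wt_e)
  finally have "co d (e k k x) = (\<Sum>b\<in>B. co b x * of_int (wt b k) * co d b)"
    by (simp add: co_linear V_closed B_in_V)
  also have "\<dots> = (\<Sum>b\<in>B. if b = d then co d x * of_int (wt d k) else 0)"
    by (intro sum.cong refl) (auto simp: co_basis)
  also have "\<dots> = co d x * of_int (wt d k)" using assms(3) B(1) by simp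
  finally have "c * co d x = co d x * of_int (wt d k)"
    using assms(1,4) by (simp add: co_linear)
  then show ?thesis using assms(5) by simp
qed

definition Bw :: "(nat \<Rightarrow> int) \<Rightarrow> 'v set" where
  "Bw mu = {b \<in> B. \<forall>k\<in>I4. wt b k = mu k}"

lemma finite_Bw: "finite (Bw mu)"
  using B(1) by (simp add: Bw_def)

lemma Bw_cong: "(\<And>k. k \<in> I4 \<Longrightarrow> mu k = nu k) \<Longrightarrow> Bw mu = Bw nu"
  by (auto simp: Bw_def)

definition mult :: "(nat \<Rightarrow> int) \<Rightarrow> nat" where "mult mu = card (Bw mu)"

text \<open>The trace of \<open>e i j\<close> after \<open>e j i\<close> on the weight space of
  \<open>mu\<close>.\<close>

definition tr :: "nat \<Rightarrow> nat \<Rightarrow> (nat \<Rightarrow> int) \<Rightarrow> complex" where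
  "tr i j mu = (\<Sum>b\<in>Bw mu. co b (e i j (e j i b)))"

lemma tr_commutator:
  assumes "i \<in> I4" "j \<in> I4" "i \<noteq> j"
  shows "tr i j mu = tr j i mu + (of_int (mu i) - of_int (mu j)) * of_nat (mult mu)"
proof -
  have "co b (e i j (e j i b)) = co b (e j i (e i j b)) + (of_int (mu i) - of_int (mu j))"
    if "b \<in> Bw mu" for b
  proof -
    have b: "b \<in> B" "wt b i = mu i" "wt b j = mu j" using that assms by (auto simp: Bw_def)
    have "e i j (e j i b) = e j i (e i j b) + (if j = j then e i i b else 0) - (if i = i then e j j b else 0)"
      by (rule bracket) (use assms b B_in_V in auto)
    then show ?thesis
      using assms b by (simp add: co_linear V_closed e_in_V B_in_V wt_e co_basis)
  qed
  then have "tr i j mu = (\<Sum>b\<in>Bw mu. co b (e j i (e i j b)) + (of_int (mu i) - of_int (mu j)))"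
    unfolding tr_def by (rule sum.cong[OF refl])
  then show ?thesis by (simp add: tr_def mult_def sum.distrib)
qed

text \<open>Only basis vectors of the neighbouring weight occur between the two operators.\<close>

lemma tr_expand:
  assumes "i \<in> I4" "j \<in> I4" "i \<noteq> j"
  shows "tr i j mu = (\<Sum>b\<in>Bw mu. \<Sum>d\<in>Bw (mu(i := mu i - 1, j := mu j + 1)). co d (e j i b) * co b (e i j d))"
proof -
  have "co b (e i j (e j i b)) = (\<Sum>d\<in>Bw (mu(i := mu i - 1, j := mu j + 1)). co d (e j i b) * co b (e i j d))"
    if "b \<in> Bw mu" for b
  proof -
    have b: "b \<in> B" "\<And>k. k \<in> I4 \<Longrightarrow> wt b k = mu k" using that by (auto simp: Bw_def)
    have "e i j (e j i b) = e i j (\<Sum>d\<in>B. smul (co d (e j i b)) d)"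
      using co_sum e_in_V B_in_V b by simp
    also have "\<dots> = (\<Sum>d\<in>B. smul (co d (e j i b)) (e i j d))"
      by (subst e_sum) (auto intro!: V_closed sum.cong simp: B_in_V e_smul)
    finally have "co b (e i j (e j i b)) = (\<Sum>d\<in>B. co d (e j i b) * co b (e i j d))"
      by (simp add: co_linear V_closed B_in_V e_in_V)
    also have "\<dots> = (\<Sum>d\<in>Bw (mu(i := mu i - 1, j := mu j + 1)). co d (e j i b) * co b (e i j d))"
    proof (rule sum.mono_neutral_right)
      show "\<forall>d\<in>B - Bw (mu(i := mu i - 1, j := mu j + 1)). co d (e j i b) * co b (e i j d) = 0"
      proof (rule ballI, rule ccontr)
        fix d assume d: "d \<in> B - Bw (mu(i := mu i - 1, j := mu j + 1))"
          and "co d (e j i b) * co b (e i j d) \<noteq> 0"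
        then have n0: "co d (e j i b) \<noteq> 0" by simp
        have "wt d k = (mu(i := mu i - 1, j := mu j + 1)) k" if k: "k \<in> I4" for k
        proof -
          have "e k k (e j i b) = smul (of_int (wt b k) + (if k = j then 1 else 0) - (if k = i then 1 else 0)) (e j i b)"
            using assms k b by (intro weight_shift) (auto simp: wt_e B_in_V)
          from co_weight[OF _ k _ this n0]
          have "of_int (wt b k) + (if k = j then 1 else 0) - (if k = i then 1 else 0) = (of_int (wt d k) :: complex)"
            using d b by (auto simp: e_in_V B_in_V)
          then have "(of_int (wt b k + (if k = j then 1 else 0) - (if k = i then 1 else 0)) :: complex) = of_int (wt d k)"
            by auto
          then have "wt d k = wt b k + (if k = j then 1 else 0) - (if k = i then 1 else 0)"
            by (simp only: of_int_eq_iff)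
          then show ?thesis using b(2)[OF k] assms(3) by auto
        qed
        then show False using d by (simp add: Bw_def)
      qed
    qed (use B(1) in \<open>auto simp: Bw_def\<close>)
    finally show ?thesis .
  qed
  then show ?thesis unfolding tr_def by (rule sum.cong[OF refl])
qed

text \<open>The two composites of a pair of maps between neighbouring weight spaces have the same
  trace. Together with \<open>tr_commutator\<close> this is a first-order recurrence along a root
  string.\<close>

lemma tr_cyclic:
  assumes "i \<in> I4" "j \<in> I4" "i \<noteq> j"
  shows "tr i j mu = tr j i (mu(i := mu i - 1, j := mu j + 1))"
proof -
  let ?nu = "mu(i := mu i - 1, j := mu j + 1)"
  have "?nu(j := ?nu j - 1, i := ?nu i + 1) = mu" using assms(3) by auto
  then have "tr j i ?nu = (\<Sum>b\<in>Bw ?nu. \<Sum>d\<in>Bw mu. co d (e i j b) * co b (e j i d))"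
    using tr_expand[of j i ?nu] assms by simp
  also have "\<dots> = (\<Sum>d\<in>Bw mu. \<Sum>b\<in>Bw ?nu. co d (e i j b) * co b (e j i d))"
    by (rule sum.swap)
  finally show ?thesis using tr_expand[OF assms, of mu] by (simp add: mult.commute)
qed

section \<open>The Casimir element and the symmetry of the multiplicities\<close>

definition casimir where "casimir v = (\<Sum>i\<in>I4. \<Sum>j\<in>I4. e i j (e j i v))"

text \<open>Each summand produces four correction terms, and after summation over the free index
  they cancel in pairs.\<close>

lemma casimir_commute:
  assumes "v \<in> V" "p \<in> I4" "q \<in> I4" "p \<noteq> q"
  shows "e p q (casimir v) = casimir (e p q v)"
proof -
  have "e p q (e i j (e j i v)) = e i j (e j i (e p q v)) +
      ((if j = q then e i q (e p i v) else 0) - (if i = p then e p j (e j q v) else 0)) +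
      ((if i = q then e p j (e j q v) else 0) - (if j = p then e i q (e p i v) else 0))"
    if ij: "i \<in> I4" "j \<in> I4" for i j
  proof -
    have 1: "e p q (e i j (e j i v)) = e i j (e p q (e j i v)) +
        (if q = i then e p j (e j i v) else 0) - (if j = p then e i q (e j i v) else 0)"
      by (rule bracket) (use assms ij e_in_V in auto)
    have 2: "e p q (e j i v) = e j i (e p q v) + (if q = j then e p i v else 0) - (if i = p then e j q v else 0)"
      by (rule bracket) (use assms ij in auto)
    have "e i j (e p q (e j i v)) = e i j (e j i (e p q v)) +
        ((if j = q then e i q (e p i v) else 0) - (if i = p then e p j (e j q v) else 0))"
      unfolding 2 using assms(1) by (auto simp: e_add e_diff e_in_V V_closed e_0)
    then show ?thesis unfolding 1 by auto
  qed
  then have "e p q (casimir v) = (\<Sum>i\<in>I4. \<Sum>j\<in>I4. e i j (e j i (e p q v)) +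
      ((if j = q then e i q (e p i v) else 0) - (if i = p then e p j (e j q v) else 0)) +
      ((if i = q then e p j (e j q v) else 0) - (if j = p then e i q (e p i v) else 0)))"
    unfolding casimir_def using assms(1)
    by (simp add: e_sum e_in_V V_closed cong: sum.cong)
  also have "\<dots> = casimir (e p q v) +
      ((\<Sum>i\<in>I4. \<Sum>j\<in>I4. if j = q then e i q (e p i v) else 0) -
       (\<Sum>i\<in>I4. \<Sum>j\<in>I4. if i = p then e p j (e j q v) else 0)) +
      ((\<Sum>i\<in>I4. \<Sum>j\<in>I4. if i = q then e p j (e j q v) else 0) -
       (\<Sum>i\<in>I4. \<Sum>j\<in>I4. if j = p then e i q (e p i v) else 0))"
    unfolding casimir_def by (simp only: sum.distrib sum_subtractf)
  also have "(\<Sum>i\<in>I4. \<Sum>j\<in>I4. if j = q then e i q (e p i v) else 0) = (\<Sum>i\<in>I4. e i q (e p i v))"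
    using assms by simp
  also have "(\<Sum>i\<in>I4. \<Sum>j\<in>I4. if j = p then e i q (e p i v) else 0) = (\<Sum>i\<in>I4. e i q (e p i v))"
    using assms by simp
  also have "(\<Sum>i\<in>I4. \<Sum>j\<in>I4. if i = p then e p j (e j q v) else 0) = (\<Sum>j\<in>I4. e p j (e j q v))"
    using assms by (subst sum.swap) simp
  also have "(\<Sum>i\<in>I4. \<Sum>j\<in>I4. if i = q then e p j (e j q v) else 0) = (\<Sum>j\<in>I4. e p j (e j q v))"
    using assms by (subst sum.swap) simp
  finally show ?thesis by simp
qed

text \<open>The inner product of \<open>hw\<close> with \<open>hw + (3, 1, -1, -3)\<close>, where
  the second summand is the sum of the positive roots.\<close>

definition cas :: int where
  "cas = (hw 1)\<^sup>2 + (hw 2)\<^sup>2 + (hw 3)\<^sup>2 + (hw 4)\<^sup>2 + 3 * hw 1 + hw 2 - hw 3 - 3 * hw 4"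

lemma casimir_v0: "casimir v0 = smul (of_int cas) v0"
proof -
  have diag: "e i i (e i i v0) = smul (of_int ((hw i)\<^sup>2)) v0" if "i \<in> I4" for i
    using that v0 by (simp add: v0_weight e_smul power2_eq_square)
  have up: "e j i (e i j v0) = 0" if "i \<in> I4" "j \<in> I4" "i < j" for i j
    using that by (simp add: v0_pos e_0)
  have down: "e i j (e j i v0) = smul (of_int (hw i - hw j)) v0" if "i \<in> I4" "j \<in> I4" "i < j" for i j
  proof -
    have "e i j (e j i v0) = e j i (e i j v0) + (if j = j then e i i v0 else 0) - (if i = i then e j j v0 else 0)"
      by (rule bracket) (use that v0 in auto)
    then show ?thesis using that by (simp add: v0_pos v0_weight e_0 scale_left_diff_distrib)
  qed
  have I: "1 \<in> I4" "2 \<in> I4" "3 \<in> I4" "4 \<in> I4" by (simp_all add: I4_def)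
  have cas: "cas = (hw 1)\<^sup>2 + (hw 2)\<^sup>2 + (hw 3)\<^sup>2 + (hw 4)\<^sup>2 + (hw 1 - hw 2) + (hw 1 - hw 3) +
      (hw 1 - hw 4) + (hw 2 - hw 3) + (hw 2 - hw 4) + (hw 3 - hw 4)"
    by (simp add: cas_def)
  show ?thesis
    unfolding casimir_def sum_I4 cas of_int_add scale_left_distrib using I
    by (simp add: diag up down add_ac del: One_nat_def of_int_diff of_int_power)
qed

lemma casimir_S: "desc x mu \<Longrightarrow> casimir x = smul (of_int cas) x"
proof (induction rule: desc.induct)
  case (down x mu i)
  then have "casimir (e (Suc i) i x) = e (Suc i) i (casimir x)"
    using Suc_in_I4[of i] desc_in_V by (intro casimir_commute[symmetric]) auto
  then show ?case using down desc_in_V by (simp add: e_smul)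
qed (rule casimir_v0)

text \<open>The trace of the Casimir element on a weight space is computed once from its summands
  and once from its scalar value.\<close>

lemma casimir_trace:
  "((of_int (mu 1))\<^sup>2 + (of_int (mu 2))\<^sup>2 + (of_int (mu 3))\<^sup>2 + (of_int (mu 4))\<^sup>2) * of_nat (mult mu) +
     (tr 1 2 mu + tr 2 1 mu) + (tr 1 3 mu + tr 3 1 mu) + (tr 1 4 mu + tr 4 1 mu) +
     (tr 2 3 mu + tr 3 2 mu) + (tr 2 4 mu + tr 4 2 mu) + (tr 3 4 mu + tr 4 3 mu) =
   of_int cas * of_nat (mult mu)"
proof -
  have diag: "tr i i mu = (of_int (mu i))\<^sup>2 * of_nat (mult mu)" if "i \<in> I4" for i
  proof -
    have "co b (e i i (e i i b)) = (of_int (mu i))\<^sup>2" if "b \<in> Bw mu" for b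
    proof -
      have b: "b \<in> B" "wt b i = mu i" using that \<open>i \<in> I4\<close> by (auto simp: Bw_def)
      then show ?thesis
        using \<open>i \<in> I4\<close> by (simp add: wt_e e_smul B_in_V co_linear V_closed co_basis power2_eq_square)
    qed
    then show ?thesis by (simp add: tr_def mult_def)
  qed
  have "of_int cas * of_nat (mult mu) = (\<Sum>b\<in>Bw mu. co b (casimir b))"
  proof -
    have "co b (casimir b) = of_int cas" if "b \<in> Bw mu" for b
    proof -
      have b: "b \<in> B" using that by (auto simp: Bw_def)
      then show ?thesis using casimir_S[OF desc_wt[OF b]] by (simp add: co_linear B_in_V co_basis)
    qed
    then show ?thesis by (simp add: mult_def)
  qed
  also have "\<dots> = (\<Sum>b\<in>Bw mu. \<Sum>i\<in>I4. \<Sum>j\<in>I4. co b (e i j (e j i b)))"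
    unfolding casimir_def by (intro sum.cong refl) (auto simp: co_linear V_closed e_in_V B_in_V Bw_def)
  also have "\<dots> = (\<Sum>i\<in>I4. \<Sum>j\<in>I4. tr i j mu)"
    unfolding tr_def sum_I4 by (simp add: sum.distrib)
  finally show ?thesis
    using diag[of 1] diag[of 2] diag[of 3] diag[of 4]
    by (simp add: sum_I4 I4_def algebra_simps)
qed

text \<open>\<open>s\<close> carries the weight space of \<open>mu\<close> injectively into that of
  the transposed weight. An inequality is enough, because the transposition is an
  involution.\<close>

lemma mult_reflection_le:
  assumes "k \<in> {1, 2, 3}"
  shows "mult mu \<le> mult (mu \<circ> Transposition.transpose k (Suc k))"
proof -
  let ?t = "Transposition.transpose k (Suc k)"
  have tI: "?t i \<in> I4" if "i \<in> I4" for i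
    using assms that by (auto simp: I4_def Transposition.transpose_def)
  obtain s where "weyl_reflection smul V e k s" using reflection[OF assms] ..
  then have s: "\<And>v. v \<in> V \<Longrightarrow> s v \<in> V" "\<And>v w. v \<in> V \<Longrightarrow> w \<in> V \<Longrightarrow> s (v + w) = s v + s w"
    "\<And>c v. v \<in> V \<Longrightarrow> s (smul c v) = smul c (s v)" "\<And>v. v \<in> V \<Longrightarrow> s v = 0 \<Longrightarrow> v = 0"
    "\<And>i v. i \<in> I4 \<Longrightarrow> v \<in> V \<Longrightarrow> s (e i i v) = e (?t i) (?t i) (s v)"
    by (simp_all add: weyl_reflection_def)
  have BV: "Bw mu \<subseteq> V" by (auto simp: Bw_def B_in_V)
  have "independent (Bw mu)"
    using B(2) independent_mono[of B "Bw mu"] by (auto simp: Bw_def)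
  note image = independent_image_subspace[OF subspace_V finite_Bw this BV s(2,3)]
  have ker: "v = 0" if "v \<in> span (Bw mu)" "s v = 0" for v
    using s(4) that span_minimal[OF BV subspace_V] by blast
  have ind: "independent (s ` Bw mu)" and card: "card (s ` Bw mu) = card (Bw mu)"
    by (rule image; use ker in blast)+
  have "s ` Bw mu \<subseteq> span (Bw (mu \<circ> ?t))"
  proof
    fix y assume "y \<in> s ` Bw mu"
    then obtain b where b: "b \<in> Bw mu" "y = s b" by blast
    then have bB: "b \<in> B" "b \<in> V" by (auto simp: Bw_def B_in_V)
    have y: "y \<in> V" using s(1) bB b by simp
    have wty: "e i i y = smul (of_int ((mu \<circ> ?t) i)) y" if "i \<in> I4" for i
    proof -
      have "e i i y = s (e (?t i) (?t i) b)"
        using s(5)[OF tI[OF that] bB(2)] b by simp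
      also have "\<dots> = smul (of_int ((mu \<circ> ?t) i)) y"
        using b bB tI[OF that] by (simp add: wt_e s Bw_def)
      finally show ?thesis .
    qed
    have "y = (\<Sum>d\<in>B. smul (co d y) d)" using co_sum[OF y] by simp
    also have "\<dots> \<in> span (Bw (mu \<circ> ?t))"
    proof (rule span_sum)
      fix d assume d: "d \<in> B"
      show "smul (co d y) d \<in> span (Bw (mu \<circ> ?t))"
      proof (cases "co d y = 0")
        case True
        then show ?thesis by (simp add: span_zero)
      next
        case False
        have "wt d i = (mu \<circ> ?t) i" if "i \<in> I4" for i
          using co_weight[OF y that d wty[OF that] False] by (simp only: of_int_eq_iff)
        then have "d \<in> Bw (mu \<circ> ?t)" using d by (simp add: Bw_def)
        then show ?thesis by (intro span_scale span_base)
      qed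
    qed
    finally show "y \<in> span (Bw (mu \<circ> ?t))" .
  qed
  then have "card (s ` Bw mu) \<le> card (Bw (mu \<circ> ?t))"
    using independent_span_bound[OF finite_Bw ind] by blast
  then show ?thesis
    by (simp add: mult_def card)
qed

lemma mult_reflection:
  assumes "k \<in> {1, 2, 3}"
  shows "mult (mu \<circ> Transposition.transpose k (Suc k)) = mult mu"
  using mult_reflection_le[OF assms, of mu] mult_reflection_le[OF assms, of "mu \<circ> Transposition.transpose k (Suc k)"]
  by (simp add: comp_assoc)

end

subsection \<open>The Weyl character formula\<close>

text \<open>\<open>alt2\<close>, \<open>alt3\<close> and \<open>alt4\<close> are signed sums over
  all permutations of the arguments, built like the expansion of a determinant.\<close>

definition alt2 :: "('a \<Rightarrow> 'a \<Rightarrow> 'k::ab_group_add) \<Rightarrow> 'a \<Rightarrow> 'a \<Rightarrow> 'k" where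
  "alt2 f z w = f z w - f w z"

definition alt3 :: "('a \<Rightarrow> 'a \<Rightarrow> 'a \<Rightarrow> 'k::ab_group_add) \<Rightarrow> 'a \<Rightarrow> 'a \<Rightarrow> 'a \<Rightarrow> 'k" where
  "alt3 f y z w = alt2 (f y) z w - alt2 (f z) y w + alt2 (f w) y z"

definition alt4 :: "('a \<Rightarrow> 'a \<Rightarrow> 'a \<Rightarrow> 'a \<Rightarrow> 'k::ab_group_add) \<Rightarrow> 'a \<Rightarrow> 'a \<Rightarrow> 'a \<Rightarrow> 'a \<Rightarrow> 'k" where
  "alt4 f x y z w = alt3 (f x) y z w - alt3 (f y) x z w + alt3 (f z) x y w - alt3 (f w) x y z"

lemmas alt_defs = alt4_def alt3_def alt2_def

lemma alt4_permute:
  "alt4 (\<lambda>p r q s. f p q r s) a b c d = - alt4 f a b c d"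
  "alt4 (\<lambda>p s q r. f p q r s) a b c d = alt4 f a b c d"
  "alt4 (\<lambda>q r p s. f p q r s) a b c d = alt4 f a b c d"
  "alt4 (\<lambda>q s p r. f p q r s) a b c d = - alt4 f a b c d"
  "alt4 (\<lambda>r s p q. f p q r s) a b c d = alt4 f a b c d"
  by (simp_all add: alt_defs)

type_synonym weight_fun = "int \<Rightarrow> int \<Rightarrow> int \<Rightarrow> int \<Rightarrow> complex"

text \<open>Let \<open>t (x - 1) (y + 1) = t x y + (x - y) m x y\<close> and
  \<open>g x y = t (x - 1) (y + 1) + t x y\<close>. Then \<open>string1\<close> is
  \<open>g x y - g (x + 1) (y - 1)\<close>, and \<open>string2\<close>, \<open>string3\<close> are
  the corresponding differences at distance 2 and 3.\<close>

definition string1 :: "(int \<Rightarrow> int \<Rightarrow> complex) \<Rightarrow> int \<Rightarrow> int \<Rightarrow> complex" where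
  "string1 m x y = of_int (x - y) * m x y + of_int (x - y + 2) * m (x + 1) (y - 1)"

definition string2 :: "(int \<Rightarrow> int \<Rightarrow> complex) \<Rightarrow> int \<Rightarrow> int \<Rightarrow> complex" where
  "string2 m x y = of_int (x - y) * m x y + 2 * of_int (x - y + 2) * m (x + 1) (y - 1) +
     of_int (x - y + 4) * m (x + 2) (y - 2)"

definition string3 :: "(int \<Rightarrow> int \<Rightarrow> complex) \<Rightarrow> int \<Rightarrow> int \<Rightarrow> complex" where
  "string3 m x y = of_int (x - y) * m x y + 2 * of_int (x - y + 2) * m (x + 1) (y - 1) +
     2 * of_int (x - y + 4) * m (x + 2) (y - 2) + of_int (x - y + 6) * m (x + 3) (y - 3)"

definition root_sum :: "weight_fun \<Rightarrow> int \<Rightarrow> int \<Rightarrow> int \<Rightarrow> int \<Rightarrow> complex" where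
  "root_sum m x y z w =
     string1 (\<lambda>x y. m x y (z - 1) w) (x - 3) (y - 2) - string1 (\<lambda>x y. m x y z (w - 1)) (x - 3) (y - 2) -
     string2 (\<lambda>x y. m x y (z - 2) w) (x - 3) (y - 1) + string2 (\<lambda>x y. m x y z (w - 2)) (x - 3) (y - 1) +
     string3 (\<lambda>x y. m x y (z - 2) (w - 1)) (x - 3) y - string3 (\<lambda>x y. m x y (z - 1) (w - 2)) (x - 3) y +
     string1 (\<lambda>x y. m x y (z - 3) w) (x - 2) (y - 1) - string1 (\<lambda>x y. m x y z (w - 3)) (x - 2) (y - 1) -
     string2 (\<lambda>x y. m x y (z - 3) (w - 1)) (x - 2) y + string2 (\<lambda>x y. m x y (z - 1) (w - 3)) (x - 2) y +
     string1 (\<lambda>x y. m x y (z - 3) (w - 2)) (x - 1) y - string1 (\<lambda>x y. m x y (z - 2) (w - 3)) (x - 1) y"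

lemma string_sums:
  assumes "\<And>x y. t (x - 1) (y + 1) = t x y + of_int (x - y) * m x y"
  shows "t (x - 1) (y + 1) + t x y = t x y + t (x + 1) (y - 1) + string1 m x y"
    and "t (x - 1) (y + 1) + t x y = t (x + 1) (y - 1) + t (x + 2) (y - 2) + string2 m x y"
    and "t (x - 1) (y + 1) + t x y = t (x + 2) (y - 2) + t (x + 3) (y - 3) + string3 m x y"
proof -
  have 0: "t (x - 1) (y + 1) = t x y + of_int (x - y) * m x y"
    by (rule assms)
  have 1: "t x y = t (x + 1) (y - 1) + of_int (x - y + 2) * m (x + 1) (y - 1)"
    using assms[of "x + 1" "y - 1"] by (simp add: algebra_simps)
  have 2: "t (x + 1) (y - 1) = t (x + 2) (y - 2) + of_int (x - y + 4) * m (x + 2) (y - 2)"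
    using assms[of "x + 2" "y - 2"] by (simp add: algebra_simps)
  have 3: "t (x + 2) (y - 2) = t (x + 3) (y - 3) + of_int (x - y + 6) * m (x + 3) (y - 3)"
    using assms[of "x + 3" "y - 3"] by (simp add: algebra_simps)
  show "t (x - 1) (y + 1) + t x y = t x y + t (x + 1) (y - 1) + string1 m x y"
    unfolding string1_def 0 1 by simp
  show "t (x - 1) (y + 1) + t x y = t (x + 1) (y - 1) + t (x + 2) (y - 2) + string2 m x y"
    unfolding string2_def 0 1 2 by (simp add: algebra_simps)
  show "t (x - 1) (y + 1) + t x y = t (x + 2) (y - 2) + t (x + 3) (y - 3) + string3 m x y"
    unfolding string3_def 0 1 2 3 by (simp add: algebra_simps)
qed

text \<open>Permutations of the shifts are paired by exchanging the first two entries
  \<open>p > q\<close>. The two points lie \<open>p - q\<close> steps apart on one root string, so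
  the difference of their terms is a string expression in \<open>m\<close> alone. This eliminates
  the unknown traces \<open>t\<close>.\<close>

lemma alt4_root_sum:
  assumes "\<And>x y z w. t (x - 1) (y + 1) z w = t x y z w + of_int (x - y) * m x y z w"
  shows "alt4 (\<lambda>p q r s. t (x - p - 1) (y - q + 1) (z - r) (w - s) + t (x - p) (y - q) (z - r) (w - s)) 3 2 1 0 =
    root_sum m x y z w"
proof -
  define g where "g x y z w = t (x - 1) (y + 1) z w + t x y z w" for x y z w
  note sums = string_sums[of "\<lambda>x y. t x y z w" "\<lambda>x y. m x y z w" for z w, OF assms]
  have s1: "g x y z w = g (x + 1) (y - 1) z w + string1 (\<lambda>x y. m x y z w) x y" for x y z w
    unfolding g_def using sums(1)[of x y z w] by simp
  have s2: "g x y z w = g (x + 2) (y - 2) z w + string2 (\<lambda>x y. m x y z w) x y" for x y z w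
    unfolding g_def using sums(2)[of x y z w] by (simp add: add.commute)
  have s3: "g x y z w = g (x + 3) (y - 3) z w + string3 (\<lambda>x y. m x y z w) x y" for x y z w
    unfolding g_def using sums(3)[of x y z w] by (simp add: add.commute)
  have r: "g (x - 3) (y - 2) z w = g (x - 2) (y - 3) z w + string1 (\<lambda>x y. m x y z w) (x - 3) (y - 2)"
    "g (x - 3) (y - 1) z w = g (x - 1) (y - 3) z w + string2 (\<lambda>x y. m x y z w) (x - 3) (y - 1)"
    "g (x - 3) y z w = g x (y - 3) z w + string3 (\<lambda>x y. m x y z w) (x - 3) y"
    "g (x - 2) (y - 1) z w = g (x - 1) (y - 2) z w + string1 (\<lambda>x y. m x y z w) (x - 2) (y - 1)"
    "g (x - 2) y z w = g x (y - 2) z w + string2 (\<lambda>x y. m x y z w) (x - 2) y"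
    "g (x - 1) y z w = g x (y - 1) z w + string1 (\<lambda>x y. m x y z w) (x - 1) y" for z w
    using s1[of "x - 3" "y - 2" z w] s2[of "x - 3" "y - 1" z w] s3[of "x - 3" y z w]
      s1[of "x - 2" "y - 1" z w] s2[of "x - 2" y z w] s1[of "x - 1" y z w] by simp_all
  have "alt4 (\<lambda>p q r s. g (x - p) (y - q) (z - r) (w - s)) 3 2 1 0 = root_sum m x y z w"
    unfolding root_sum_def alt_defs by (simp add: r)
  then show ?thesis by (simp add: g_def)
qed

text \<open>The sum over the positive roots is the Laplacian of the Weyl denominator; the linear term in
  the weight appears because \<open>(3, 2, 1, 0)\<close> differs from half the sum of the positive roots by
  \<open>(3/2, 3/2, 3/2, 3/2)\<close>.\<close>

lemma denominator_laplacian: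
  "alt4 (\<lambda>p q r s. ((of_int (x - p))\<^sup>2 + (of_int (y - q))\<^sup>2 + (of_int (z - r))\<^sup>2 + (of_int (w - s))\<^sup>2) *
       m (x - p) (y - q) (z - r) (w - s)) 3 2 1 0 +
     (root_sum m x y z w - root_sum (\<lambda>x z y w. m x y z w) x z y w +
      root_sum (\<lambda>x w y z. m x y z w) x w y z + root_sum (\<lambda>y z x w. m x y z w) y z x w -
      root_sum (\<lambda>y w x z. m x y z w) y w x z + root_sum (\<lambda>z w x y. m x y z w) z w x y) =
   ((of_int x)\<^sup>2 + (of_int y)\<^sup>2 + (of_int z)\<^sup>2 + (of_int w)\<^sup>2 - 3 * (of_int x + of_int y + of_int z + of_int w) + 4) *
     alt4 (\<lambda>p q r s. m (x - p) (y - q) (z - r) (w - s)) 3 2 1 0"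
proof -
  have sq: "(of_int (x - p))\<^sup>2 + (of_int (y - q))\<^sup>2 + (of_int (z - r))\<^sup>2 + (of_int (w - s))\<^sup>2 =
     (of_int x)\<^sup>2 + (of_int y)\<^sup>2 + (of_int z)\<^sup>2 + (of_int w)\<^sup>2 +
     (of_int (p\<^sup>2 + q\<^sup>2 + r\<^sup>2 + s\<^sup>2) - 2 * (of_int x * of_int p + of_int y * of_int q + of_int z * of_int r + of_int w * of_int s) :: complex)" for p q r s
    by (simp add: power2_eq_square algebra_simps)
  have add: "alt4 (\<lambda>p q r s. (n + f p q r s) * g p q r s) a b c d = n * alt4 g a b c d + alt4 (\<lambda>p q r s. f p q r s * g p q r s) a b c d"
    for f g :: weight_fun and n a b c d
    by (simp add: alt_defs algebra_simps)
  define X Y Z W where "X = (of_int x :: complex)" "Y = (of_int y :: complex)" "Z = (of_int z :: complex)" "W = (of_int w :: complex)"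
  show ?thesis
    unfolding sq add distrib_right[of _ 4] left_diff_distrib[of "_ + _"]
    unfolding root_sum_def string1_def string2_def string3_def alt_defs of_int_diff of_int_add of_int_numeral of_int_0 of_int_1 X_Y_Z_W_def[symmetric]
    by simp algebra
qed

text \<open>The polynomial factor is \<open>|v|^2 - 5\<close> for
  \<open>v = (x - 3/2, y - 3/2, z - 3/2, w - 3/2)\<close>, where 5 is the squared length of half the
  sum of the positive roots.\<close>

lemma weyl_numerator_eigen:
  fixes m :: weight_fun
  assumes t12: "\<And>x y z w. t12 (x - 1) (y + 1) z w = t12 x y z w + of_int (x - y) * m x y z w"
    and t13: "\<And>x y z w. t13 (x - 1) y (z + 1) w = t13 x y z w + of_int (x - z) * m x y z w"
    and t14: "\<And>x y z w. t14 (x - 1) y z (w + 1) = t14 x y z w + of_int (x - w) * m x y z w"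
    and t23: "\<And>x y z w. t23 x (y - 1) (z + 1) w = t23 x y z w + of_int (y - z) * m x y z w"
    and t24: "\<And>x y z w. t24 x (y - 1) z (w + 1) = t24 x y z w + of_int (y - w) * m x y z w"
    and t34: "\<And>x y z w. t34 x y (z - 1) (w + 1) = t34 x y z w + of_int (z - w) * m x y z w"
    and casimir: "\<And>x y z w. ((of_int x)\<^sup>2 + (of_int y)\<^sup>2 + (of_int z)\<^sup>2 + (of_int w)\<^sup>2) * m x y z w +
      (t12 (x - 1) (y + 1) z w + t12 x y z w) + (t13 (x - 1) y (z + 1) w + t13 x y z w) +
      (t14 (x - 1) y z (w + 1) + t14 x y z w) + (t23 x (y - 1) (z + 1) w + t23 x y z w) +
      (t24 x (y - 1) z (w + 1) + t24 x y z w) + (t34 x y (z - 1) (w + 1) + t34 x y z w) = c * m x y z w"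
  shows "((of_int x)\<^sup>2 + (of_int y)\<^sup>2 + (of_int z)\<^sup>2 + (of_int w)\<^sup>2 - 3 * (of_int x + of_int y + of_int z + of_int w) + 4) *
     alt4 (\<lambda>p q r s. m (x - p) (y - q) (z - r) (w - s)) 3 2 1 0 =
     c * alt4 (\<lambda>p q r s. m (x - p) (y - q) (z - r) (w - s)) 3 2 1 0"
proof -
  let ?t12 = "\<lambda>p q r s. t12 (x - p - 1) (y - q + 1) (z - r) (w - s) + t12 (x - p) (y - q) (z - r) (w - s)"
  let ?t13 = "\<lambda>p q r s. t13 (x - p - 1) (y - q) (z - r + 1) (w - s) + t13 (x - p) (y - q) (z - r) (w - s)"
  let ?t14 = "\<lambda>p q r s. t14 (x - p - 1) (y - q) (z - r) (w - s + 1) + t14 (x - p) (y - q) (z - r) (w - s)"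
  let ?t23 = "\<lambda>p q r s. t23 (x - p) (y - q - 1) (z - r + 1) (w - s) + t23 (x - p) (y - q) (z - r) (w - s)"
  let ?t24 = "\<lambda>p q r s. t24 (x - p) (y - q - 1) (z - r) (w - s + 1) + t24 (x - p) (y - q) (z - r) (w - s)"
  let ?t34 = "\<lambda>p q r s. t34 (x - p) (y - q) (z - r - 1) (w - s + 1) + t34 (x - p) (y - q) (z - r) (w - s)"
  let ?m = "\<lambda>p q r s. m (x - p) (y - q) (z - r) (w - s)"
  let ?n = "\<lambda>p q r s. ((of_int (x - p))\<^sup>2 + (of_int (y - q))\<^sup>2 + (of_int (z - r))\<^sup>2 + (of_int (w - s))\<^sup>2) * ?m p q r s"
  have alt4_add: "alt4 (\<lambda>p q r s. f p q r s + g p q r s) a b c d = alt4 f a b c d + alt4 g a b c d"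
    for f g :: weight_fun and a b c d
    by (simp add: alt_defs)
  have alt4_cmult: "alt4 (\<lambda>p q r s. k * f p q r s) a b c d = k * alt4 f a b c d"
    for f :: weight_fun and a b c d k
    by (simp add: alt_defs algebra_simps)
  have e12: "alt4 ?t12 3 2 1 0 = root_sum m x y z w"
    by (rule alt4_root_sum[OF t12])
  \<comment> \<open>For the remaining roots the slots are permuted so that the two coordinates
    involved come first; the sign is that of the permutation.\<close>
  have "alt4 (\<lambda>p r q s. ?t13 p q r s) 3 2 1 0 = root_sum (\<lambda>x z y w. m x y z w) x z y w"
    by (rule alt4_root_sum[of "\<lambda>x z y w. t13 x y z w" "\<lambda>x z y w. m x y z w", OF t13])
  from this[symmetric] have e13: "alt4 ?t13 3 2 1 0 = - root_sum (\<lambda>x z y w. m x y z w) x z y w"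
    by (simp only: alt4_permute(1)[of ?t13] minus_minus)
  have "alt4 (\<lambda>p s q r. ?t14 p q r s) 3 2 1 0 = root_sum (\<lambda>x w y z. m x y z w) x w y z"
    by (rule alt4_root_sum[of "\<lambda>x w y z. t14 x y z w" "\<lambda>x w y z. m x y z w", OF t14])
  then have e14: "alt4 ?t14 3 2 1 0 = root_sum (\<lambda>x w y z. m x y z w) x w y z"
    by (simp add: alt4_permute(2)[of ?t14])
  have "alt4 (\<lambda>q r p s. ?t23 p q r s) 3 2 1 0 = root_sum (\<lambda>y z x w. m x y z w) y z x w"
    by (rule alt4_root_sum[of "\<lambda>y z x w. t23 x y z w" "\<lambda>y z x w. m x y z w", OF t23])
  then have e23: "alt4 ?t23 3 2 1 0 = root_sum (\<lambda>y z x w. m x y z w) y z x w"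
    by (simp add: alt4_permute(3)[of ?t23])
  have "alt4 (\<lambda>q s p r. ?t24 p q r s) 3 2 1 0 = root_sum (\<lambda>y w x z. m x y z w) y w x z"
    by (rule alt4_root_sum[of "\<lambda>y w x z. t24 x y z w" "\<lambda>y w x z. m x y z w", OF t24])
  from this[symmetric] have e24: "alt4 ?t24 3 2 1 0 = - root_sum (\<lambda>y w x z. m x y z w) y w x z"
    by (simp only: alt4_permute(4)[of ?t24] minus_minus)
  have "alt4 (\<lambda>r s p q. ?t34 p q r s) 3 2 1 0 = root_sum (\<lambda>z w x y. m x y z w) z w x y"
    by (rule alt4_root_sum[of "\<lambda>z w x y. t34 x y z w" "\<lambda>z w x y. m x y z w", OF t34])
  then have e34: "alt4 ?t34 3 2 1 0 = root_sum (\<lambda>z w x y. m x y z w) z w x y"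
    by (simp add: alt4_permute(5)[of ?t34])
  have "c * alt4 ?m 3 2 1 0 = alt4 (\<lambda>p q r s. c * ?m p q r s) 3 2 1 0"
    by (rule alt4_cmult[symmetric])
  also have "\<dots> = alt4 (\<lambda>p q r s. ?n p q r s + ?t12 p q r s + ?t13 p q r s + ?t14 p q r s +
      ?t23 p q r s + ?t24 p q r s + ?t34 p q r s) 3 2 1 0"
    by (simp only: casimir[symmetric] add.assoc)
  also have "\<dots> = alt4 ?n 3 2 1 0 + alt4 ?t12 3 2 1 0 + alt4 ?t13 3 2 1 0 + alt4 ?t14 3 2 1 0 +
      alt4 ?t23 3 2 1 0 + alt4 ?t24 3 2 1 0 + alt4 ?t34 3 2 1 0"
    by (simp only: alt4_add)
  also have "\<dots> = alt4 ?n 3 2 1 0 +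
     (root_sum m x y z w - root_sum (\<lambda>x z y w. m x y z w) x z y w +
      root_sum (\<lambda>x w y z. m x y z w) x w y z + root_sum (\<lambda>y z x w. m x y z w) y z x w -
      root_sum (\<lambda>y w x z. m x y z w) y w x z + root_sum (\<lambda>z w x y. m x y z w) z w x y)"
    unfolding e12 e13 e14 e23 e24 e34 by simp
  also have "\<dots> = ((of_int x)\<^sup>2 + (of_int y)\<^sup>2 + (of_int z)\<^sup>2 + (of_int w)\<^sup>2 - 3 * (of_int x + of_int y + of_int z + of_int w) + 4) *
     alt4 ?m 3 2 1 0"
    by (rule denominator_laplacian)
  finally show ?thesis ..
qed

text \<open>A decreasing vector can agree with a permutation of a strictly decreasing one only if
  the permutation is the identity.\<close>

lemma alt4_indicator_sorted:
  fixes x y z w :: int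
  assumes "x \<ge> y" "y \<ge> z" "z \<ge> w" "a > b" "b > c" "c > d"
  shows "alt4 (\<lambda>p q r s. if x = p \<and> y = q \<and> z = r \<and> w = s then 1 else 0) a b c d =
    (if x = a \<and> y = b \<and> z = c \<and> w = d then 1 else 0 :: int)"
proof -
  define f :: "int \<Rightarrow> int \<Rightarrow> int \<Rightarrow> int \<Rightarrow> int"
    where "f p q r s = (if x = p \<and> y = q \<and> z = r \<and> w = s then 1 else 0)" for p q r s
  have "f p q r s = 0" if "p < q \<or> q < r \<or> r < s" for p q r s
    using assms(1-3) that by (auto simp: f_def)
  then have "alt4 f a b c d = f a b c d"
    using assms(4-6) by (simp add: alt_defs)
  then show ?thesis by (simp add: f_def[abs_def])
qed

text \<open>Insertion sort by adjacent transpositions.\<close>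

lemma symmetric4_wlog:
  fixes x y z w :: int
  assumes "\<And>x y z w. Q x y z w \<Longrightarrow> Q y x z w" "\<And>x y z w. Q x y z w \<Longrightarrow> Q x z y w"
    "\<And>x y z w. Q x y z w \<Longrightarrow> Q x y w z" "\<And>x y z w. x \<ge> y \<Longrightarrow> y \<ge> z \<Longrightarrow> z \<ge> w \<Longrightarrow> Q x y z w"
  shows "Q x y z w"
proof -
  have 1: "Q x y z w" if "y \<ge> z" "z \<ge> w" for x y z w
  proof (cases "x \<ge> y")
    case True
    then show ?thesis using assms(4) that by blast
  next
    case False
    show ?thesis
    proof (cases "x \<ge> z")
      case True
      then have "Q y x z w" using assms(4) that False by simp
      then show ?thesis by (rule assms(1))
    next
      case xz: False
      show ?thesis
      proof (cases "x \<ge> w")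
        case True
        then have "Q y z x w" using assms(4) that xz by simp
        then show ?thesis using assms(1,2) by blast
      next
        case False
        then have "Q y z w x" using assms(4) that xz by simp
        then show ?thesis using assms(1,2,3) by blast
      qed
    qed
  qed
  have 2: "Q x y z w" if "z \<ge> w" for x y z w
  proof (cases "y \<ge> z")
    case True
    then show ?thesis using 1 that by blast
  next
    case False
    show ?thesis
    proof (cases "y \<ge> w")
      case True
      then have "Q x z y w" using 1 that False by simp
      then show ?thesis by (rule assms(2))
    next
      case False
      then have "Q x z w y" using 1 that by simp
      then show ?thesis using assms(2,3) by blast
    qed
  qed
  show ?thesis
  proof (cases "z \<ge> w")
    case True
    then show ?thesis by (rule 2)
  next
    case False
    then have "Q x y w z" using 2 by simp
    then show ?thesis by (rule assms(3))
  qed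
qed

definition wvec :: "int \<Rightarrow> int \<Rightarrow> int \<Rightarrow> int \<Rightarrow> nat \<Rightarrow> int" where
  "wvec x y z w k = (if k = 1 then x else if k = 2 then y else if k = 3 then z else w)"

lemma wvec_simps [simp]:
  "wvec x y z w 1 = x" "wvec x y z w (Suc 0) = x" "wvec x y z w 2 = y" "wvec x y z w 3 = z" "wvec x y z w 4 = w"
  by (simp_all add: wvec_def)

section \<open>The product of the character with the Weyl denominator\<close>

context gl4_module
begin

definition mw :: "int \<Rightarrow> int \<Rightarrow> int \<Rightarrow> int \<Rightarrow> int" where
  "mw x y z w = int (mult (wvec x y z w))"

lemma mult_cong: "(\<And>k. k \<in> I4 \<Longrightarrow> mu k = nu k) \<Longrightarrow> mult mu = mult nu"
  unfolding mult_def using Bw_cong by metis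

lemma tr_cong: "(\<And>k. k \<in> I4 \<Longrightarrow> mu k = nu k) \<Longrightarrow> tr i j mu = tr i j nu"
  unfolding tr_def using Bw_cong by metis

lemma mw_symmetric: "mw y x z w = mw x y z w" "mw x z y w = mw x y z w" "mw x y w z = mw x y z w"
proof -
  have "mult (wvec x y z w \<circ> Transposition.transpose k (Suc k)) = mult (wvec x y z w)" if "k \<in> {1, 2, 3}" for k
    by (rule mult_reflection[OF that])
  from this[of 1] this[of 2] this[of 3]
  have "mult (wvec x y z w \<circ> Transposition.transpose 1 2) = mult (wvec x y z w)"
    "mult (wvec x y z w \<circ> Transposition.transpose 2 3) = mult (wvec x y z w)"
    "mult (wvec x y z w \<circ> Transposition.transpose 3 4) = mult (wvec x y z w)"
    by (simp_all add: numeral_eq_Suc)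
  moreover have "mult (wvec y x z w) = mult (wvec x y z w \<circ> Transposition.transpose 1 2)"
    "mult (wvec x z y w) = mult (wvec x y z w \<circ> Transposition.transpose 2 3)"
    "mult (wvec x y w z) = mult (wvec x y z w \<circ> Transposition.transpose 3 4)"
    by (rule mult_cong; auto simp: I4_def Transposition.transpose_def)+
  ultimately show "mw y x z w = mw x y z w" "mw x z y w = mw x y z w" "mw x y w z = mw x y z w"
    by (simp_all add: mw_def)
qed

text \<open>A coefficient of the product of the character with the Weyl denominator, whose exponents
  are the permutations of \<open>(3, 2, 1, 0)\<close>.\<close>

definition numer :: "int \<Rightarrow> int \<Rightarrow> int \<Rightarrow> int \<Rightarrow> int" where
  "numer x y z w = alt4 (\<lambda>p q r s. mw (x - p) (y - q) (z - r) (w - s)) 3 2 1 0"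

lemma numer_antisym: "numer y x z w = - numer x y z w" "numer x z y w = - numer x y z w"
  "numer x y w z = - numer x y z w"
  by (simp_all add: numer_def alt_defs mw_symmetric(1)[of "y - _" "x - _"]
      mw_symmetric(2)[of _ "z - _" "y - _"] mw_symmetric(3)[of _ _ "w - _" "z - _"])

lemma numer_eigen:
  "(x\<^sup>2 + y\<^sup>2 + z\<^sup>2 + w\<^sup>2 - 3 * (x + y + z + w) + 4 - cas) * numer x y z w = 0"
proof -
  \<comment> \<open>The indices are swapped so that \<open>tr_cyclic\<close> and
    \<open>tr_commutator\<close> combine to the recurrence in the form required.\<close>
  let ?t = "\<lambda>i j x y z w. tr j i (wvec x y z w)"
  have cyc: "tr i j (wvec x y z w) = tr j i (wvec x' y' z' w')"
    if "i \<in> I4" "j \<in> I4" "i \<noteq> j" "\<And>k. k \<in> I4 \<Longrightarrow> ((wvec x y z w)(i := wvec x y z w i - 1, j := wvec x y z w j + 1)) k = wvec x' y' z' w' k"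
    for i j x y z w x' y' z' w'
    using tr_cyclic[OF that(1-3), of "wvec x y z w"] tr_cong[OF that(4)] by simp
  have c: "tr 1 2 (wvec x y z w) = ?t 1 2 (x - 1) (y + 1) z w"
    "tr 1 3 (wvec x y z w) = ?t 1 3 (x - 1) y (z + 1) w"
    "tr 1 4 (wvec x y z w) = ?t 1 4 (x - 1) y z (w + 1)"
    "tr 2 3 (wvec x y z w) = ?t 2 3 x (y - 1) (z + 1) w"
    "tr 2 4 (wvec x y z w) = ?t 2 4 x (y - 1) z (w + 1)"
    "tr 3 4 (wvec x y z w) = ?t 3 4 x y (z - 1) (w + 1)" for x y z w
    by (rule cyc; auto simp: I4_def)+
  have d: "?t i j x y z w + (of_int (wvec x y z w i - wvec x y z w j)) * of_int (mw x y z w) = tr i j (wvec x y z w)"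
    if "i \<in> I4" "j \<in> I4" "i \<noteq> j" for i j x y z w
    using tr_commutator[OF that, of "wvec x y z w"] by (simp add: mw_def)
  have "((of_int x)\<^sup>2 + (of_int y)\<^sup>2 + (of_int z)\<^sup>2 + (of_int w)\<^sup>2 - 3 * (of_int x + of_int y + of_int z + of_int w) + 4) *
     alt4 (\<lambda>p q r s. of_int (mw (x - p) (y - q) (z - r) (w - s))) 3 2 1 0 =
     (of_int cas :: complex) * alt4 (\<lambda>p q r s. of_int (mw (x - p) (y - q) (z - r) (w - s))) 3 2 1 0"
  proof (rule weyl_numerator_eigen[where ?t12.0 = "?t 1 2" and ?t13.0 = "?t 1 3" and ?t14.0 = "?t 1 4"
        and ?t23.0 = "?t 2 3" and ?t24.0 = "?t 2 4" and ?t34.0 = "?t 3 4"])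
    fix x y z w
    show "?t 1 2 (x - 1) (y + 1) z w = ?t 1 2 x y z w + of_int (x - y) * of_int (mw x y z w)"
      using d[of 1 2 x y z w] c(1)[of x y z w] by (simp add: I4_def)
    show "?t 1 3 (x - 1) y (z + 1) w = ?t 1 3 x y z w + of_int (x - z) * of_int (mw x y z w)"
      using d[of 1 3 x y z w] c(2)[of x y z w] by (simp add: I4_def)
    show "?t 1 4 (x - 1) y z (w + 1) = ?t 1 4 x y z w + of_int (x - w) * of_int (mw x y z w)"
      using d[of 1 4 x y z w] c(3)[of x y z w] by (simp add: I4_def)
    show "?t 2 3 x (y - 1) (z + 1) w = ?t 2 3 x y z w + of_int (y - z) * of_int (mw x y z w)"
      using d[of 2 3 x y z w] c(4)[of x y z w] by (simp add: I4_def)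
    show "?t 2 4 x (y - 1) z (w + 1) = ?t 2 4 x y z w + of_int (y - w) * of_int (mw x y z w)"
      using d[of 2 4 x y z w] c(5)[of x y z w] by (simp add: I4_def)
    show "?t 3 4 x y (z - 1) (w + 1) = ?t 3 4 x y z w + of_int (z - w) * of_int (mw x y z w)"
      using d[of 3 4 x y z w] c(6)[of x y z w] by (simp add: I4_def)
    show "((of_int x)\<^sup>2 + (of_int y)\<^sup>2 + (of_int z)\<^sup>2 + (of_int w)\<^sup>2) * of_int (mw x y z w) +
      (?t 1 2 (x - 1) (y + 1) z w + ?t 1 2 x y z w) + (?t 1 3 (x - 1) y (z + 1) w + ?t 1 3 x y z w) +
      (?t 1 4 (x - 1) y z (w + 1) + ?t 1 4 x y z w) + (?t 2 3 x (y - 1) (z + 1) w + ?t 2 3 x y z w) +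
      (?t 2 4 x (y - 1) z (w + 1) + ?t 2 4 x y z w) + (?t 3 4 x y (z - 1) (w + 1) + ?t 3 4 x y z w) =
      of_int cas * of_int (mw x y z w)"
      using casimir_trace[of "wvec x y z w"] by (simp add: c[symmetric] mw_def del: One_nat_def)
  qed
  moreover have "alt4 (\<lambda>p q r s. of_int (mw (x - p) (y - q) (z - r) (w - s))) 3 2 1 0 = (of_int (numer x y z w) :: complex)"
    by (simp add: numer_def alt_defs)
  ultimately have "(of_int ((x\<^sup>2 + y\<^sup>2 + z\<^sup>2 + w\<^sup>2 - 3 * (x + y + z + w) + 4 - cas) * numer x y z w) :: complex) = 0"
    by (simp add: algebra_simps)
  then show ?thesis by (simp only: of_int_eq_0_iff)
qed

lemma mw_nonzero: "mw x y z w \<noteq> 0 \<Longrightarrow> dominated (wvec x y z w)"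
proof -
  assume "mw x y z w \<noteq> 0"
  then have "Bw (wvec x y z w) \<noteq> {}" by (auto simp: mw_def mult_def)
  then obtain b where "b \<in> B" "\<forall>k\<in>I4. wt b k = wvec x y z w k" by (auto simp: Bw_def)
  then show ?thesis using wt_dominated[of b] by (simp add: dominated_def I4_def)
qed

lemma numer_nonzero:
  assumes "numer x y z w \<noteq> 0"
  shows "x \<le> hw 1 + 3 \<and> x + y \<le> hw 1 + hw 2 + 5 \<and> x + y + z \<le> hw 1 + hw 2 + hw 3 + 6 \<and>
    x + y + z + w = hw 1 + hw 2 + hw 3 + hw 4 + 6"
proof (rule ccontr)
  assume neg: "\<not> ?thesis"
  define f where "f p q r s = mw (x - p) (y - q) (z - r) (w - s)" for p q r s
  \<comment> \<open>The inequalities on partial sums hold for every permutation of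
    \<open>(3, 2, 1, 0)\<close>, so all terms of the alternating sum vanish.\<close>
  have "f p q r s = 0"
    if "p \<le> 3" "p + q \<le> 5" "p + q + r \<le> 6" "p + q + r + s = 6" for p q r s
    using mw_nonzero[of "x - p" "y - q" "z - r" "w - s"] neg that
    unfolding dominated_def wvec_simps f_def by linarith
  then have "alt4 f 3 2 1 0 = 0"
    by (simp add: alt_defs)
  then have "numer x y z w = 0"
    by (simp add: numer_def f_def[abs_def])
  then show False using assms by simp
qed

lemma mw_top: "mw (hw 1) (hw 2) (hw 3) (hw 4) = 1"
proof -
  have "Bw (wvec (hw 1) (hw 2) (hw 3) (hw 4)) = {v0}"
  proof
    show "{v0} \<subseteq> Bw (wvec (hw 1) (hw 2) (hw 3) (hw 4))"
      using B(4) wt_v0 by (auto simp: Bw_def I4_def)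
    show "Bw (wvec (hw 1) (hw 2) (hw 3) (hw 4)) \<subseteq> {v0}"
    proof
      fix b assume "b \<in> Bw (wvec (hw 1) (hw 2) (hw 3) (hw 4))"
      then have "b \<in> B" "height (wt b) = 0" by (auto simp: Bw_def height_def I4_def)
      then show "b \<in> {v0}" using wt_height by fastforce
    qed
  qed
  then show ?thesis by (simp add: mw_def mult_def)
qed

lemma numer_top: "numer (hw 1 + 3) (hw 2 + 2) (hw 3 + 1) (hw 4) = 1"
proof -
  define f where "f p q r s = mw (hw 1 + 3 - p) (hw 2 + 2 - q) (hw 3 + 1 - r) (hw 4 - s)" for p q r s
  \<comment> \<open>Every permutation of \<open>(3, 2, 1, 0)\<close> but the identity has a smaller
    partial sum and leads to a weight not below the highest one.\<close>
  have "f p q r s = 0" if "p < 3 \<or> p + q < 5 \<or> p + q + r < 6" for p q r s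
    using mw_nonzero[of "hw 1 + 3 - p" "hw 2 + 2 - q" "hw 3 + 1 - r" "hw 4 - s"] that
    unfolding dominated_def wvec_simps f_def by linarith
  moreover have "f 3 2 1 0 = 1" using mw_top by (simp add: f_def)
  ultimately have "alt4 f 3 2 1 0 = 1" by (simp add: alt_defs)
  then show ?thesis by (simp add: numer_def f_def[abs_def])
qed

text \<open>\<open>a\<close>, \<open>b\<close>, \<open>c\<close> are the coefficients of
  \<open>hw + (3, 2, 1, 0) - (x, y, z, w)\<close> over the simple roots. By
  \<open>numer_eigen\<close> this difference is orthogonal to the sum of the two vectors, whose
  product with each simple root is at least 1; hence the nonnegative coefficients vanish.\<close>

lemma numer_dominant:
  assumes "hw 1 \<ge> hw 2" "hw 2 \<ge> hw 3" "hw 3 \<ge> hw 4"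
    and "x \<ge> y" "y \<ge> z" "z \<ge> w" "numer x y z w \<noteq> 0"
  shows "x = hw 1 + 3 \<and> y = hw 2 + 2 \<and> z = hw 3 + 1 \<and> w = hw 4"
proof -
  define a b c where "a = hw 1 + 3 - x" and "b = hw 1 + hw 2 + 5 - x - y"
    and "c = hw 1 + hw 2 + hw 3 + 6 - x - y - z"
  have sum: "x + y + z + w = hw 1 + hw 2 + hw 3 + hw 4 + 6"
    and pos: "a \<ge> 0" "b \<ge> 0" "c \<ge> 0"
    using numer_nonzero[OF assms(7)] by (auto simp: a_def b_def c_def)
  have x: "x = hw 1 + 3 - a" and y: "y = hw 2 + 2 + a - b" and z: "z = hw 3 + 1 + b - c" and w: "w = hw 4 + c"
    using sum by (simp_all add: a_def b_def c_def)
  have "x\<^sup>2 + y\<^sup>2 + z\<^sup>2 + w\<^sup>2 - 3 * (x + y + z + w) + 4 - cas = 0"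
    using numer_eigen[of x y z w] assms(7) by simp
  then have "a * (hw 1 + 3 + x - (hw 2 + 2 + y)) + b * (hw 2 + 2 + y - (hw 3 + 1 + z)) +
      c * (hw 3 + 1 + z - (hw 4 + w)) = 0"
    unfolding sum unfolding x y z w cas_def by (simp add: power2_eq_square algebra_simps)
  moreover have "a * (hw 1 + 3 + x - (hw 2 + 2 + y)) \<ge> a * 1" "b * (hw 2 + 2 + y - (hw 3 + 1 + z)) \<ge> b * 1"
    "c * (hw 3 + 1 + z - (hw 4 + w)) \<ge> c * 1"
    by (rule mult_left_mono; use pos assms in simp)+
  ultimately have "a = 0" "b = 0" "c = 0" using pos by linarith+
  then show ?thesis using x y z w by simp
qed

lemma numer_eq:
  assumes "hw 1 \<ge> hw 2" "hw 2 \<ge> hw 3" "hw 3 \<ge> hw 4"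
  shows "numer x y z w = alt4 (\<lambda>p q r s. if x = p \<and> y = q \<and> z = r \<and> w = s then 1 else 0)
    (hw 1 + 3) (hw 2 + 2) (hw 3 + 1) (hw 4)" (is "_ = ?E x y z w")
proof (induction x y z w rule: symmetric4_wlog)
  case (1 x y z w)
  have "?E y x z w = - ?E x y z w" by (simp add: alt_defs conj_ac)
  then show ?case using 1 numer_antisym(1)[of y x z w] by simp
next
  case (2 x y z w)
  have "?E x z y w = - ?E x y z w" by (simp add: alt_defs conj_ac)
  then show ?case using 2 numer_antisym(2)[of x z y w] by simp
next
  case (3 x y z w)
  have "?E x y w z = - ?E x y z w" by (simp add: alt_defs conj_ac)
  then show ?case using 3 numer_antisym(3)[of x y w z] by simp
next
  case (4 x y z w)
  have "?E x y z w = (if x = hw 1 + 3 \<and> y = hw 2 + 2 \<and> z = hw 3 + 1 \<and> w = hw 4 then 1 else 0)"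
    by (rule alt4_indicator_sorted) (use 4 assms in simp_all)
  moreover have "numer x y z w = (if x = hw 1 + 3 \<and> y = hw 2 + 2 \<and> z = hw 3 + 1 \<and> w = hw 4 then 1 else 0)"
  proof (cases "x = hw 1 + 3 \<and> y = hw 2 + 2 \<and> z = hw 3 + 1 \<and> w = hw 4")
    case True
    then show ?thesis by (simp only: numer_top simp_thms if_True)
  next
    case False
    then have "numer x y z w = 0" using numer_dominant[OF assms 4] by blast
    then show ?thesis by (simp only: False if_False)
  qed
  ultimately show ?case by (simp only:)
qed

text \<open>Weyl's formula paired with an arbitrary function \<open>f\<close> on weights instead of
  formal exponentials; a suitable power of \<open>q\<close> as \<open>f\<close> restricts it to a
  one-parameter torus.\<close>

lemma weyl_character:
  fixes f :: "int \<Rightarrow> int \<Rightarrow> int \<Rightarrow> int \<Rightarrow> 'k::comm_ring_1"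
  assumes "hw 1 \<ge> hw 2" "hw 2 \<ge> hw 3" "hw 3 \<ge> hw 4"
  shows "(\<Sum>b\<in>B. alt4 (\<lambda>p q r s. f (wt b 1 + p) (wt b 2 + q) (wt b 3 + r) (wt b 4 + s)) 3 2 1 0) =
    alt4 f (hw 1 + 3) (hw 2 + 2) (hw 3 + 1) (hw 4)"
proof -
  define pt where "pt b p q r s = (wt b 1 + p, wt b 2 + q, wt b 3 + r, wt b 4 + s)" for b p q r s
  define f' where "f' = (\<lambda>(x, y, z, w). f x y z w)"
  let ?L = "{hw 1 + 3, hw 2 + 2, hw 3 + 1, hw 4}"
  \<comment> \<open>A finite set containing all shifted weights and all points on the right-hand
    side, so that both can be compared coefficientwise.\<close>
  define F where "F = (\<lambda>(b, p, q, r, s). pt b p q r s) ` (B \<times> {0, 1, 2, 3} \<times> {0, 1, 2, 3} \<times> {0, 1, 2, 3} \<times> {0, 1, 2, 3})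
    \<union> ?L \<times> ?L \<times> ?L \<times> ?L"
  have fin: "finite F" unfolding F_def using B(1) by (intro finite_UnI finite_imageI finite_cartesian_product) auto
  have fiber: "(\<Sum>b\<in>B. f' (pt b p q r s)) = (\<Sum>(x, y, z, w)\<in>F. of_int (mw (x - p) (y - q) (z - r) (w - s)) * f x y z w)"
    if "p \<in> {0, 1, 2, 3}" "q \<in> {0, 1, 2, 3}" "r \<in> {0, 1, 2, 3}" "s \<in> {0, 1, 2, 3}" for p q r s
  proof -
    have "(\<Sum>b\<in>B. f' (pt b p q r s)) = (\<Sum>v\<in>F. of_nat (card {b \<in> B. pt b p q r s = v}) * f' v)"
    proof (rule sum_fun_comp[OF B(1) fin])
      show "(\<lambda>b. pt b p q r s) ` B \<subseteq> F"
      proof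
        fix v assume "v \<in> (\<lambda>b. pt b p q r s) ` B"
        then obtain b where b: "b \<in> B" "v = pt b p q r s" by blast
        then have "v = (\<lambda>(b, p, q, r, s). pt b p q r s) (b, p, q, r, s)" by simp
        moreover have "(b, p, q, r, s) \<in> B \<times> {0, 1, 2, 3} \<times> {0, 1, 2, 3} \<times> {0, 1, 2, 3} \<times> {0, 1, 2, 3}"
          using that b(1) by (simp only: mem_Times_iff fst_conv snd_conv)
        ultimately show "v \<in> F" unfolding F_def by blast
      qed
    qed
    also have "\<dots> = (\<Sum>(x, y, z, w)\<in>F. of_int (mw (x - p) (y - q) (z - r) (w - s)) * f x y z w)"
    proof (intro sum.cong refl)
      fix v :: "int \<times> int \<times> int \<times> int"
      obtain x y z w where v: "v = (x, y, z, w)" by (metis prod_cases4)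
      have "{b \<in> B. pt b p q r s = v} = Bw (wvec (x - p) (y - q) (z - r) (w - s))"
        by (auto simp: v pt_def Bw_def I4_def)
      then show "of_nat (card {b \<in> B. pt b p q r s = v}) * f' v =
          (case v of (x, y, z, w) \<Rightarrow> of_int (mw (x - p) (y - q) (z - r) (w - s)) * f x y z w)"
        by (simp add: v f'_def mw_def mult_def)
    qed
    finally show ?thesis .
  qed
  have "(\<Sum>b\<in>B. alt4 (\<lambda>p q r s. f' (pt b p q r s)) 3 2 1 0) =
      alt4 (\<lambda>p q r s. \<Sum>b\<in>B. f' (pt b p q r s)) 3 2 1 0"
    by (simp add: alt_defs sum.distrib sum_subtractf)
  also have "\<dots> = alt4 (\<lambda>p q r s. \<Sum>(x, y, z, w)\<in>F. of_int (mw (x - p) (y - q) (z - r) (w - s)) * f x y z w) 3 2 1 0"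
    unfolding alt_defs by (simp only: fiber insert_iff simp_thms)
  also have "\<dots> = (\<Sum>(x, y, z, w)\<in>F. of_int (numer x y z w) * f x y z w)"
    by (simp add: alt_defs numer_def case_prod_beta sum.distrib sum_subtractf algebra_simps)
  also have "\<dots> = (\<Sum>v\<in>F. alt4 (\<lambda>p q r s. if v = (p, q, r, s) then f p q r s else 0)
      (hw 1 + 3) (hw 2 + 2) (hw 3 + 1) (hw 4))"
  proof (intro sum.cong refl)
    fix v :: "int \<times> int \<times> int \<times> int"
    obtain x y z w where v: "v = (x, y, z, w)" by (metis prod_cases4)
    have "of_int (alt4 (\<lambda>p q r s. if x = p \<and> y = q \<and> z = r \<and> w = s then 1 else 0) a b c d) * f x y z w =
        alt4 (\<lambda>p q r s. if x = p \<and> y = q \<and> z = r \<and> w = s then f p q r s else 0) a b c d" for a b c d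
    proof -
      have "of_int (if P then 1 else 0) * k = (if P then k else 0)" for P :: bool and k :: 'k by simp
      then have *: "of_int (if x = p \<and> y = q \<and> z = r \<and> w = s then 1 else 0) * f x y z w =
          (if x = p \<and> y = q \<and> z = r \<and> w = s then f p q r s else 0)" for p q r s by auto
      show ?thesis
        by (simp only: alt_defs of_int_diff of_int_add left_diff_distrib distrib_right *)
    qed
    then show "(case v of (x, y, z, w) \<Rightarrow> of_int (numer x y z w) * f x y z w) =
        alt4 (\<lambda>p q r s. if v = (p, q, r, s) then f p q r s else 0) (hw 1 + 3) (hw 2 + 2) (hw 3 + 1) (hw 4)"
      by (simp add: v numer_eq[OF assms])
  qed
  also have "\<dots> = alt4 (\<lambda>p q r s. \<Sum>v\<in>F. if v = (p, q, r, s) then f p q r s else 0)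
      (hw 1 + 3) (hw 2 + 2) (hw 3 + 1) (hw 4)"
    by (simp only: alt_defs sum.distrib sum_subtractf)
  also have "\<dots> = alt4 f (hw 1 + 3) (hw 2 + 2) (hw 3 + 1) (hw 4)"
  proof -
    have "(\<Sum>v\<in>F. if v = (p, q, r, s) then f p q r s else 0) = f p q r s"
      if "p \<in> ?L" "q \<in> ?L" "r \<in> ?L" "s \<in> ?L" for p q r s
    proof -
      have "(p, q, r, s) \<in> ?L \<times> ?L \<times> ?L \<times> ?L"
        using that by (simp only: mem_Times_iff fst_conv snd_conv)
      then have "(p, q, r, s) \<in> F" unfolding F_def by (rule UnI2)
      then show ?thesis using fin by simp
    qed
    then show ?thesis unfolding alt_defs by (simp only: insert_iff simp_thms)
  qed
  finally show ?thesis by (simp add: f'_def pt_def)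
qed

end

subsection \<open>Polynomials as nested coefficient lists\<close>

text \<open>The outermost list has the coefficients of the powers of \<open>z3\<close>, followed by \<open>z2\<close>, \<open>z1\<close> and
  finally \<open>q\<close>.\<close>

type_synonym pol4 = "int list list list list"

fun plus_list :: "('a \<Rightarrow> 'a \<Rightarrow> 'a) \<Rightarrow> 'a list \<Rightarrow> 'a list \<Rightarrow> 'a list" where
  "plus_list f [] ys = ys"
| "plus_list f (x # xs) [] = x # xs"
| "plus_list f (x # xs) (y # ys) = f x y # plus_list f xs ys"

definition plus4 :: "pol4 \<Rightarrow> pol4 \<Rightarrow> pol4" where
  "plus4 = plus_list (plus_list (plus_list (plus_list (+))))"

definition uminus4 :: "pol4 \<Rightarrow> pol4" where
  "uminus4 = map (map (map (map uminus)))"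

definition mon4 :: "nat \<times> nat \<times> nat \<times> nat \<Rightarrow> pol4 \<Rightarrow> pol4" where
  "mon4 = (\<lambda>(a, b, c, n) p. replicate c [] @ map (\<lambda>p. replicate b [] @ map (\<lambda>p.
     replicate a [] @ map (\<lambda>p. replicate n 0 @ p) p) p) p)"

text \<open>All factors in the certificates are differences of two monomials, so products reduce to
  shifting and subtracting lists.\<close>

definition binom4 :: "(nat \<times> nat \<times> nat \<times> nat) \<times> (nat \<times> nat \<times> nat \<times> nat) \<Rightarrow> pol4 \<Rightarrow> pol4" where
  "binom4 = (\<lambda>(m, m') p. plus4 (mon4 m p) (uminus4 (mon4 m' p)))"

text \<open>Lists may end in zeros, so the zero polynomial has many representations and is
  recognised by its coefficients.\<close>

definition zero4 :: "pol4 \<Rightarrow> bool" where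
  "zero4 = list_all (list_all (list_all (list_all (\<lambda>x. x = 0))))"

definition horner :: "('a \<Rightarrow> 'r::comm_ring_1) \<Rightarrow> 'r \<Rightarrow> 'a list \<Rightarrow> 'r" where
  "horner f t xs = foldr (\<lambda>x r. f x + t * r) xs 0"

definition eval4 :: "'r::comm_ring_1 \<Rightarrow> 'r \<Rightarrow> 'r \<Rightarrow> 'r \<Rightarrow> pol4 \<Rightarrow> 'r" where
  "eval4 x1 x2 x3 q = horner (horner (horner (horner of_int q) x1) x2) x3"

definition eval_mon :: "'r::comm_ring_1 \<Rightarrow> 'r \<Rightarrow> 'r \<Rightarrow> 'r \<Rightarrow> nat \<times> nat \<times> nat \<times> nat \<Rightarrow> 'r" where
  "eval_mon x1 x2 x3 q = (\<lambda>(a, b, c, n). x1 ^ a * x2 ^ b * x3 ^ c * q ^ n)"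

lemma horner_simps [simp]:
  "horner f t [] = 0" "horner f t (x # xs) = f x + t * horner f t xs"
  by (simp_all add: horner_def)

lemma horner_plus_list:
  assumes "\<And>x y. f (g x y) = f x + f y"
  shows "horner f t (plus_list g xs ys) = horner f t xs + horner f t ys"
proof (induction xs arbitrary: ys)
  case (Cons x xs)
  then show ?case by (cases ys) (simp_all add: assms algebra_simps)
qed simp

lemma horner_map:
  assumes "\<And>x. f (g x) = c * f x"
  shows "horner f t (map g xs) = c * horner f t xs"
  by (induction xs) (simp_all add: assms algebra_simps)

lemma horner_shift:
  assumes "f z = 0"
  shows "horner f t (replicate n z @ xs) = t ^ n * horner f t xs"
  by (induction n) (simp_all add: assms algebra_simps)

lemma horner_zero:
  assumes "\<And>x. Q x \<Longrightarrow> f x = 0" "list_all Q xs"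
  shows "horner f t xs = 0"
  using assms(2) by (induction xs) (simp_all add: assms(1))

lemma eval4_plus4: "eval4 x1 x2 x3 q (plus4 p r) = eval4 x1 x2 x3 q p + eval4 x1 x2 x3 q r"
  unfolding eval4_def plus4_def by (intro horner_plus_list) simp

lemma eval4_uminus4: "eval4 x1 x2 x3 q (uminus4 p) = - eval4 x1 x2 x3 q p"
proof -
  have "eval4 x1 x2 x3 q (uminus4 p) = (- 1) * eval4 x1 x2 x3 q p"
    unfolding eval4_def uminus4_def by (intro horner_map) simp
  then show ?thesis by simp
qed

lemma eval4_mon4: "eval4 x1 x2 x3 q (mon4 m p) = eval_mon x1 x2 x3 q m * eval4 x1 x2 x3 q p"
proof -
  obtain a b c n where m: "m = (a, b, c, n)" by (metis prod_cases4)
  let ?h1 = "horner of_int q" and ?m1 = "\<lambda>p. replicate n (0::int) @ p"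
  let ?h2 = "horner ?h1 x1" and ?m2 = "\<lambda>p. replicate a [] @ map ?m1 p"
  let ?h3 = "horner ?h2 x2" and ?m3 = "\<lambda>p. replicate b [] @ map ?m2 p"
  have 1: "?h1 (?m1 p) = q ^ n * ?h1 p" for p
    by (simp add: horner_shift)
  have 2: "?h2 (?m2 p) = x1 ^ a * q ^ n * ?h2 p" for p
    by (simp add: horner_shift horner_map[of ?h1, OF 1] mult_ac)
  have 3: "?h3 (?m3 p) = x2 ^ b * x1 ^ a * q ^ n * ?h3 p" for p
    by (simp add: horner_shift horner_map[of ?h2, OF 2] mult_ac)
  show ?thesis
    by (simp add: m eval4_def mon4_def eval_mon_def horner_shift horner_map[of ?h3, OF 3] mult_ac)
qed

lemma eval4_binom4:
  "eval4 x1 x2 x3 q (binom4 f p) =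
     (eval_mon x1 x2 x3 q (fst f) - eval_mon x1 x2 x3 q (snd f)) * eval4 x1 x2 x3 q p"
  by (simp add: binom4_def case_prod_beta eval4_plus4 eval4_uminus4 eval4_mon4 algebra_simps)

lemma eval4_zero4:
  assumes "zero4 p"
  shows "eval4 x1 x2 x3 q p = 0"
proof -
  have 1: "list_all (\<lambda>x. x = 0) xs \<Longrightarrow> horner of_int q xs = 0" for xs
    by (rule horner_zero[where Q = "\<lambda>x. x = 0"]) simp_all
  have 2: "list_all (list_all (\<lambda>x. x = 0)) xs \<Longrightarrow> horner (horner of_int q) x1 xs = 0" for xs
    using 1 by (rule horner_zero)
  have 3: "list_all (list_all (list_all (\<lambda>x. x = 0))) xs \<Longrightarrow>
      horner (horner (horner of_int q) x1) x2 xs = 0" for xs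
    using 2 by (rule horner_zero)
  show ?thesis
    unfolding eval4_def using 3 assms[unfolded zero4_def] by (rule horner_zero)
qed

lemma eval4_fold_binom4:
  "eval4 x1 x2 x3 q (fold binom4 fs p) =
     (\<Prod>f\<leftarrow>fs. eval_mon x1 x2 x3 q (fst f) - eval_mon x1 x2 x3 q (snd f)) * eval4 x1 x2 x3 q p"
  by (induction fs arbitrary: p) (simp_all add: eval4_binom4 mult_ac)

lemma horner_hom:
  assumes "\<And>x y. h (x + y) = h x + h y" "\<And>x y. h (x * y) = h x * h y" "h 0 = 0"
  shows "h (horner f t xs) = horner (\<lambda>x. h (f x)) (h t) xs"
  by (induction xs) (simp_all add: assms)

text \<open>For degree below \<open>n\<close> in \<open>q\<close> this is \<open>q^(n - 1)\<close>
  times the value at \<open>1/q\<close>; in \<open>eval4_reverse4\<close> a further factor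
  \<open>q\<close> removes the subtraction from the exponent.\<close>

definition reverse4 :: "nat \<Rightarrow> pol4 \<Rightarrow> pol4" where
  "reverse4 n = map (map (map (\<lambda>p. rev (p @ replicate (n - length p) 0))))"

definition short4 :: "nat \<Rightarrow> pol4 \<Rightarrow> bool" where
  "short4 n = list_all (list_all (list_all (\<lambda>p. length p \<le> n)))"

lemma horner_append: "horner f t (xs @ ys) = horner f t xs + t ^ length xs * horner f t ys"
  by (induction xs) (simp_all add: algebra_simps)

lemma horner_replicate_zero: "f z = 0 \<Longrightarrow> horner f t (replicate n z) = 0"
  by (induction n) simp_all

lemma horner_rev:
  assumes "q * r = 1"
  shows "q * horner f q (rev xs) = q ^ length xs * horner f r xs"
proof (induction xs)
  case (Cons x xs)
  have "q * horner f q (rev (x # xs)) = q ^ length xs * horner f r xs + q ^ Suc (length xs) * f x"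
    using Cons by (simp add: horner_append algebra_simps)
  also have "\<dots> = q ^ length xs * (q * r) * horner f r xs + q ^ Suc (length xs) * f x"
    by (simp add: assms)
  finally show ?case by (simp add: algebra_simps)
qed simp

lemma horner_map_all:
  assumes "\<And>x. Q x \<Longrightarrow> c * f (g x) = d * f' x" "list_all Q xs"
  shows "c * horner f t (map g xs) = d * horner f' t xs"
  using assms(2)
proof (induction xs)
  case (Cons x xs)
  have "c * horner f t (map g (x # xs)) = c * f (g x) + t * (c * horner f t (map g xs))"
    by (simp add: algebra_simps)
  also have "\<dots> = d * f' x + t * (d * horner f' t xs)"
    using Cons assms(1)[of x] by simp
  finally show ?case by (simp add: algebra_simps)
qed simp

lemma eval4_reverse4:
  assumes "q * r = 1" "short4 n p"
  shows "q * eval4 x1 x2 x3 q (reverse4 n p) = q ^ n * eval4 x1 x2 x3 r p"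
proof -
  let ?g1 = "\<lambda>p. rev (p @ replicate (n - length p) (0::int))"
  have 1: "q * horner of_int q (?g1 xs) = q ^ n * horner of_int r xs" if "length xs \<le> n" for xs
    using that
    by (simp only: horner_rev[OF assms(1)]) (simp add: horner_append horner_replicate_zero)
  have 2: "q * horner (horner of_int q) x1 (map ?g1 xs) = q ^ n * horner (horner of_int r) x1 xs"
    if "list_all (\<lambda>p. length p \<le> n) xs" for xs
    using 1 that by (rule horner_map_all)
  have 3: "q * horner (horner (horner of_int q) x1) x2 (map (map ?g1) xs) =
      q ^ n * horner (horner (horner of_int r) x1) x2 xs"
    if "list_all (list_all (\<lambda>p. length p \<le> n)) xs" for xs
    using 2 that by (rule horner_map_all)
  show ?thesis
    unfolding eval4_def reverse4_def using 3 assms(2)[unfolded short4_def] by (rule horner_map_all)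
qed

subsection \<open>A certificate for the generating function\<close>

text \<open>Both polynomials were found by expanding the series by computer: \<open>num4\<close> is \<open>q^4\<close> times
  the numerator of \<open>F\<close> over \<open>1 - z2\<close> and the factors \<open>1 - q^s zi\<close> for the nonzero weights \<open>s\<close> of the i-th
  fundamental representation, and \<open>cov4\<close> is the numerator of \<open>G\<close> over \<open>U\<close> and those factors with
  \<open>s > 0\<close>.\<close>

definition num4 :: pol4 where "num4 =
  [[[[0,0,0,0,1]],[[0,0,0,0,1],[0,-1,0,-1,0,-1,0,-1],[0,0,0,0,1]],[[],[],[0,0,0,0,1]]],[[[],[0,0,0,0,-1]],[[0,
     -1,0,-1,0,-1,0,-1],[1,0,1,0,1,0,1,0,1]],[[],[1,0,1,0,1,0,1,0,1],[0,-1,0,-1,0,-1,0,-1]],[[],[0,0,0,0,-1]]],[[],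
     [[0,0,0,0,1]],[[0,0,0,0,1],[0,-1,0,-1,0,-1,0,-1],[0,0,0,0,1]],[[],[],[0,0,0,0,1]]]]"

definition cov4 :: pol4 where "cov4 =
  [[[[1],[0,-1],[0,0,1]],[[0,0,-1],[0,1,0,1,0,1],[-1,0,0,0,-1,0,-1],[0,2],[0,0,-1,0,-1]],[[0,0,0,0,1],[0,0,0,0,
     0,-1,0,-1],[0,0,2,0,0,0,0,0,1],[0,0,0,-2,0,-2],[1,0,0,0,0,0,2],[0,-1,0,-1],[0,0,0,0,1]],[[],[],[0,0,0,0,-1,0,
     -1],[0,0,0,0,0,0,0,2],[0,0,-1,0,-1,0,0,0,-1],[0,0,0,1,0,1,0,1],[0,0,0,0,0,0,-1]],[[],[],[],[],[0,0,0,0,0,0,1],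
     [0,0,0,0,0,0,0,-1],[0,0,0,0,0,0,0,0,1]]],[[[0,-1],[0,0,2,0,1],[0,1,0,-1,0,-1],[],[0,1,0,-1],[0,0,-1]],[[0,1,0,
     1,0,1],[0,0,-1,0,-2,0,-3,0,-1],[0,2,0,0,0,0,0,2,0,1],[0,0,-2,0,-3],[0,-1,0,0,0,1,0,1],[1,0,0,0,0,0,1],[0,-2],
     [0,0,1,0,1]],[[0,0,0,0,0,-1,0,-1],[1,0,1,0,0,0,1,0,2,0,1],[0,-1,0,-3,0,-3,0,0,0,-1,0,-1],[1,0,1,0,1,0,5,0,2],
     [0,-2,0,-2,0,0,0,-1,0,-2],[0,0,-1,0,2,0,1],[0,0,0,2,0,1],[-1,0,0,0,0,0,-2],[0,1,0,1],[0,0,0,0,-1]],[[],[0,0,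
     -1,0,-1,0,-1],[0,0,0,1,0,1,0,3,0,1],[-1,0,-1,0,-2,0,-1,0,-2,0,-2],[0,1,0,2,0,3,0,2,0,1,0,1],[0,0,-1,0,-1,0,-1,
     0,-2,0,-1],[0,0,0,0,0,1,0,-1,0,1],[0,0,1,0,1,0,0,0,1],[0,0,0,-1,0,-1,0,-1],[0,0,0,0,0,0,1]],[[],[0,0,0,0,0,0,
     1],[0,0,0,0,0,0,0,-1],[0,0,1,0,1,0,1,0,1],[0,0,0,-1,0,-1,0,-2,0,-1],[0,0,0,0,1,0,1,0,2,0,1],[0,0,0,0,0,0,0,0,
     0,-1,0,-1],[0,0,0,0,0,0,-1],[0,0,0,0,0,0,0,1],[0,0,0,0,0,0,0,0,-1]],[[],[],[],[0,0,0,0,0,0,-1],[0,0,0,0,0,0,0,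
     1],[0,0,0,0,0,0,0,0,-1]]],[[[0,0,1],[0,1,0,-1,0,-1],[1,0,-1,0,0,0,1],[],[0,0,-1],[0,0,0,1],[0,0,0,0,-1]],[[-1,
     0,0,0,-1,0,-1],[0,2,0,0,0,0,0,2,0,1],[1,0,-3,0,-2,0,1,0,-1,0,-1],[0,-1,0,0,0,2],[0,0,1],[0,-2,0,-2,0,0,0,-1],
     [0,0,2,0,2,0,1,0,1],[0,0,0,-1,0,-1],[0,0,0,0,1]],[[0,0,2,0,0,0,0,0,1],[0,-1,0,-3,0,-3,0,0,0,-1,0,-1],[2,0,0,0,
     2,0,5,0,1,0,0,0,1],[0,-3,0,-2,0,0,0,-2,0,-2],[-1,0,1,0,3,0,0,0,1,0,1],[0,1,0,2,0,2,0,1],[-1,0,-1,0,-2,0,-3,0,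
     -2,0,-1],[0,2,0,2,0,1,0,2,0,1],[0,0,-1,0,-2,0,-1,0,-1],[0,0,0,0,0,1]],[[0,0,0,0,-1,0,-1],[0,0,0,1,0,1,0,3,0,
     1],[0,0,-3,0,-3,0,-1,0,-3,0,-2],[0,1,0,3,0,5,0,3,0,1,0,2],[-1,0,-1,0,-2,0,-4,0,-2,0,-1,0,-1],[0,0,0,0,0,2,0,0,
     0,0,0,1],[0,0,1,0,2,0,1,0,1,0,1],[0,-1,0,-1,0,-3,0,-2,0,-1,0,-1],[0,0,1,0,2,0,2,0,2,0,1],[0,0,0,0,0,-1,0,-1,0,
     -1]],[[],[0,0,0,0,0,0,0,-1],[0,0,0,0,1,0,2,0,2,0,1],[0,0,0,-1,0,-1,0,-3,0,-2,0,-1],[0,0,1,0,3,0,2,0,4,0,2],[0,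
     0,0,0,0,-1,0,-1,0,-3,0,-2],[0,0,0,0,0,0,0,0,-2,0,0,0,1],[0,0,0,1,0,0,0,1,0,1],[0,0,0,0,-1,0,-1,0,-2,0,-1],[0,
     0,0,0,0,0,0,0,0,1,0,1]],[[],[],[],[0,0,0,0,0,0,0,1],[0,0,0,0,0,0,-1,0,-2,0,-1],[0,0,0,0,0,0,0,0,0,1,0,1],[0,0,
     0,0,0,0,0,0,-1],[0,0,0,0,0,0,0,-1,0,1],[0,0,0,0,0,0,0,0,1]]],[[[],[],[],[1],[0,0,0,-1],[0,0,0,0,-1],[0,0,0,-1,
     0,1]],[[0,2],[0,0,-2,0,-3],[0,-1,0,0,0,2],[1,0,-1,0,-1],[0,-3,0,-1,0,1,0,1],[-1,0,2,0,3,0,1,0,1],[0,0,0,0,0,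
     -1,0,0,0,-1],[0,0,0,0,1,0,1],[0,0,0,1,0,-1]],[[0,0,0,-2,0,-2],[1,0,1,0,1,0,5,0,2],[0,-3,0,-2,0,0,0,-2,0,-2],
     [1,0,0,0,4,0,2],[0,0,0,2,0,1,0,1,0,-1],[-3,0,0,0,0,0,-4,0,-2,0,-1],[0,4,0,3,0,1,0,2,0,1,0,1],[0,0,-2,0,-4,0,
     -1,0,-2,0,-1],[0,0,0,1,0,1,0,0,0,1],[0,0,0,0,0,0,-1]],[[0,0,0,0,0,0,0,2],[-1,0,-1,0,-2,0,-1,0,-2,0,-2],[0,1,0,
     3,0,5,0,3,0,1,0,2],[-1,0,-3,0,-2,0,-5,0,-4,0,-1],[0,1,0,2,0,3,0,1,0,2],[-1,0,3,0,3,0,-1,0,1,0,1],[0,0,0,-3,0,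
     -5,0,-4,0,-1,0,-2],[1,0,1,0,2,0,6,0,2,0,1,0,1],[0,-1,0,-1,0,-2,0,-3,0,-1,0,-1],[0,0,0,0,1,0,0,0,1,0,1]],[[],
     [0,0,1,0,1,0,1,0,1],[0,0,0,-1,0,-1,0,-3,0,-2,0,-1],[1,0,1,0,3,0,3,0,3,0,3,0,1],[0,-1,0,-1,0,-3,0,-3,0,-3,0,
     -3],[0,0,2,0,1,0,-1,0,0,0,1,0,1],[0,0,0,0,0,-1,0,2,0,1,0,1],[0,0,-1,0,-2,0,-1,0,-4,0,-2],[0,0,0,1,0,2,0,1,0,2,
     0,2],[0,0,0,0,0,0,-2,0,0,0,0,0,-1]],[[],[0,0,0,0,0,0,-1],[0,0,0,0,0,0,0,1],[0,0,-1,0,-1,0,-1,0,-2],[0,0,0,1,0,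
     1,0,1,0,2,0,1],[0,0,0,0,-1,0,-2,0,-1,0,-1,0,-1],[0,0,0,0,0,0,0,0,0,1,0,1],[0,0,0,0,0,0,1,0,1],[0,0,0,0,0,0,0,
     -1,0,-1],[0,0,0,0,0,0,0,0,1,0,1]],[[],[],[],[0,0,0,0,0,0,1],[0,0,0,0,0,0,0,-1],[0,0,0,0,0,0,0,0,1]]],[[[],[0,
     1,0,-1],[0,0,-1],[0,0,0,-1],[0,0,0,0,0,0,1]],[[0,0,-1,0,-1],[0,-1,0,0,0,1,0,1],[0,0,1],[0,-3,0,-1,0,1,0,1],[1,
     0,2,0,3,0,1,0,-1,0,-1],[0,-1,0,-1,0,-1],[-1,0,0,0,2],[0,1,0,1],[0,0,0,0,-1]],[[1,0,0,0,0,0,2],[0,-2,0,-2,0,0,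
     0,-1,0,-2],[-1,0,1,0,3,0,0,0,1,0,1],[0,0,0,2,0,1,0,1,0,-1],[-2,0,-2,0,0,0,-3,0,-2,0,-1,0,1],[0,5,0,6,0,2,0,2,
     0,1],[-1,0,-2,0,-5,0,-3,0,-2],[0,1,0,1,0,2,0,-1],[1,0,0,0,-2],[0,-1,0,-1],[0,0,0,0,1]],[[0,0,-1,0,-1,0,0,0,
     -1],[0,1,0,2,0,3,0,2,0,1,0,1],[-1,0,-1,0,-2,0,-4,0,-2,0,-1,0,-1],[0,1,0,2,0,3,0,1,0,2],[1,0,0,0,1,0,1,0,-1,0,
     -1,0,1],[0,-2,0,-3,0,-5,0,-6,0,-1,0,-1],[0,0,3,0,5,0,6,0,5,0,3],[0,-2,0,-1,0,-4,0,-5,0,-3],[0,0,1,0,1,0,1,0,2,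
     0,1],[0,0,0,1,0,-1,0,1],[0,0,0,0,0,0,-1]],[[0,0,0,0,0,0,1],[0,0,0,-1,0,-1,0,-2,0,-1],[0,0,1,0,3,0,2,0,4,0,2],
     [0,-1,0,-1,0,-3,0,-3,0,-3,0,-3],[0,0,1,0,2,0,2,0,1,0,1,0,2],[0,1,0,1,0,-1,0,1],[0,0,0,0,-2,0,-3,0,-5,0,-2,0,
     -1],[0,1,0,1,0,2,0,1,0,3,0,4],[0,0,-1,0,-2,0,-3,0,-2,0,-1,0,-1],[0,0,0,0,0,0,0,1,0,2],[0,0,0,0,0,0,0,0,1]],
     [[],[0,0,0,0,0,0,0,1],[0,0,0,0,0,0,-1,0,-2,0,-1],[0,0,0,1,0,1,0,1,0,2,0,1],[0,0,0,0,-2,0,-2,0,-3,0,-2],[0,0,0,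
     -1,0,0,0,0,0,3,0,2],[0,0,0,0,0,0,0,0,2,0,0,0,-1],[0,0,0,-1,0,0,0,-1],[0,0,0,0,1,0,1,0,2,0,2],[0,0,0,0,0,0,0,0,
     0,0,0,-2]],[[],[],[],[0,0,0,0,0,0,0,-1],[0,0,0,0,0,0,0,0,2,0,1],[0,0,0,0,0,0,0,1,0,-1,0,-1],[],[0,0,0,0,0,0,0,
     1,0,-1],[0,0,0,0,0,0,0,0,-1]]],[[[],[0,0,-1],[0,0,0,1],[0,0,0,0,-1],[],[1,0,0,0,-1,0,1],[0,-1,0,-1,0,1],[0,0,
     0,0,1]],[[],[1,0,0,0,0,0,1],[0,-2,0,-2,0,0,0,-1],[-1,0,2,0,3,0,1,0,1],[0,-1,0,-1,0,-1],[-1,0,0,0,3,0,2,0,0,0,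
     -1],[0,2,0,3,0,0,0,0,0,-1],[-1,0,-1,0,-1,0,-2,0,-1],[0,1,0,1],[0,0,0,0,-1]],[[0,-1,0,-1],[0,0,-1,0,2,0,1],[0,
     1,0,2,0,2,0,1],[-3,0,0,0,0,0,-4,0,-2,0,-1],[0,5,0,6,0,2,0,2,0,1],[1,0,-2,0,-7,0,-3,0,-5,0,-2,0,1],[0,0,0,0,0,
     1,0,-1,0,1,0,1],[1,0,1,0,0,0,-1,0,1,0,2],[0,-2,0,-3,0,-1,0,-1],[0,0,1,0,2,0,1,0,1],[0,0,0,0,0,-1]],[[0,0,0,1,
     0,1,0,1],[0,0,-1,0,-1,0,-1,0,-2,0,-1],[0,0,0,0,0,2,0,0,0,0,0,1],[-1,0,3,0,3,0,-1,0,1,0,1],[0,-2,0,-3,0,-5,0,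
     -6,0,-1,0,-1],[1,0,3,0,5,0,6,0,5,0,3,0,1],[0,-1,0,-1,0,-6,0,-5,0,-3,0,-2],[0,0,1,0,1,0,-1,0,3,0,3,0,-1],[0,1,
     0,0,0,0,0,2],[0,0,-1,0,-2,0,-1,0,-1,0,-1],[0,0,0,0,0,1,0,1,0,1]],[[0,0,0,0,0,0,0,-1],[0,0,0,0,1,0,1,0,2,0,1],
     [0,0,0,0,0,-1,0,-1,0,-3,0,-2],[0,0,2,0,1,0,-1,0,0,0,1,0,1],[0,1,0,1,0,-1,0,1],[1,0,-2,0,-5,0,-3,0,-7,0,-2,0,
     1],[0,0,0,1,0,2,0,2,0,6,0,5],[0,0,-1,0,-2,0,-4,0,0,0,0,0,-3],[0,0,0,0,0,1,0,2,0,2,0,1],[0,0,0,0,0,0,1,0,2,0,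
     -1],[0,0,0,0,0,0,0,0,0,-1,0,-1]],[[],[0,0,0,0,0,0,0,0,-1],[0,0,0,0,0,0,0,0,0,1,0,1],[0,0,0,0,-1,0,-2,0,-1,0,
     -1,0,-1],[0,0,0,-1,0,0,0,0,0,3,0,2],[0,0,-1,0,0,0,2,0,3,0,0,0,-1],[0,0,0,0,0,0,0,-1,0,-1,0,-1],[0,0,0,0,1,0,1,
     0,3,0,2,0,-1],[0,0,0,0,0,-1,0,0,0,-2,0,-2],[0,0,0,0,0,0,1,0,0,0,0,0,1]],[[],[],[],[0,0,0,0,0,0,0,0,1],[0,0,0,
     0,0,0,0,1,0,-1,0,-1],[0,0,0,0,0,0,1,0,-1,0,0,0,1],[],[0,0,0,0,0,0,0,0,-1],[0,0,0,0,0,0,0,0,0,1],[0,0,0,0,0,0,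
     0,0,0,0,-1]]],[[[],[],[0,0,0,0,-1],[0,0,0,-1,0,1],[],[0,-1,0,-1,0,1],[0,0,1,0,2],[0,0,0,0,0,-1]],[[],[0,-2],
     [0,0,2,0,2,0,1,0,1],[0,0,0,0,0,-1,0,0,0,-1],[-1,0,0,0,2],[0,2,0,3,0,0,0,0,0,-1],[0,0,-2,0,-3,0,-2,0,-2],[0,1,
     0,2,0,1,0,1,0,1],[0,0,-1,0,-2,0,-1],[0,0,0,0,0,1]],[[0,0,0,0,1],[0,0,0,2,0,1],[-1,0,-1,0,-2,0,-3,0,-2,0,-1],
     [0,4,0,3,0,1,0,2,0,1,0,1],[-1,0,-2,0,-5,0,-3,0,-2],[0,0,0,0,0,1,0,-1,0,1,0,1],[2,0,1,0,1,0,2,0,2,0,1],[0,-3,0,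
     -3,0,-3,0,-3,0,-1,0,-1],[0,0,2,0,4,0,2,0,3,0,1],[0,0,0,-1,0,-2,0,-1,0,-1],[0,0,0,0,0,0,1]],[[0,0,0,0,0,0,-1],
     [0,0,0,0,0,1,0,-1,0,1],[0,0,1,0,2,0,1,0,1,0,1],[0,0,0,-3,0,-5,0,-4,0,-1,0,-2],[0,0,3,0,5,0,6,0,5,0,3],[0,-1,0,
     -1,0,-6,0,-5,0,-3,0,-2],[1,0,-1,0,-1,0,1,0,1,0,0,0,1],[0,0,0,2,0,1,0,3,0,2,0,1],[-1,0,-1,0,-2,0,-4,0,-2,0,-1,
     0,-1],[0,1,0,1,0,2,0,3,0,2,0,1],[0,0,0,0,-1,0,0,0,-1,0,-1]],[[0,0,0,0,0,0,0,0,1],[0,0,0,0,0,0,0,0,0,-1,0,-1],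
     [0,0,0,0,0,0,0,0,-2,0,0,0,1],[0,0,0,0,0,-1,0,2,0,1,0,1],[0,0,0,0,-2,0,-3,0,-5,0,-2,0,-1],[0,0,0,1,0,2,0,2,0,6,
     0,5],[1,0,-1,0,-2,0,-3,0,0,0,-2,0,-2],[0,0,0,-1,0,1,0,1,0,2],[0,0,1,0,1,0,0,0,3,0,1,0,-1],[0,0,0,-2,0,-1,0,0,
     0,-2,0,-2],[0,0,0,0,0,0,2,0,0,0,0,0,1]],[[],[],[0,0,0,0,0,0,0,0,-1],[0,0,0,0,0,0,0,0,0,1,0,1],[0,0,0,0,0,0,0,
     0,2,0,0,0,-1],[0,0,0,0,0,0,0,-1,0,-1,0,-1],[0,0,-1,0,-1,0,1,0,3,0,2,0,1],[0,0,0,0,0,1,0,1,0,-1,0,-3],[0,0,0,0,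
     0,0,0,0,0,0,1],[0,0,0,0,0,1,0,1,0,0,0,-1],[0,0,0,0,0,0,0,0,-1,0,-1]],[[],[],[],[],[],[],[0,0,0,0,0,0,1],[0,0,
     0,0,0,0,0,0,0,-1],[0,0,0,0,0,0,0,0,0,0,-1],[0,0,0,0,0,0,0,0,0,-1,0,1]]],[[[],[],[],[],[],[0,0,0,0,1],[0,0,0,0,
     0,-1],[0,0,0,0,0,0,1]],[[],[0,0,1,0,1],[0,0,0,-1,0,-1],[0,0,0,0,1,0,1],[0,1,0,1],[-1,0,-1,0,-1,0,-2,0,-1],[0,
     1,0,2,0,1,0,1,0,1],[0,0,0,0,-2,0,-1,0,-1,0,-1],[0,0,0,0,0,1],[0,0,0,0,0,0,-1]],[[],[-1,0,0,0,0,0,-2],[0,2,0,2,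
     0,1,0,2,0,1],[0,0,-2,0,-4,0,-1,0,-2,0,-1],[0,1,0,1,0,2,0,-1],[1,0,1,0,0,0,-1,0,1,0,2],[0,-3,0,-3,0,-3,0,-3,0,
     -1,0,-1],[1,0,3,0,3,0,3,0,3,0,1,0,1],[0,-1,0,-2,0,-3,0,-1,0,-1],[0,0,0,0,1,0,1,0,1,0,1]],[[],[0,0,1,0,1,0,0,0,
     1],[0,-1,0,-1,0,-3,0,-2,0,-1,0,-1],[1,0,1,0,2,0,6,0,2,0,1,0,1],[0,-2,0,-1,0,-4,0,-5,0,-3],[0,0,1,0,1,0,-1,0,3,
     0,3,0,-1],[0,0,0,2,0,1,0,3,0,2,0,1],[0,0,-1,0,-4,0,-5,0,-2,0,-3,0,-1],[0,2,0,1,0,3,0,5,0,3,0,1],[0,0,-2,0,-2,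
     0,-1,0,-2,0,-1,0,-1],[0,0,0,0,0,2]],[[],[0,0,0,0,0,0,-1],[0,0,0,1,0,0,0,1,0,1],[0,0,-1,0,-2,0,-1,0,-4,0,-2],
     [0,1,0,1,0,2,0,1,0,3,0,4],[0,0,-1,0,-2,0,-4,0,0,0,0,0,-3],[0,0,0,-1,0,1,0,1,0,2],[0,0,0,0,0,0,2,0,4,0,0,0,1],
     [0,0,0,-2,0,-2,0,0,0,-2,0,-3],[0,0,0,0,2,0,5,0,1,0,1,0,1],[0,0,0,0,0,0,0,-2,0,-2]],[[],[],[0,0,0,0,0,0,0,-1,0,
     1],[0,0,0,0,0,0,1,0,1],[0,0,0,-1,0,0,0,-1],[0,0,0,0,1,0,1,0,3,0,2,0,-1],[0,0,0,0,0,1,0,1,0,-1,0,-3],[0,0,0,0,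
     0,0,0,0,-1,0,-1,0,1],[0,0,0,0,0,0,0,2,0,0,0,-1],[0,0,0,0,0,0,0,0,-3,0,-2],[0,0,0,0,0,0,0,0,0,0,0,2]],[[],[],
     [],[],[0,0,0,0,0,0,0,1,0,-1],[0,0,0,0,0,0,0,0,-1],[0,0,0,0,0,0,0,0,0,-1],[0,0,0,0,0,0,0,0,0,0,0,0,1]]],[[],
     [[],[],[0,0,0,0,1],[0,0,0,1,0,-1],[0,0,0,0,-1],[0,1,0,1],[0,0,-1,0,-2,0,-1],[0,0,0,0,0,1]],[[],[0,1,0,1],[0,0,
     -1,0,-2,0,-1,0,-1],[0,0,0,1,0,1,0,0,0,1],[1,0,0,0,-2],[0,-2,0,-3,0,-1,0,-1],[0,0,2,0,4,0,2,0,3,0,1],[0,-1,0,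
     -2,0,-3,0,-1,0,-1],[0,0,1,0,2,0,2,0,1],[0,0,0,0,0,-1]],[[],[0,0,0,-1,0,-1,0,-1],[0,0,1,0,2,0,2,0,2,0,1],[0,-1,
     0,-1,0,-2,0,-3,0,-1,0,-1],[0,0,1,0,1,0,1,0,2,0,1],[0,1,0,0,0,0,0,2],[-1,0,-1,0,-2,0,-4,0,-2,0,-1,0,-1],[0,2,0,
     1,0,3,0,5,0,3,0,1],[0,0,-2,0,-3,0,-1,0,-3,0,-3],[0,0,0,1,0,3,0,1,0,1],[0,0,0,0,0,0,-1,0,-1]],[[],[0,0,0,0,0,0,
     0,1],[0,0,0,0,-1,0,-1,0,-2,0,-1],[0,0,0,1,0,2,0,1,0,2,0,2],[0,0,-1,0,-2,0,-3,0,-2,0,-1,0,-1],[0,0,0,0,0,1,0,2,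
     0,2,0,1],[0,0,1,0,1,0,0,0,3,0,1,0,-1],[0,0,0,-2,0,-2,0,0,0,-2,0,-3],[1,0,0,0,1,0,5,0,2,0,0,0,2],[0,-1,0,-1,0,
     0,0,-3,0,-3,0,-1],[0,0,0,0,1,0,0,0,0,0,2]],[[],[],[0,0,0,0,0,0,0,0,1],[0,0,0,0,0,0,0,-1,0,-1],[0,0,0,0,1,0,1,
     0,2,0,2],[0,0,0,0,0,-1,0,0,0,-2,0,-2],[0,0,0,0,0,0,0,0,0,0,1],[0,0,0,0,0,0,0,2,0,0,0,-1],[0,0,-1,0,-1,0,1,0,
     -2,0,-3,0,1],[0,0,0,1,0,2,0,0,0,0,0,2],[0,0,0,0,0,0,-1,0,-1,0,0,0,-1]],[[],[],[],[],[0,0,0,0,0,0,0,0,-1],[0,0,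
     0,0,0,0,0,0,0,1],[0,0,0,0,0,0,0,0,0,0,-1],[],[0,0,0,0,0,0,1,0,0,0,-1,0,1],[0,0,0,0,0,0,0,-1,0,-1,0,1],[0,0,0,
     0,0,0,0,0,0,0,1]]],[[],[[],[],[],[],[],[0,0,0,0,-1],[0,0,0,0,0,1],[0,0,0,0,0,0,-1]],[[],[0,0,0,0,-1],[0,0,0,0,
     0,1],[0,0,0,0,0,0,-1],[0,-1,0,-1],[0,0,1,0,2,0,1,0,1],[0,0,0,-1,0,-2,0,-1,0,-1],[0,0,0,0,1,0,1,0,1,0,1],[0,0,
     0,0,0,-1],[0,0,0,0,0,0,1]],[[],[0,0,0,0,0,0,1],[0,0,0,0,0,-1,0,-1,0,-1],[0,0,0,0,1,0,0,0,1,0,1],[0,0,0,1,0,-1,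
     0,1],[0,0,-1,0,-2,0,-1,0,-1,0,-1],[0,1,0,1,0,2,0,3,0,2,0,1],[0,0,-2,0,-2,0,-1,0,-2,0,-1,0,-1],[0,0,0,1,0,3,0,
     1,0,1],[0,0,0,0,0,0,-1,0,-1,0,-1]],[[],[0,0,0,0,0,0,0,0,-1],[0,0,0,0,0,0,0,0,0,1,0,1],[0,0,0,0,0,0,-2,0,0,0,0,
     0,-1],[0,0,0,0,0,0,0,1,0,2],[0,0,0,0,0,0,1,0,2,0,-1],[0,0,0,-2,0,-1,0,0,0,-2,0,-2],[0,0,0,0,2,0,5,0,1,0,1,0,
     1],[0,-1,0,-1,0,0,0,-3,0,-3,0,-1],[0,0,1,0,2,0,1,0,0,0,1,0,1],[0,0,0,0,0,-1,0,-1]],[[],[],[],[0,0,0,0,0,0,0,0,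
     1,0,1],[0,0,0,0,0,0,0,0,0,0,0,-2],[0,0,0,0,0,0,1,0,0,0,0,0,1],[0,0,0,0,0,1,0,1,0,0,0,-1],[0,0,0,0,0,0,0,0,-3,
     0,-2],[0,0,0,1,0,2,0,0,0,0,0,2],[0,0,0,0,-1,0,-3,0,-2,0,-1],[0,0,0,0,0,0,0,1,0,1,0,1]],[[],[],[],[],[],[0,0,0,
     0,0,0,0,0,0,0,-1],[0,0,0,0,0,0,0,0,0,-1,0,1],[],[0,0,0,0,0,0,0,-1,0,-1,0,1],[0,0,0,0,0,0,0,0,1,0,2],[0,0,0,0,
     0,0,0,0,0,0,0,-1]]],[[],[],[[],[],[],[],[0,0,0,0,1],[0,0,0,0,0,-1],[0,0,0,0,0,0,1]],[[],[],[],[],[0,0,0,0,0,0,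
     -1],[0,0,0,0,0,1,0,1,0,1],[0,0,0,0,-1,0,0,0,-1,0,-1],[0,0,0,0,0,2],[0,0,0,0,0,0,-1,0,-1]],[[],[],[],[],[0,0,0,
     0,0,0,0,0,1],[0,0,0,0,0,0,0,0,0,-1,0,-1],[0,0,0,0,0,0,2,0,0,0,0,0,1],[0,0,0,0,0,0,0,-2,0,-2],[0,0,0,0,1,0,0,0,
     0,0,2],[0,0,0,0,0,-1,0,-1],[0,0,0,0,0,0,0,0,1]],[[],[],[],[],[],[],[0,0,0,0,0,0,0,0,-1,0,-1],[0,0,0,0,0,0,0,0,
     0,0,0,2],[0,0,0,0,0,0,-1,0,-1,0,0,0,-1],[0,0,0,0,0,0,0,1,0,1,0,1],[0,0,0,0,0,0,0,0,0,0,-1]],[[],[],[],[],[],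
     [],[],[],[0,0,0,0,0,0,0,0,0,0,1],[0,0,0,0,0,0,0,0,0,0,0,-1],[0,0,0,0,0,0,0,0,0,0,0,0,1]]]]"

text \<open>The factors \<open>1 - q^s zi\<close>, multiplied by \<open>q^(-s)\<close> if \<open>s < 0\<close>.\<close>

definition fac1 :: "int \<Rightarrow> (nat \<times> nat \<times> nat \<times> nat) \<times> (nat \<times> nat \<times> nat \<times> nat)" where
  "fac1 s = ((0, 0, 0, nat (- s)), (1, 0, 0, nat s))"
definition fac2 :: "int \<Rightarrow> (nat \<times> nat \<times> nat \<times> nat) \<times> (nat \<times> nat \<times> nat \<times> nat)" where
  "fac2 s = ((0, 0, 0, nat (- s)), (0, 1, 0, nat s))"
definition fac3 :: "int \<Rightarrow> (nat \<times> nat \<times> nat \<times> nat) \<times> (nat \<times> nat \<times> nat \<times> nat)" where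
  "fac3 s = ((0, 0, 0, nat (- s)), (0, 0, 1, nat s))"

definition pos_facs where
  "pos_facs = [fac1 3, fac1 1, fac3 3, fac3 1, fac2 4, fac2 2]"

definition neg_facs where
  "neg_facs = [fac1 (- 3), fac1 (- 1), fac3 (- 3), fac3 (- 1), fac2 (- 4), fac2 (- 2)]"

text \<open>The factors of \<open>U\<close> other than \<open>1 - z2\<close>, which also divides the
  denominator of \<open>F\<close> and cancels.\<close>

definition U_facs where
  "U_facs = map (\<lambda>m. ((0, 0, 0, 0), m))
     [(4, 0, 0, 0), (3, 0, 1, 0), (1, 0, 3, 0), (0, 0, 4, 0), (0, 3, 0, 0), (2, 1, 0, 0), (0, 1, 2, 0)]"

text \<open>The equation between \<open>F\<close> and \<open>G\<close>, multiplied by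
  \<open>q\<close>, cleared of denominators and divided by \<open>q^2\<close>. The exponent 8 is
  \<open>14 - 4 - 2\<close>: \<open>neg_facs\<close> carries \<open>q^14\<close> and
  \<open>num4\<close> carries \<open>q^4\<close>. As \<open>cov4\<close> has degree 12 in
  \<open>q\<close>, \<open>reverse4 13\<close> represents its value at \<open>1/q\<close>.\<close>

lemma cov4_identity:
  "zero4 (plus4 (binom4 ((0, 0, 0, 8), (0, 0, 0, 10)) (fold binom4 U_facs num4))
     (plus4 (fold binom4 neg_facs cov4) (uminus4 (fold binom4 pos_facs (reverse4 13 cov4)))))"
  by code_simp

lemma short4_cov4: "short4 13 cov4"
  by code_simp

text \<open>A permutation of \<open>(3, 1, - 1, - 3)\<close> is given by its partial sums.\<close>

definition weyl_term :: "int \<Rightarrow> int \<Rightarrow> int \<Rightarrow> pol4" where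
  "weyl_term s1 s2 s3 =
     fold binom4 (map fac1 (filter (\<lambda>s. s \<noteq> s1) [3, 1, - 1, - 3]) @
         map fac2 (filter (\<lambda>s. s \<noteq> s2) [4, 2, 0, - 2, - 4]) @
         map fac3 (filter (\<lambda>s. s \<noteq> s3) [3, 1, - 1, - 3]))
       (mon4 (0, 0, 0, nat s1 + nat s2 + nat s3) [[[[1]]]])"

text \<open>\<open>True\<close> marks the even permutations.\<close>

definition weyl_terms :: "(bool \<times> int \<times> int \<times> int) list" where
  "weyl_terms = [(True, 3, 4, 3), (False, 3, 4, 1), (False, 3, 2, 3), (True, 3, 2, - 1),
     (True, 3, 0, 1), (False, 3, 0, - 1), (False, 1, 4, 3), (True, 1, 4, 1),
     (True, 1, 0, 3), (False, 1, 0, - 3), (False, 1, - 2, 1), (True, 1, - 2, - 3),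
     (True, - 1, 2, 3), (False, - 1, 2, - 1), (False, - 1, 0, 3), (True, - 1, 0, - 3),
     (True, - 1, - 4, - 1), (False, - 1, - 4, - 3), (False, - 3, 0, 1), (True, - 3, 0, - 1),
     (True, - 3, - 2, 1), (False, - 3, - 2, - 3), (False, - 3, - 4, - 1), (True, - 3, - 4, - 3)]"

definition weyl_sum :: pol4 where
  "weyl_sum = foldr (\<lambda>(e, s1, s2, s3) p.
     plus4 (if e then weyl_term s1 s2 s3 else uminus4 (weyl_term s1 s2 s3)) p) weyl_terms []"

text \<open>The binomials are, up to sign, \<open>q^(2 h) - 1\<close> for the heights
  \<open>h = 1, 1, 1, 2, 2, 3\<close> of the positive roots. Only the last is written in this order,
  so the product changes sign and the identity becomes a vanishing sum.\<close>

lemma weyl_identity: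
  "zero4 (plus4 weyl_sum (fold binom4 [((0,0,0,0),(0,0,0,2)), ((0,0,0,0),(0,0,0,2)), ((0,0,0,0),(0,0,0,2)),
     ((0,0,0,0),(0,0,0,4)), ((0,0,0,0),(0,0,0,4)), ((0,0,0,6),(0,0,0,0))] num4))"
  by code_simp

subsection \<open>The generating function\<close>

definition is_ring_hom :: "('r::comm_ring_1 \<Rightarrow> 's::comm_ring_1) \<Rightarrow> bool" where
  "is_ring_hom h \<longleftrightarrow> h 1 = 1 \<and> (\<forall>x y. h (x + y) = h x + h y) \<and> (\<forall>x y. h (x * y) = h x * h y)"

definition fps_map :: "('r \<Rightarrow> 's) \<Rightarrow> 'r fps \<Rightarrow> 's fps" where
  "fps_map h f = Abs_fps (\<lambda>n. h (fps_nth f n))"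

lemma fps_map_nth [simp]: "fps_nth (fps_map h f) n = h (fps_nth f n)"
  by (simp add: fps_map_def)

lemma additive_zero:
  fixes h :: "'r::ab_group_add \<Rightarrow> 's::ab_group_add"
  assumes "\<And>x y. h (x + y) = h x + h y"
  shows "h 0 = 0"
  using assms[of 0 0] by simp

lemma additive_sum:
  fixes h :: "'r::ab_group_add \<Rightarrow> 's::ab_group_add"
  assumes "\<And>x y. h (x + y) = h x + h y"
  shows "h (sum f A) = (\<Sum>x\<in>A. h (f x))"
  by (induction A rule: infinite_finite_induct) (simp_all add: assms additive_zero[of h])

lemma is_ring_homD:
  assumes "is_ring_hom h"
  shows "h 1 = 1" "h (x + y) = h x + h y" "h (x * y) = h x * h y" "h 0 = 0"
    "h (x - y) = h x - h y" "h (- x) = - h x" "h (x ^ n) = h x ^ n" "h (of_int k) = of_int k"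
proof -
  show 1: "h 1 = 1" and add: "\<And>x y. h (x + y) = h x + h y" and mult: "\<And>x y. h (x * y) = h x * h y"
    using assms by (auto simp: is_ring_hom_def)
  show 0: "h 0 = 0" using add by (rule additive_zero)
  show minus: "h (x - y) = h x - h y" for x y
    using add[of "x - y" y] by simp
  show "h (- x) = - h x" using minus[of 0 x] 0 by simp
  show "h (x ^ n) = h x ^ n" by (induction n) (simp_all add: 1 mult)
  show "h (of_int k) = of_int k"
    by (induction k rule: int_induct[of _ 0]) (simp_all add: 0 1 add minus)
qed

lemma is_ring_hom_fps_map:
  assumes "is_ring_hom h"
  shows "is_ring_hom (fps_map h)"
proof -
  note h = is_ring_homD[OF assms]
  show ?thesis
    unfolding is_ring_hom_def
    by (auto simp: fps_eq_iff h fps_mult_nth additive_sum[of h, OF h(2)])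
qed

lemma fps_map_const:
  fixes h :: "'r::comm_ring_1 \<Rightarrow> 's::comm_ring_1"
  assumes "h 0 = 0"
  shows "fps_map h (fps_const c) = fps_const (h c)"
  by (auto simp: fps_eq_iff assms)

lemma fps_map_X:
  fixes h :: "'r::comm_ring_1 \<Rightarrow> 's::comm_ring_1"
  assumes "h 0 = 0" "h 1 = 1"
  shows "fps_map h fps_X = fps_X"
  by (auto simp: fps_eq_iff assms fps_X_def)

abbreviation const3 :: "'r::comm_ring_1 \<Rightarrow> 'r fps fps fps" where
  "const3 c \<equiv> fps_const (fps_const (fps_const c))"
abbreviation X1 :: "'r::comm_ring_1 fps fps fps" where "X1 \<equiv> fps_const (fps_const fps_X)"
abbreviation X2 :: "'r::comm_ring_1 fps fps fps" where "X2 \<equiv> fps_const fps_X"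
abbreviation X3 :: "'r::comm_ring_1 fps fps fps" where "X3 \<equiv> fps_X"

abbreviation map3 :: "('r \<Rightarrow> 's) \<Rightarrow> 'r fps fps fps \<Rightarrow> 's fps fps fps" where
  "map3 h \<equiv> fps_map (fps_map (fps_map h))"

abbreviation eval3 :: "'r::comm_ring_1 \<Rightarrow> pol4 \<Rightarrow> 'r fps fps fps" where
  "eval3 q \<equiv> eval4 X1 X2 X3 (const3 q)"

definition gen3 :: "(nat \<Rightarrow> nat \<Rightarrow> nat \<Rightarrow> 'r) \<Rightarrow> 'r fps fps fps" where
  "gen3 f = Abs_fps (\<lambda>c. Abs_fps (\<lambda>b. Abs_fps (\<lambda>a. f a b c)))"

lemma is_ring_hom_map3: "is_ring_hom h \<Longrightarrow> is_ring_hom (map3 h)"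
  by (intro is_ring_hom_fps_map)

lemma map3_simps:
  assumes "is_ring_hom h"
  shows "map3 h (const3 c) = const3 (h c)" "map3 h X1 = X1" "map3 h X2 = X2" "map3 h X3 = X3"
proof -
  note h = is_ring_homD[OF assms]
  note h' = is_ring_homD[OF is_ring_hom_fps_map[OF assms]]
  note h'' = is_ring_homD[OF is_ring_hom_fps_map[OF is_ring_hom_fps_map[OF assms]]]
  show "map3 h (const3 c) = const3 (h c)" "map3 h X1 = X1" "map3 h X2 = X2" "map3 h X3 = X3"
    by (simp_all add: fps_map_const fps_map_X h h' h'')
qed

lemma map_eval4:
  assumes "is_ring_hom h"
  shows "h (eval4 x1 x2 x3 q p) = eval4 (h x1) (h x2) (h x3) (h q) p"
proof -
  note h = is_ring_homD[OF assms]
  show ?thesis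
    unfolding eval4_def by (simp add: horner_hom[of h, OF h(2,3,4)] h)
qed

lemma map_eval_mon:
  assumes "is_ring_hom h"
  shows "h (eval_mon x1 x2 x3 q m) = eval_mon (h x1) (h x2) (h x3) (h q) m"
  using is_ring_homD[OF assms] by (simp add: eval_mon_def case_prod_beta)

lemma map3_eval3:
  assumes "is_ring_hom h"
  shows "map3 h (eval3 q p) = eval3 (h q) p"
  using map_eval4[OF is_ring_hom_map3[OF assms]] by (simp add: map3_simps[OF assms])

lemma fps_unit:
  fixes f :: "'r::comm_ring_1 fps"
  assumes "fps_nth f 0 dvd 1"
  shows "f dvd 1"
proof -
  obtain k where "1 = fps_nth f 0 * k" using assms by (auto elim: dvdE)
  then have "f * fps_right_inverse f k = 1"
    by (intro fps_right_inverse) simp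
  then show ?thesis by (metis dvd_triv_left)
qed

lemma fps3_unit:
  fixes f :: "'r::comm_ring_1 fps fps fps"
  assumes "fps_nth (fps_nth (fps_nth f 0) 0) 0 = 1"
  shows "f dvd 1"
  by (intro fps_unit) (simp add: assms)

lemma fps_geometric:
  "(1 - fps_const i * fps_X) * Abs_fps (\<lambda>n. i ^ n) = (1 :: 'r::comm_ring_1 fps)"
proof -
  have "fps_nth ((1 - fps_const i * fps_X) * Abs_fps (\<lambda>n. i ^ n)) n = fps_nth 1 n" for n
    by (cases n) (simp_all add: left_diff_distrib mult.assoc)
  then show ?thesis by (simp add: fps_eq_iff)
qed

lemma gen3_geometric:
  "(1 - const3 i * X1) * (1 - const3 j * X2) * (1 - const3 l * X3) *
     gen3 (\<lambda>a b c. k * i ^ a * j ^ b * l ^ c) = const3 (k :: 'r::comm_ring_1)"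
proof -
  let ?G1 = "fps_const (fps_const (Abs_fps (\<lambda>n. i ^ n)))"
  let ?G2 = "fps_const (Abs_fps (\<lambda>n. fps_const (j ^ n)))"
  let ?G3 = "Abs_fps (\<lambda>n. fps_const (fps_const (l ^ n)))"
  have gen: "gen3 (\<lambda>a b c. k * i ^ a * j ^ b * l ^ c) = const3 k * ?G1 * ?G2 * ?G3"
    by (simp add: gen3_def fps_eq_iff mult_ac)
  have 1: "(1 - const3 i * X1) * ?G1 = 1"
    using arg_cong[OF fps_geometric[of i], of "\<lambda>x. fps_const (fps_const x)"]
    by (simp flip: fps_const_mult fps_const_sub)
  have "(1 - fps_const (fps_const j) * fps_X) * Abs_fps (\<lambda>n. fps_const (j ^ n)) = (1 :: 'r fps fps)"
    using fps_geometric[of "fps_const j"] by (simp add: fps_const_power)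
  from arg_cong[OF this, of fps_const] have 2: "(1 - const3 j * X2) * ?G2 = 1"
    by (simp flip: fps_const_mult fps_const_sub)
  have 3: "(1 - const3 l * X3) * ?G3 = 1"
    using fps_geometric[of "fps_const (fps_const l)"] by (simp add: fps_const_power)
  have "(1 - const3 i * X1) * (1 - const3 j * X2) * (1 - const3 l * X3) * (const3 k * ?G1 * ?G2 * ?G3)
      = const3 k * ((1 - const3 i * X1) * ?G1) * ((1 - const3 j * X2) * ?G2) * ((1 - const3 l * X3) * ?G3)"
    by (simp only: mult_ac)
  then show ?thesis unfolding gen by (simp only: 1 2 3 mult_1_right)
qed

text \<open>Substitution of a Laurent series for the variable, to be used with \<open>q\<close> and
  \<open>1/q\<close>.\<close>

definition poly_at :: "int fls \<Rightarrow> int poly \<Rightarrow> int fls" where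
  "poly_at x p = poly (map_poly of_int p) x"

lemma poly_at_pCons [simp]: "poly_at x (pCons a p) = of_int a + x * poly_at x p" "poly_at x 0 = 0"
  by (simp_all add: poly_at_def map_poly_pCons)

lemma is_ring_hom_poly_at: "is_ring_hom (poly_at x)"
proof -
  have add: "map_poly of_int (p + q) = (map_poly of_int p + map_poly of_int q :: int fls poly)" for p q
    by (rule poly_eqI) (simp add: coeff_map_poly)
  have mult: "map_poly of_int (p * q) = (map_poly of_int p * map_poly of_int q :: int fls poly)" for p q
    by (rule poly_eqI) (simp add: coeff_map_poly coeff_mult)
  show ?thesis
    by (simp add: is_ring_hom_def poly_at_def add mult map_poly_1)
qed

lemma poly_at_X_nth: "n < 0 \<Longrightarrow> fls_nth (poly_at fls_X p) n = 0"
  by (induction p arbitrary: n) (simp_all add: fls_X_times_conv_shift fls_of_int_nth)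

lemma poly_at_X_nth_0: "fls_nth (poly_at fls_X p) 0 = coeff p 0"
  by (cases p) (simp_all add: fls_X_times_conv_shift fls_of_int_nth poly_at_X_nth)

lemma poly_at_X_inv_nth: "n > 0 \<Longrightarrow> fls_nth (poly_at fls_X_inv p) n = 0"
  by (induction p arbitrary: n) (simp_all add: fls_X_inv_times_conv_shift fls_of_int_nth)

lemma is_ring_hom_of_int: "is_ring_hom (of_int :: int \<Rightarrow> 'r::comm_ring_1)"
  by (simp add: is_ring_hom_def)

lemma is_ring_hom_coeff_0: "is_ring_hom (\<lambda>p::'r::comm_ring_1 poly. coeff p 0)"
  by (simp add: is_ring_hom_def coeff_mult_0)

text \<open>Extracting a coefficient in \<open>q\<close> is not multiplicative, but it is linear
  over the integers, so a factor free of \<open>q\<close> such as \<open>U\<close> can be pulled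
  out.\<close>

lemma fps_map_semilinear:
  assumes add: "\<And>x y. L (x + y) = L x + L (y :: 's::comm_ring_1)"
    and lin: "\<And>c x. L (h c * x) = (c :: 'r::comm_ring_1) * L x"
  shows "fps_map L (x + y) = fps_map L x + fps_map L y"
    and "fps_map L (fps_map h u * f) = u * fps_map L f"
  by (simp_all add: fps_eq_iff add fps_mult_nth additive_sum[of L, OF add] lin)

lemma map3_semilinear:
  assumes add: "\<And>x y. L (x + y) = L x + L (y :: 's::comm_ring_1)"
    and lin: "\<And>c x. L (h c * x) = (c :: 'r::comm_ring_1) * L x"
  shows "map3 L (x + y) = map3 L x + map3 L y"
    and "map3 L (map3 h u * f) = u * map3 L f"
proof -
  note 1 = fps_map_semilinear[of L h, OF add lin]
  note 2 = fps_map_semilinear[of "fps_map L" "fps_map h", OF 1]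
  show "map3 L (x + y) = map3 L x + map3 L y" "map3 L (map3 h u * f) = u * map3 L f"
    using fps_map_semilinear[of "fps_map (fps_map L)" "fps_map (fps_map h)", OF 2] by blast+
qed

section \<open>Weyl's formula on the torus of the principal subgroup\<close>

definition qpow :: "int \<Rightarrow> int fls" where
  "qpow n = fls_shift (- n) 1"

lemma qpow_add: "qpow (m + n) = qpow m * qpow n"
  by (simp add: qpow_def fls_X_intpow_times_fls_X_intpow)

lemma qpow_0 [simp]: "qpow 0 = 1"
  by (simp add: qpow_def)

lemma qpow_of_nat: "qpow (int n) = fls_X ^ n"
  by (simp add: qpow_def fls_X_power_conv_shift_1)

lemma qpow_mult_of_nat: "qpow (m * int n) = qpow m ^ n"
  by (simp add: qpow_def fls_X_intpow_power mult.commute)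

lemma qpow_nat: "qpow (int (nat (- s))) * qpow s = qpow (int (nat s))"
  by (simp flip: qpow_add)

text \<open>The numerator of Weyl's formula restricted to the torus of the principal subgroup;
  \<open>weyl_alt 0 0 0\<close> is the denominator.\<close>

definition weyl_alt :: "nat \<Rightarrow> nat \<Rightarrow> nat \<Rightarrow> int fls" where
  "weyl_alt a b c = alt4 (\<lambda>x y z w. qpow (3 * x + y - z - 3 * w))
     (int a + int b + int c + 3) (int b + int c + 2) (int c + 1) 0"

text \<open>Summation by parts: the entries of the shifted highest weight have the successive
  differences \<open>a + 1\<close>, \<open>b + 1\<close>, \<open>c + 1\<close>, and their
  coefficients are partial sums of a permutation of \<open>(3, 1, -1, -3)\<close>.\<close>

lemma weyl_alt_eq:
  "weyl_alt a b c = (\<Sum>(e, s1, s2, s3)\<leftarrow>weyl_terms.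
     (if e then 1 else - 1) * qpow (s1 * (int a + 1) + s2 * (int b + 1) + s3 * (int c + 1)))"
  by (simp add: weyl_alt_def weyl_terms_def alt_defs algebra_simps)

definition eval_fac where
  "eval_fac q f = eval_mon X1 X2 X3 (const3 q) (fst f) - eval_mon X1 X2 X3 (const3 q) (snd f)"

abbreviation eval_facs where
  "eval_facs q fs \<equiv> \<Prod>f\<leftarrow>fs. eval_fac q f"

lemma eval3_fold_binom4:
  "eval3 q (fold binom4 fs p) = (eval_facs q fs) * eval3 q p"
  by (simp add: eval4_fold_binom4 eval_fac_def)

lemma const3_mult: "const3 (a * b) = const3 a * const3 (b :: 'r::comm_ring_1)"
  by simp

lemma const3_power: "const3 (a ^ n) = const3 (a :: 'r::comm_ring_1) ^ n"
  by (simp add: fps_const_power)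

lemma eval_fac_fac:
  "eval_fac fls_X (fac1 s) = const3 (qpow (int (nat (- s)))) * (1 - const3 (qpow s) * X1)"
  "eval_fac fls_X (fac2 s) = const3 (qpow (int (nat (- s)))) * (1 - const3 (qpow s) * X2)"
  "eval_fac fls_X (fac3 s) = const3 (qpow (int (nat (- s)))) * (1 - const3 (qpow s) * X3)"
  by (simp_all add: eval_fac_def eval_mon_def fac1_def fac2_def fac3_def right_diff_distrib
      qpow_nat mult.assoc[symmetric] const3_mult[symmetric] const3_power[symmetric] qpow_of_nat
      del: fps_const_mult of_nat_nat) (simp_all add: mult.commute flip: qpow_of_nat qpow_add)

text \<open>A product of three geometric series. The powers of \<open>q\<close> that clear negative
  exponents leave only the positive parts of \<open>s1\<close>, \<open>s2\<close>,
  \<open>s3\<close>.\<close>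

lemma eval_fac_gen3:
  "eval_fac fls_X (fac1 s1) * eval_fac fls_X (fac2 s2) * eval_fac fls_X (fac3 s3) *
     gen3 (\<lambda>a b c. qpow (s1 * (int a + 1) + s2 * (int b + 1) + s3 * (int c + 1))) =
   const3 fls_X ^ (nat s1 + nat s2 + nat s3)" (is "?l * gen3 ?f = _")
proof -
  let ?n = "\<lambda>s. const3 (qpow (int (nat (- s))))"
  have f: "?f = (\<lambda>a b c. qpow (s1 + s2 + s3) * qpow s1 ^ a * qpow s2 ^ b * qpow s3 ^ c)"
    by (intro ext) (simp add: algebra_simps flip: qpow_add qpow_mult_of_nat)
  have "?l * gen3 ?f = ?n s1 * ?n s2 * ?n s3 *
      ((1 - const3 (qpow s1) * X1) * (1 - const3 (qpow s2) * X2) * (1 - const3 (qpow s3) * X3) * gen3 ?f)"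
    unfolding eval_fac_fac by (simp only: mult_ac)
  also have "\<dots> = ?n s1 * ?n s2 * ?n s3 * const3 (qpow (s1 + s2 + s3))"
    unfolding f gen3_geometric ..
  also have "\<dots> = const3 (qpow (int (nat (- s1)) + int (nat (- s2)) + int (nat (- s3)) + (s1 + s2 + s3)))"
    by (simp add: qpow_add)
  also have "int (nat (- s1)) + int (nat (- s2)) + int (nat (- s3)) + (s1 + s2 + s3) =
      int (nat s1 + nat s2 + nat s3)" by simp
  finally show ?thesis by (simp only: qpow_of_nat const3_power)
qed

text \<open>The weights of the fundamental representations. The weight 0 of the second one has
  multiplicity 2 but is listed once, since each term of Weyl's formula contributes only one factor
  in \<open>z2\<close>.\<close>

definition all_facs where
  "all_facs = map fac1 [3, 1, - 1, - 3] @ map fac2 [4, 2, 0, - 2, - 4] @ map fac3 [3, 1, - 1, - 3]"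

lemma prod_list_filter_neq:
  fixes f :: "'a \<Rightarrow> 'r::comm_monoid_mult"
  assumes "distinct xs" "x \<in> set xs"
  shows "(\<Prod>y\<leftarrow>filter (\<lambda>y. y \<noteq> x) xs. f y) * f x = (\<Prod>y\<leftarrow>xs. f y)"
  using assms
proof (induction xs)
  case (Cons y ys)
  show ?case
  proof (cases "x = y")
    case True
    with Cons.prems have "filter (\<lambda>y. y \<noteq> x) ys = ys" by (auto intro: filter_True)
    with True show ?thesis by (simp add: mult.commute)
  next
    case False
    with Cons show ?thesis by (simp add: mult.assoc)
  qed
qed simp

lemma all_facs_gen3:
  assumes "s1 \<in> {3, 1, - 1, - 3}" "s2 \<in> {4, 2, 0, - 2, - 4}" "s3 \<in> {3, 1, - 1, - 3}"
  shows "(eval_facs fls_X all_facs) *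
      gen3 (\<lambda>a b c. qpow (s1 * (int a + 1) + s2 * (int b + 1) + s3 * (int c + 1))) =
    eval3 fls_X (weyl_term s1 s2 s3)"
proof -
  let ?e = "eval_fac fls_X"
  let ?g = "gen3 (\<lambda>a b c. qpow (s1 * (int a + 1) + s2 * (int b + 1) + s3 * (int c + 1)))"
  let ?p1 = "\<Prod>s\<leftarrow>filter (\<lambda>s. s \<noteq> s1) [3, 1, - 1, - 3]. ?e (fac1 s)"
  let ?p2 = "\<Prod>s\<leftarrow>filter (\<lambda>s. s \<noteq> s2) [4, 2, 0, - 2, - 4]. ?e (fac2 s)"
  let ?p3 = "\<Prod>s\<leftarrow>filter (\<lambda>s. s \<noteq> s3) [3, 1, - 1, - 3]. ?e (fac3 s)"
  have f1: "?p1 * ?e (fac1 s1) = (\<Prod>s\<leftarrow>[3, 1, - 1, - 3]. ?e (fac1 s))"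
    by (rule prod_list_filter_neq) (use assms in auto)
  have f2: "?p2 * ?e (fac2 s2) = (\<Prod>s\<leftarrow>[4, 2, 0, - 2, - 4]. ?e (fac2 s))"
    by (rule prod_list_filter_neq) (use assms in auto)
  have f3: "?p3 * ?e (fac3 s3) = (\<Prod>s\<leftarrow>[3, 1, - 1, - 3]. ?e (fac3 s))"
    by (rule prod_list_filter_neq) (use assms in auto)
  have prod: "(\<Prod>f\<leftarrow>all_facs. ?e f) = (?p1 * ?e (fac1 s1)) * ((?p2 * ?e (fac2 s2)) * (?p3 * ?e (fac3 s3)))"
    unfolding f1 f2 f3 all_facs_def map_append prod_list.append list.map map_map o_def ..
  have "(\<Prod>f\<leftarrow>all_facs. ?e f) * ?g = ?p1 * (?p2 * ?p3) *
      (?e (fac1 s1) * ?e (fac2 s2) * ?e (fac3 s3) * ?g)"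
    unfolding prod by (simp only: mult_ac)
  also have "\<dots> = ?p1 * (?p2 * ?p3) * const3 fls_X ^ (nat s1 + nat s2 + nat s3)"
    by (simp only: eval_fac_gen3)
  also have "\<dots> = eval3 fls_X (weyl_term s1 s2 s3)"
  proof -
    have 1: "eval3 (fls_X :: int fls) [[[[1]]]] = 1"
      by (simp add: eval4_def)
    have 2: "eval_mon X1 X2 X3 (const3 fls_X :: int fls fps fps fps) (0, 0, 0, n) = const3 fls_X ^ n" for n
      by (simp add: eval_mon_def)
    show ?thesis
      unfolding weyl_term_def eval3_fold_binom4 eval4_mon4 map_append prod_list.append map_map o_def 1 2
      by (simp only: mult_1_right)
  qed
  finally show ?thesis .
qed

lemma gen3_add: "gen3 (\<lambda>a b c. f a b c + g a b c) = gen3 f + gen3 (g :: _ \<Rightarrow> _ \<Rightarrow> _ \<Rightarrow> 'r::comm_ring_1)"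
  by (simp add: gen3_def fps_eq_iff)

lemma gen3_const_mult: "gen3 (\<lambda>a b c. k * f a b c) = const3 k * gen3 (f :: _ \<Rightarrow> _ \<Rightarrow> _ \<Rightarrow> 'r::comm_ring_1)"
  by (simp add: gen3_def fps_eq_iff)

lemma gen3_uminus: "gen3 (\<lambda>a b c. - f a b c) = - gen3 (f :: _ \<Rightarrow> _ \<Rightarrow> _ \<Rightarrow> 'r::comm_ring_1)"
  by (simp add: gen3_def fps_eq_iff)

lemma all_facs_weyl_alt:
  "(eval_facs fls_X all_facs) * gen3 weyl_alt = eval3 fls_X weyl_sum"
proof -
  let ?D = "eval_facs fls_X all_facs"
  have "?D * gen3 (\<lambda>a b c. \<Sum>(e, s1, s2, s3)\<leftarrow>ws. (if e then 1 else - 1) *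
      qpow (s1 * (int a + 1) + s2 * (int b + 1) + s3 * (int c + 1))) =
    eval3 fls_X (foldr (\<lambda>(e, s1, s2, s3) p.
     plus4 (if e then weyl_term s1 s2 s3 else uminus4 (weyl_term s1 s2 s3)) p) ws [])"
    if "list_all (\<lambda>(e, s1, s2, s3). s1 \<in> {3, 1, - 1, - 3} \<and> s2 \<in> {4, 2, 0, - 2, - 4} \<and>
      s3 \<in> {3, 1, - 1, - 3}) ws" for ws
    using that
  proof (induction ws)
    case Nil
    then show ?case by (simp add: eval4_def gen3_def flip: fps_zero_def)
  next
    case (Cons w ws)
    obtain e s1 s2 s3 where w: "w = (e, s1, s2, s3)" by (metis prod_cases4)
    from Cons.prems have s: "s1 \<in> {3, 1, - 1, - 3}" "s2 \<in> {4, 2, 0, - 2, - 4}" "s3 \<in> {3, 1, - 1, - 3}"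
      by (simp_all add: w)
    let ?g = "\<lambda>a b c. qpow (s1 * (int a + 1) + s2 * (int b + 1) + s3 * (int c + 1))"
    have "?D * gen3 (\<lambda>a b c. (if e then 1 else - 1) * ?g a b c) =
        eval3 fls_X (if e then weyl_term s1 s2 s3 else uminus4 (weyl_term s1 s2 s3))"
      using all_facs_gen3[OF s] by (cases e) (simp_all add: gen3_uminus eval4_uminus4)
    moreover note Cons.IH
    moreover have "list_all (\<lambda>(e, s1, s2, s3). s1 \<in> {3, 1, - 1, - 3} \<and> s2 \<in> {4, 2, 0, - 2, - 4} \<and>
        s3 \<in> {3, 1, - 1, - 3}) ws"
      using Cons.prems by simp
    ultimately show ?case
      by (simp only: w list.map sum_list.Cons prod.case gen3_add distrib_left foldr.simps o_apply
          eval4_plus4)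
  qed
  from this[of weyl_terms] show ?thesis
    unfolding weyl_sum_def weyl_alt_eq by (simp add: weyl_terms_def weyl_alt_eq[abs_def])
qed


definition delta3 :: "int fls fps fps fps" where
  "delta3 = (const3 fls_X ^ 2 - 1) ^ 3 * (const3 fls_X ^ 4 - 1) ^ 2 * (const3 fls_X ^ 6 - 1)"

lemma is_ring_hom_const3: "is_ring_hom (\<lambda>c. const3 c)"
  by (simp add: is_ring_hom_def)

text \<open>The product formula for the Weyl denominator; 10 is the sum of the heights of the
  positive roots.\<close>

lemma weyl_alt_0: "const3 fls_X ^ 10 * const3 (weyl_alt 0 0 0) = delta3"
proof -
  \<comment> \<open>All exponents are even, so the factorisation is checked in the variable
    \<open>q^2\<close>.\<close>
  define Q where "Q = fls_X ^ 2 * (1 :: int fls)"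
  have Q: "fls_X ^ (2 * n) = Q ^ n" for n
    by (simp add: Q_def power_mult)
  have "fls_X ^ 10 * weyl_alt 0 0 0 = (fls_X ^ 2 - 1) ^ 3 * (fls_X ^ 4 - 1) ^ 2 * (fls_X ^ 6 - 1 :: int fls)"
  proof -
    have shift: "fls_X ^ 10 * qpow n = qpow (10 + n)" for n
      by (simp add: qpow_add qpow_of_nat[of 10, simplified])
    have shift': "fls_X ^ 10 * (numeral k * x) = numeral k * (fls_X ^ 10 * x :: int fls)" for k x
      by (rule mult.left_commute)
    have q: "qpow (numeral n) = fls_X ^ numeral n" for n
      using qpow_of_nat[of "numeral n"] by simp
    have "fls_X ^ 10 * weyl_alt 0 0 0 = Q^10 - 3 * Q^9 + Q^8 + 4 * Q^7 - 2 * Q^6 - 2 * Q^5 - 2 * Q^4 + 4 * Q^3 + Q^2 - 3 * Q + 1"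
      by (simp add: weyl_alt_def alt_defs ring_distribs shift shift' q flip: power_add Q[of 10, simplified] Q[of 9, simplified] Q[of 8, simplified] Q[of 7, simplified] Q[of 6, simplified] Q[of 5, simplified] Q[of 4, simplified] Q[of 3, simplified] Q[of 2, simplified] Q[of 1, simplified])
    also have "\<dots> = (Q - 1) ^ 3 * (Q ^ 2 - 1) ^ 2 * (Q ^ 3 - 1)"
      by algebra
    finally show ?thesis by (simp add: Q[of 1, simplified] Q[of 2, simplified] Q[of 3, simplified])
  qed
  from arg_cong[OF this, of const3] show ?thesis
    unfolding delta3_def by (simp only: is_ring_homD[OF is_ring_hom_const3])
qed

lemma delta3_nonzero: "delta3 \<noteq> 0"
proof -
  have "const3 fls_X ^ n - 1 \<noteq> (0 :: int fls fps fps fps)" if "n > 0" for n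
  proof
    assume "const3 fls_X ^ n - 1 = (0 :: int fls fps fps fps)"
    then have "const3 (fls_X ^ n :: int fls) = const3 1" by (simp add: fps_const_power)
    from arg_cong[OF this, of "\<lambda>f. fps_nth (fps_nth (fps_nth f 0) 0) 0"]
    have "(fls_X ^ n :: int fls) = 1" by simp
    from arg_cong[OF this, of "\<lambda>f. fls_nth f 0"] show False using that by simp
  qed
  then show ?thesis by (simp add: delta3_def)
qed

lemma eval4_weyl_sum:
  "eval4 x1 x2 x3 q weyl_sum = (q ^ 2 - 1) ^ 3 * (q ^ 4 - 1) ^ 2 * (q ^ 6 - 1) * eval4 x1 x2 x3 q num4"
proof -
  have "eval4 x1 x2 x3 q weyl_sum + (1 - q ^ 2) ^ 3 * (1 - q ^ 4) ^ 2 * (q ^ 6 - 1) * eval4 x1 x2 x3 q num4 = 0"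
    using eval4_zero4[OF weyl_identity, of x1 x2 x3 q]
    by (simp add: eval4_plus4 eval4_binom4 eval_mon_def power2_eq_square power3_eq_cube mult_ac)
  moreover have "(1 - q ^ 2) ^ 3 = - ((q ^ 2 - 1) ^ 3)" "(1 - q ^ 4) ^ 2 = (q ^ 4 - 1) ^ 2"
    by (simp_all add: power3_eq_cube power2_eq_square algebra_simps)
  ultimately show ?thesis by (simp add: eq_neg_iff_add_eq_0)
qed

lemma eval3_weyl_sum: "eval3 fls_X weyl_sum = delta3 * eval3 fls_X num4"
  unfolding eval4_weyl_sum delta3_def ..

text \<open>The Weyl denominator occurs as \<open>delta3\<close> on both sides and cancels in this
  integral domain.\<close>

lemma gen3_character:
  assumes "\<And>a b c. ch a b c * weyl_alt 0 0 0 = weyl_alt a b c"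
  shows "(eval_facs fls_X all_facs) * gen3 ch = const3 fls_X ^ 10 * eval3 fls_X num4"
proof -
  let ?D = "eval_facs fls_X all_facs"
  have "gen3 weyl_alt = gen3 (\<lambda>a b c. weyl_alt 0 0 0 * ch a b c)"
    using assms by (simp add: mult.commute)
  also have "\<dots> = const3 (weyl_alt 0 0 0) * gen3 ch"
    by (rule gen3_const_mult)
  finally have "const3 fls_X ^ 10 * gen3 weyl_alt = delta3 * gen3 ch"
    by (simp only: weyl_alt_0[symmetric] mult.assoc)
  then have "delta3 * (?D * gen3 ch) = const3 fls_X ^ 10 * (?D * gen3 weyl_alt)"
    by (simp only: mult.left_commute[of delta3 ?D] mult.left_commute[of "const3 fls_X ^ 10" ?D])
  also have "\<dots> = delta3 * (const3 fls_X ^ 10 * eval3 fls_X num4)"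
    by (simp only: all_facs_weyl_alt eval3_weyl_sum mult.left_commute[of delta3])
  finally show ?thesis by (simp only: mult_left_cancel[OF delta3_nonzero])
qed

section \<open>From characters to invariants\<close>

lemma eval4_cov4_identity:
  "q ^ 8 * (q ^ 2 - 1) * eval4 x1 x2 x3 q (fold binom4 U_facs num4) =
     eval4 x1 x2 x3 q (fold binom4 neg_facs cov4) -
     eval4 x1 x2 x3 q (fold binom4 pos_facs (reverse4 13 cov4))"
proof -
  have "(q ^ 8 - q ^ 10) * eval4 x1 x2 x3 q (fold binom4 U_facs num4) +
     (eval4 x1 x2 x3 q (fold binom4 neg_facs cov4) -
      eval4 x1 x2 x3 q (fold binom4 pos_facs (reverse4 13 cov4))) = 0"
    using eval4_zero4[OF cov4_identity, of x1 x2 x3 q]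
    by (simp add: eval4_plus4 eval4_uminus4 eval4_binom4 eval_mon_def)
  moreover have "q ^ 8 * (q ^ 2 - 1) * x = y - ((q ^ 8 - q ^ 10) * x + y)" for x y
    by (simp add: algebra_simps flip: power_add)
  ultimately show ?thesis by (simp add: neg_eq_iff_add_eq_0)
qed

lemmas eval3_cov4_identity =
  eval4_cov4_identity[of "const3 fls_X" X1 X2 X3, unfolded eval3_fold_binom4]

lemma all_facs_split:
  "(eval_facs q all_facs) =
     (eval_facs q pos_facs) * (eval_facs q neg_facs) * (1 - X2)"
proof -
  have "eval_fac q (fac2 0) = 1 - X2" by (simp add: eval_fac_def eval_mon_def fac2_def)
  then show ?thesis
    by (simp only: all_facs_def pos_facs_def neg_facs_def list.map map_append append.simps
        prod_list.Cons prod_list.Nil mult_ac mult_1_right mult_1_left)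
qed

lemma U_eq: "U = (eval_facs 0 U_facs) * (1 - X2)"
  by (simp add: U_def U_facs_def eval_fac_def eval_mon_def z1_def z2_def z3_def mult_ac)

lemma map3_eval_fac:
  assumes "is_ring_hom h"
  shows "map3 h (eval_fac q f) = eval_fac (h q) f"
  using map_eval_mon[OF is_ring_hom_map3[OF assms]] is_ring_homD(5)[OF is_ring_hom_map3[OF assms]]
  by (simp add: eval_fac_def map3_simps[OF assms])

lemma map3_prod_eval_fac:
  assumes "is_ring_hom h"
  shows "map3 h (eval_facs q fs) = (eval_facs (h q) fs)"
  by (induction fs) (simp_all add: map3_eval_fac[OF assms] is_ring_homD[OF is_ring_hom_map3[OF assms]])

lemma map3_U: "map3 of_int U = (eval_facs fls_X U_facs) * (1 - X2 :: int fls fps fps fps)"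
proof -
  note h = is_ring_homD[OF is_ring_hom_map3[OF is_ring_hom_of_int]]
  have "map3 of_int (1 - X2) = (1 - X2 :: int fls fps fps fps)"
    by (simp only: h map3_simps[OF is_ring_hom_of_int])
  moreover have "(eval_facs (of_int 0) U_facs) = (eval_facs (fls_X :: int fls) U_facs)"
    by (simp add: U_facs_def eval_fac_def eval_mon_def)
  ultimately show ?thesis
    by (simp only: U_eq h map3_prod_eval_fac[OF is_ring_hom_of_int])
qed

text \<open>Invertibility of \<open>U\<close> gives the quotient \<open>P / U\<close> its meaning as
  a power series.\<close>

lemma U_unit: "U dvd 1"
  by (rule fps3_unit) (simp add: U_def z1_def z2_def z3_def fps_nth_power_0)

lemma pos_facs_unit: "(eval_facs q pos_facs) dvd 1"
  by (rule fps3_unit)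
    (simp add: pos_facs_def eval_fac_def eval_mon_def fac1_def fac2_def fac3_def fps_nth_power_0)

text \<open>The exponent 14 is the sum \<open>3 + 1 + 3 + 1 + 4 + 2\<close> of the weights in
  \<open>pos_facs\<close>.\<close>

lemma neg_facs_eq:
  "(eval_facs (fls_X :: int fls) neg_facs) = const3 fls_X ^ 14 * (eval_facs fls_X_inv pos_facs)"
proof -
  have X: "fls_X ^ n * fls_X_inv ^ n = (1 :: int fls)" for n
    by (simp add: fls_X_times_conv_shift flip: power_mult_distrib)
  have e: "eval_fac (fls_X :: int fls) (fac1 (- int n)) = const3 fls_X ^ n * eval_fac fls_X_inv (fac1 (int n))"
    "eval_fac (fls_X :: int fls) (fac2 (- int n)) = const3 fls_X ^ n * eval_fac fls_X_inv (fac2 (int n))"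
    "eval_fac (fls_X :: int fls) (fac3 (- int n)) = const3 fls_X ^ n * eval_fac fls_X_inv (fac3 (int n))" for n
    by (simp_all add: eval_fac_def eval_mon_def fac1_def fac2_def fac3_def fps_const_power
        right_diff_distrib mult.left_commute[of "const3 _"] X mult.commute[of "fls_X_inv ^ _"])
  show ?thesis
    using e[of 1] e[of 2] e[of 3] e[of 4]
    by (simp add: neg_facs_def pos_facs_def mult_ac flip: power_Suc power_Suc2 power_add)
qed

lemma eval3_0_cov4: "eval3 (0::int) cov4 = P"
proof -
  have "eval4 z1 z2 z3 0 cov4 = P"
    unfolding P_def by (simp add: eval4_def cov4_def) (simp add: algebra_simps power_numeral_reduce)
  then show ?thesis by (simp add: z1_def z2_def z3_def)
qed

lemma gen3_invariants:
  assumes "\<And>a b c. ch a b c * weyl_alt 0 0 0 = weyl_alt a b c"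
  shows "gen3 (\<lambda>a b c. fls_nth (ch a b c) 0 - fls_nth (ch a b c) 2) * U = P"
proof -
  let ?Q = "const3 fls_X :: int fls fps fps fps"
  let ?pos = "\<lambda>q. eval_facs q pos_facs" and ?neg = "eval_facs (fls_X :: int fls) neg_facs"
  let ?x = "[:0, 1:] :: int poly"
  obtain k where k: "1 = ?pos ?x * k" using pos_facs_unit[of ?x] by (elim dvdE)
  \<comment> \<open>\<open>U\<close> times the generating function of the multiplicities, with
    polynomials in \<open>q\<close> as coefficients, so that \<open>q\<close>, \<open>1/q\<close>
    and 0 can all be substituted.\<close>
  define G where "G = k * eval3 ?x cov4"
  have G: "?pos ?x * G = eval3 ?x cov4"
    by (simp add: G_def mult.assoc[symmetric] flip: k)
  have h: "?pos (h ?x) * map3 h G = eval3 (h ?x) cov4" if "is_ring_hom h" for h :: "int poly \<Rightarrow> 'r::comm_ring_1"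
    using arg_cong[OF G, of "map3 h"]
    by (simp only: map3_prod_eval_fac[OF that] map3_eval3[OF that] is_ring_homD[OF is_ring_hom_map3[OF that]])
  define G1 where "G1 = map3 (poly_at fls_X) G"
  define G2 where "G2 = map3 (poly_at fls_X_inv) G"
  have G1: "?pos fls_X * G1 = eval3 fls_X cov4"
    using h[OF is_ring_hom_poly_at[of fls_X]] by (simp add: G1_def)
  have G2: "?pos fls_X_inv * G2 = eval3 fls_X_inv cov4"
    using h[OF is_ring_hom_poly_at[of fls_X_inv]] by (simp add: G2_def)
  have Q0: "?Q \<noteq> 0" by simp
  have "?Q * const3 fls_X_inv = 1" by (simp add: fls_X_times_conv_shift)
  from eval4_reverse4[OF this short4_cov4]
  have rev: "?Q * eval3 fls_X (reverse4 13 cov4) = ?Q ^ 13 * eval3 fls_X_inv cov4" .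
  have pn0: "?pos fls_X * ?neg \<noteq> 0"
  proof -
    have "?pos (fls_X :: int fls) \<noteq> 0" "?pos (fls_X_inv :: int fls) \<noteq> 0"
      using pos_facs_unit[of "fls_X :: int fls"] pos_facs_unit[of "fls_X_inv :: int fls"] by auto
    then show ?thesis unfolding neg_facs_eq using Q0 by (simp del: fps_const_power)
  qed
  have "(?pos fls_X * ?neg) * (map3 of_int U * ((?Q ^ 2 - 1) * gen3 ch)) =
      (?Q ^ 2 - 1) * (eval_facs fls_X U_facs) * ((eval_facs fls_X all_facs) * gen3 ch)"
    unfolding map3_U all_facs_split by (simp only: mult_ac)
  also have "\<dots> = ?Q ^ 2 * (?Q ^ 8 * (?Q ^ 2 - 1) * ((eval_facs fls_X U_facs) * eval3 fls_X num4))"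
  proof -
    have "?Q ^ 10 = ?Q ^ 2 * ?Q ^ 8" by (simp only: power_add[symmetric]) simp
    then show ?thesis
      unfolding gen3_character[OF assms] by (simp only: mult_ac)
  qed
  also have "\<dots> = ?Q ^ 2 * (?neg * eval3 fls_X cov4) - ?Q * ?pos fls_X * (?Q * eval3 fls_X (reverse4 13 cov4))"
    unfolding eval3_cov4_identity by (simp only: right_diff_distrib power2_eq_square mult_ac)
  also have "\<dots> = ?Q ^ 2 * (?neg * (?pos fls_X * G1)) -
      ?Q * ?pos fls_X * (?Q ^ 13 * (?pos fls_X_inv * G2))"
    unfolding rev G1 G2 ..
  also have "?Q * ?pos fls_X * (?Q ^ 13 * (?pos fls_X_inv * G2)) =
      ?pos fls_X * ((?Q * ?Q ^ 13) * ?pos fls_X_inv) * G2"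
    by (simp only: mult_ac)
  also have "?Q * ?Q ^ 13 = ?Q ^ 14" by (simp only: power_Suc[symmetric]) simp
  also have "?Q ^ 2 * (?neg * (?pos fls_X * G1)) - ?pos fls_X * (?Q ^ 14 * ?pos fls_X_inv) * G2 =
      (?pos fls_X * ?neg) * (?Q ^ 2 * G1 - G2)"
    unfolding neg_facs_eq[symmetric] right_diff_distrib by (simp only: mult_ac)
  finally have main: "map3 of_int U * ((?Q ^ 2 - 1) * gen3 ch) = ?Q ^ 2 * G1 - G2"
    by (simp only: mult_left_cancel[OF pn0])
  \<comment> \<open>The coefficient of \<open>q^2\<close>. On the left it is the difference of the
    multiplicities of the weights 0 and 2. On the right \<open>q^2 G(q)\<close> contributes
    \<open>G(0)\<close>, and \<open>G(1/q)\<close> has no positive powers.\<close>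
  define L :: "int fls \<Rightarrow> int" where "L = (\<lambda>f. fls_nth f 2)"
  have Q21: "(?Q ^ 2 - 1) * gen3 ch = gen3 (\<lambda>a b c. (fls_X ^ 2 - 1) * ch a b c)"
    unfolding gen3_const_mult by (simp only: is_ring_homD[OF is_ring_hom_const3])
  have "map3 L (map3 of_int U * gen3 (\<lambda>a b c. (fls_X ^ 2 - 1) * ch a b c)) =
      U * map3 L (gen3 (\<lambda>a b c. (fls_X ^ 2 - 1) * ch a b c))"
    by (rule map3_semilinear) (simp_all add: L_def fls_of_int)
  also have "map3 L (gen3 (\<lambda>a b c. (fls_X ^ 2 - 1) * ch a b c)) =
      gen3 (\<lambda>a b c. fls_nth (ch a b c) 0 - fls_nth (ch a b c) 2)"
    by (simp add: fps_eq_iff gen3_def L_def left_diff_distrib fls_X_power_times_conv_shift)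
  finally have l: "map3 L (map3 of_int U * ((?Q ^ 2 - 1) * gen3 ch)) =
    U * gen3 (\<lambda>a b c. fls_nth (ch a b c) 0 - fls_nth (ch a b c) 2)"
    unfolding Q21 .
  have "map3 L (?Q ^ 2 * G1 - G2) = map3 (\<lambda>p. coeff p 0) G"
    by (simp add: fps_eq_iff G1_def G2_def L_def fps_const_power fls_X_power_times_conv_shift
        poly_at_X_nth_0 poly_at_X_inv_nth)
  also have "\<dots> = ?pos 0 * map3 (\<lambda>p. coeff p 0) G"
  proof -
    have "?pos (0::int) = 1"
      by (simp add: pos_facs_def eval_fac_def eval_mon_def fac1_def fac2_def fac3_def)
    then show ?thesis by simp
  qed
  also have "\<dots> = P"
    using h[OF is_ring_hom_coeff_0] eval3_0_cov4 by simp
  finally show ?thesis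
    using l main by (simp add: mult.commute)
qed

subsection \<open>Irreducible representations of the special linear group of degree four\<close>

lemma munit_mult: "munit i j ** munit k l = (if j = k then munit i l else 0)"
proof -
  have "(munit i j ** munit k l) $ m $ n = (if j = k then munit i l else 0) $ m $ n" for m n
  proof -
    have "munit i j $ m $ p * munit k l $ p $ n =
        (if p = j then (if m = i \<and> j = k \<and> n = l then 1 else 0) else 0)" for p
      by auto
    then have "(munit i j ** munit k l) $ m $ n =
        (\<Sum>p\<in>UNIV. if p = j then (if m = i \<and> j = k \<and> n = l then 1 else 0) else 0)"
      unfolding matrix_matrix_mult_def vec_lambda_beta by (simp only:)
    then show ?thesis by auto
  qed
  then show ?thesis by (simp add: vec_eq_iff)
qed

lemma trace_munit: "trace (munit i j) = (if i = j then 1 else 0)"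
  by (simp add: trace_def if_distrib sum.If_cases)

lemma mult_munit_mult_nth: "(A ** munit i j ** B) $ k $ l = A $ k $ i * B $ j $ l"
proof -
  have "(A ** munit i j) $ k $ m = (if m = j then A $ k $ i else 0)" for m
  proof -
    have "(A ** munit i j) $ k $ m = (\<Sum>p\<in>UNIV. if p = i then (if m = j then A $ k $ i else 0) else 0)"
      unfolding matrix_matrix_mult_def by (auto simp: if_one_mult intro!: sum.cong)
    then show ?thesis by simp
  qed
  then have "(A ** munit i j) $ k $ m * B $ m $ l = (if m = j then A $ k $ i * B $ j $ l else 0)" for m
    by simp
  then have "(A ** munit i j ** B) $ k $ l = (\<Sum>m\<in>UNIV. if m = j then A $ k $ i * B $ j $ l else 0)"
    unfolding matrix_matrix_mult_def[of "A ** munit i j" B] vec_lambda_beta by (simp only:)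
  then show ?thesis by simp
qed

text \<open>A representative of a transposition; the opposite signs make the determinant 1, and
  \<open>- s\<close> gives the inverse.\<close>

definition signed_swap :: "'n::finite \<Rightarrow> 'n \<Rightarrow> complex \<Rightarrow> complex^'n^'n" where
  "signed_swap p q s = elem p q s ** (elem q p (- s) ** elem p q s)"

lemma signed_swap:
  assumes "p \<noteq> q"
  shows "signed_swap p q s \<in> SL" "signed_swap p q s ** signed_swap p q (- s) = mat 1"
proof -
  show "signed_swap p q s \<in> SL"
    unfolding signed_swap_def using assms by (intro SL_mult elem_in_SL) auto
  have "elem p q s ** (elem q p (- s) ** (elem p q s ** (elem p q (- s) ** (elem q p s ** elem p q (- s))))) = mat 1"
    using assms elem_mult_elem[of p q] elem_mult_elem[of q p]
    by (metis (no_types, lifting) add.right_inverse elem_0 matrix_mul_assoc matrix_mul_lid matrix_mul_rid minus_minus)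
  then show "signed_swap p q s ** signed_swap p q (- s) = mat 1"
    by (simp add: signed_swap_def matrix_mul_assoc)
qed

lemma signed_swap_nth:
  assumes "p \<noteq> q" "s * s = 1"
  shows "signed_swap p q s $ k $ l = (if k = p then (if l = q then s else 0) else if k = q then (if l = p then - s else 0)
    else if k = l then 1 else 0)"
  using assms by (auto simp: signed_swap_def elem_mult_nth) (auto simp: elem_def)

lemma signed_swap_conj:
  assumes "p \<noteq> q"
  shows "signed_swap p q 1 ** munit i i ** signed_swap p q (- 1) =
    munit (Transposition.transpose p q i) (Transposition.transpose p q i)"
  using assms
  by (auto simp: vec_eq_iff mult_munit_mult_nth signed_swap_nth Transposition.transpose_def)

text \<open>The indices 1, 2, 3, 4 are handled as natural numbers since the order of the index type differs
  from their listing.\<close>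

definition ix :: "nat \<Rightarrow> 4" where "ix k = of_nat k"

lemma ix_simps: "ix 1 = 1" "ix (Suc 0) = 1" "ix 2 = 2" "ix 3 = 3" "ix 4 = 4"
  by (simp_all add: ix_def)

lemma ix_eq_iff: "i \<in> I4 \<Longrightarrow> j \<in> I4 \<Longrightarrow> ix i = ix j \<longleftrightarrow> i = j"
  by (auto simp: I4_def ix_simps)

lemma ex_ix: "\<exists>k\<in>I4. ix k = x"
  using exhaust_4[of x] by (auto simp: I4_def ix_simps)

lemma ix_transpose:
  "i \<in> I4 \<Longrightarrow> k \<in> I4 \<Longrightarrow> l \<in> I4 \<Longrightarrow> ix (Transposition.transpose k l i) = Transposition.transpose (ix k) (ix l) (ix i)"
  by (auto simp: Transposition.transpose_def ix_eq_iff)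

lemma vector_4 [simp]:
  "(vector [x, y, z, w] :: 'a::zero^4) $ 1 = x" "(vector [x, y, z, w] :: 'a::zero^4) $ 2 = y"
  "(vector [x, y, z, w] :: 'a::zero^4) $ 3 = z" "(vector [x, y, z, w] :: 'a::zero^4) $ 4 = w"
  unfolding vector_def by simp_all

lemma vec4_eq_iff:
  fixes A B :: "complex^4^4"
  shows "A = B \<longleftrightarrow> A $ 1 = B $ 1 \<and> A $ 2 = B $ 2 \<and> A $ 3 = B $ 3 \<and> A $ 4 = B $ 4"
  by (simp add: vec_eq_iff[of A B] forall_4)

locale irrep_SL4 = SL_rep smul V \<rho>
  for smul :: "complex \<Rightarrow> 'v::ab_group_add \<Rightarrow> 'v" and V and \<rho> :: "complex^4^4 \<Rightarrow> 'v \<Rightarrow> 'v" +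
  fixes a b c :: nat and v0 :: 'v
  assumes irr: "irreducible_rep"
    and v0: "v0 \<in> V" "v0 \<noteq> 0"
    and v0_unipotent: "\<rho> (unitriangular4 p q r s t u) v0 = v0"
    and v0_torus: "t1 * t2 * t3 * t4 = 1 \<Longrightarrow> \<rho> (diagonal4 t1 t2 t3 t4) v0 = smul (weight4 a b c t1 t2 t3) v0"
begin

text \<open>A quarter of the size of the partition \<open>(a + b + c, b + c, c, 0)\<close>, that is,
  the scalar by which each diagonal operator has to be shifted.\<close>

definition lev :: complex where "lev = (of_nat a + 2 * of_nat b + 3 * of_nat c) / 4"

text \<open>The matrix unit made traceless, so that \<open>lie\<close> is determined on it.\<close>

definition ux :: "nat \<Rightarrow> nat \<Rightarrow> complex^4^4" where
  "ux i j = munit (ix i) (ix j) - (if ix i = ix j then mscale (1 / 4) (mat 1) else 0)"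

text \<open>The derived representation extended to \<open>gl\<^sub>4\<close>, where scalar matrices act in such a way that
  the highest weight becomes the partition \<open>(a + b + c, b + c, c, 0)\<close>.\<close>

definition e :: "nat \<Rightarrow> nat \<Rightarrow> 'v \<Rightarrow> 'v" where
  "e i j v = lie (ux i j) v + (if ix i = ix j then smul lev v else 0)"

definition hw :: "nat \<Rightarrow> int" where
  "hw k = (if k = 1 then int (a + b + c) else if k = 2 then int (b + c) else if k = 3 then int c else 0)"

lemma trace_ux: "trace (ux i j) = 0"
proof -
  have "trace (mscale (1 / 4) (mat 1 :: complex^4^4)) = 1"
    by (simp add: trace_def sum_4 mat_def)
  then show ?thesis by (simp add: ux_def trace_sub trace_munit trace_0[unfolded mat_0])
qed

lemma e_offdiag: "i \<in> I4 \<Longrightarrow> j \<in> I4 \<Longrightarrow> i \<noteq> j \<Longrightarrow> e i j v = lie (munit (ix i) (ix j)) v"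
  by (simp add: e_def ux_def ix_eq_iff)

lemma e_diag_diff:
  assumes "v \<in> V"
  shows "e i i v - e j j v = lie (munit (ix i) (ix i) - munit (ix j) (ix j)) v"
proof -
  have "e i i v - e j j v = lie (ux i i - ux j j) v"
    using assms trace_ux by (simp add: e_def lie_diff_left)
  then show ?thesis by (simp add: ux_def)
qed

lemma bracket_e:
  assumes "v \<in> V" "i \<in> I4" "j \<in> I4" "k \<in> I4" "l \<in> I4" "i \<noteq> j"
  shows "e i j (e k l v) = e k l (e i j v) + (if j = k then e i l v else 0) - (if l = i then e k j v else 0)"
proof -
  let ?E = "munit (ix i) (ix j)"
  have ij: "ix i \<noteq> ix j" using assms by (simp add: ix_eq_iff)
  have tE: "trace ?E = 0" using ij by (simp add: trace_munit)
  \<comment> \<open>The scalar correction in \<open>ux\<close> is central and drops out of the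
    commutator.\<close>
  have comm: "?E ** ux k l - ux k l ** ?E =
      (if j = k then munit (ix i) (ix l) else 0) - (if l = i then munit (ix k) (ix j) else 0)"
  proof -
    have "?E ** ux k l - ux k l ** ?E = ?E ** munit (ix k) (ix l) - munit (ix k) (ix l) ** ?E"
      by (simp add: ux_def matrix_diff_distrib mscale_mult)
    then show ?thesis using assms by (simp add: munit_mult ix_eq_iff)
  qed
  have "lie ?E (e k l v) = lie ?E (lie (ux k l) v) + (if ix k = ix l then smul lev (lie ?E v) else 0)"
    using assms(1) tE by (simp add: e_def lie_linear_right lie_0_right lie_in_V V_closed)
  also have "lie ?E (lie (ux k l) v) = lie (ux k l) (lie ?E v) + lie (?E ** ux k l - ux k l ** ?E) v"
    by (rule lie_bracket[OF ij trace_ux assms(1)])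
  finally have "e i j (e k l v) = e k l (e i j v) + lie (?E ** ux k l - ux k l ** ?E) v"
    using assms by (simp add: e_offdiag) (simp add: e_def)
  also have "lie (?E ** ux k l - ux k l ** ?E) v = (if j = k then e i l v else 0) - (if l = i then e k j v else 0)"
  proof (cases "j = k \<and> l = i")
    case True
    then show ?thesis unfolding comm using e_diag_diff[OF assms(1)] by simp
  next
    case False
    have neg: "lie (- X) v = - lie X v" if "trace X = 0" for X
      using lie_diff_left[OF assms(1) _ that, of 0] lie_0[OF assms(1)] by (simp add: trace_0[unfolded mat_0])
    show ?thesis
      unfolding comm using False assms
      by (auto simp: e_offdiag lie_0 neg trace_munit ix_eq_iff)
  qed
  finally show ?thesis by simp
qed

lemma v0_simple:
  "lie (munit 1 1 - munit 2 2) v0 = smul (of_nat a) v0"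
  "lie (munit 2 2 - munit 3 3) v0 = smul (of_nat b) v0"
  "lie (munit 3 3 - munit 4 4) v0 = smul (of_nat c) v0"
proof -
  have d: "diag2 1 2 t = diagonal4 (exp t) (exp (- t)) 1 1" "diag2 2 3 t = diagonal4 1 (exp t) (exp (- t)) 1"
    "diag2 3 4 t = diagonal4 1 1 (exp t) (exp (- t))" for t
    by (simp_all add: vec4_eq_iff diag2_def diagonal4_def vec_eq_iff forall_4)
  have w: "((\<lambda>t. exp t ^ n) has_field_derivative of_nat n) (at (0::complex))" for n
    by (auto intro!: derivative_eq_intros)
  show "lie (munit 1 1 - munit 2 2) v0 = smul (of_nat a) v0"
    by (rule lie_eq_smul[OF tangent_diag2 v0(1) _ w]) (simp_all add: d v0_torus weight4_def exp_minus)
  show "lie (munit 2 2 - munit 3 3) v0 = smul (of_nat b) v0"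
    by (rule lie_eq_smul[OF tangent_diag2 v0(1) _ w]) (simp_all add: d v0_torus weight4_def exp_minus)
  show "lie (munit 3 3 - munit 4 4) v0 = smul (of_nat c) v0"
    by (rule lie_eq_smul[OF tangent_diag2 v0(1) _ w]) (simp_all add: d v0_torus weight4_def exp_minus)
qed

lemma v0_weight:
  assumes "i \<in> I4"
  shows "e i i v0 = smul (of_int (hw i)) v0"
proof -
  define h12 h23 h34 :: "complex^4^4" where
    "h12 = munit 1 1 - munit 2 2" "h23 = munit 2 2 - munit 3 3" "h34 = munit 3 3 - munit 4 4"
  have tr: "trace h12 = 0" "trace h23 = 0" "trace h34 = 0"
    by (simp_all add: h12_h23_h34_def trace_sub trace_munit)
  have comb: "lie (mscale x h12 + mscale y h23 + mscale z h34) v0 =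
      smul (x * of_nat a + y * of_nat b + z * of_nat c) v0" for x y z
    using v0_simple v0(1) tr
    by (simp add: lie_linear_left trace_mscale trace_add scale_left_distrib flip: h12_h23_h34_def)
  \<comment> \<open>The traceless diagonal units are expressed in the simple coroots, whose
    eigenvalues on \<open>v0\<close> are \<open>a\<close>, \<open>b\<close>,
    \<open>c\<close>.\<close>
  have u: "ux 1 1 = mscale (3 / 4) h12 + mscale (1 / 2) h23 + mscale (1 / 4) h34"
    "ux 2 2 = mscale (- 1 / 4) h12 + mscale (1 / 2) h23 + mscale (1 / 4) h34"
    "ux 3 3 = mscale (- 1 / 4) h12 + mscale (- 1 / 2) h23 + mscale (1 / 4) h34"
    "ux 4 4 = mscale (- 1 / 4) h12 + mscale (- 1 / 2) h23 + mscale (- 3 / 4) h34"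
    by (simp_all add: ux_def ix_simps h12_h23_h34_def vec_eq_iff forall_4 mat_def)
  have w: "e j j v0 = smul (x * of_nat a + y * of_nat b + z * of_nat c + lev) v0"
    if "ux j j = mscale x h12 + mscale y h23 + mscale z h34" for j x y z
    unfolding e_def that comb by (simp add: scale_left_distrib)
  have "e 1 1 v0 = smul (of_int (hw 1)) v0"
    unfolding w[OF u(1)] by (rule arg_cong[of _ _ "\<lambda>k. smul k v0"]) (simp add: hw_def lev_def field_simps)
  moreover have "e 2 2 v0 = smul (of_int (hw 2)) v0"
    unfolding w[OF u(2)] by (rule arg_cong[of _ _ "\<lambda>k. smul k v0"]) (simp add: hw_def lev_def field_simps)
  moreover have "e 3 3 v0 = smul (of_int (hw 3)) v0"
    unfolding w[OF u(3)] by (rule arg_cong[of _ _ "\<lambda>k. smul k v0"]) (simp add: hw_def lev_def field_simps)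
  moreover have "e 4 4 v0 = smul (of_int (hw 4)) v0"
    unfolding w[OF u(4)] by (rule arg_cong[of _ _ "\<lambda>k. smul k v0"]) (simp add: hw_def lev_def field_simps)
  ultimately show ?thesis using assms by (auto simp: I4_def)
qed

lemma v0_pos:
  assumes "i \<in> I4" "j \<in> I4" "i < j"
  shows "e i j v0 = 0"
proof -
  have "elem 1 2 t = unitriangular4 t 0 0 0 0 0" "elem 1 3 t = unitriangular4 0 t 0 0 0 0"
    "elem 1 4 t = unitriangular4 0 0 t 0 0 0" "elem 2 3 t = unitriangular4 0 0 0 t 0 0"
    "elem 2 4 t = unitriangular4 0 0 0 0 t 0" "elem 3 4 t = unitriangular4 0 0 0 0 0 t" for t
    by (simp_all add: elem_def unitriangular4_def vec_eq_iff forall_4)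
  then have "\<rho> (elem (ix i) (ix j) t) v0 = v0" for t
    using assms by (auto simp: I4_def ix_simps v0_unipotent)
  then show ?thesis
    using assms v0(1) lie_eq_0[OF tangent_elem, of "ix i" "ix j" v0]
    by (simp add: e_offdiag ix_eq_iff)
qed

sublocale gl4: gl4_module smul V e v0 hw
proof unfold_locales
  fix W assume W: "subspace W" "W \<subseteq> V" "W \<noteq> {0}"
    and stable: "\<And>i j w. i \<in> I4 \<Longrightarrow> j \<in> I4 \<Longrightarrow> i \<noteq> j \<Longrightarrow> w \<in> W \<Longrightarrow> e i j w \<in> W"
  show "W = V"
  proof (rule irreducible_lie_stable[OF irr W])
    fix i j :: 4 and w assume ij: "i \<noteq> j" "w \<in> W"
    obtain k l where "k \<in> I4" "l \<in> I4" "ix k = i" "ix l = j" using ex_ix by metis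
    then show "lie (munit i j) w \<in> W" using stable[of k l w] ij by (auto simp: e_offdiag)
  qed
next
  fix k :: nat assume "k \<in> {1, 2, 3}"
  then have k: "k \<in> I4" "Suc k \<in> I4" by (auto simp: I4_def)
  then have pq: "ix k \<noteq> ix (Suc k)" by (simp add: ix_eq_iff)
  let ?n = "signed_swap (ix k) (ix (Suc k)) 1" and ?m = "signed_swap (ix k) (ix (Suc k)) (- 1)"
  note SL = signed_swap(1)[OF pq]
  have nm: "?n ** ?m = mat 1" "?m ** ?n = mat 1"
    using signed_swap(2)[OF pq, of 1] signed_swap(2)[OF pq, of "- 1"] by simp_all
  have inj: "v = 0" if "v \<in> V" "\<rho> ?n v = 0" for v
  proof -
    have "v = \<rho> ?m (\<rho> ?n v)" using that(1) SL nm by (simp add: rep_one flip: rep_mult)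
    also have "\<dots> = 0" using that(2) rep_smul[OF SL V_closed(1), of "- 1" 0] by simp
    finally show ?thesis .
  qed
  have "\<rho> ?n (e i i v) = e (Transposition.transpose k (Suc k) i) (Transposition.transpose k (Suc k) i) (\<rho> ?n v)"
    if "i \<in> I4" "v \<in> V" for i v
  proof -
    have "?n ** ux i i ** ?m = ux (Transposition.transpose k (Suc k) i) (Transposition.transpose k (Suc k) i)"
      using that(1) k
      by (simp add: ux_def matrix_diff_distrib mscale_mult signed_swap_conj[OF pq] ix_transpose nm)
    moreover have "\<rho> ?n (e i i v) = lie (?n ** ux i i ** ?m) (\<rho> ?n v) + smul lev (\<rho> ?n v)"
      using that(2) SL by (simp add: e_def rep_add rep_smul lie_in_V V_closed lie_Ad[OF that(2) trace_ux SL SL nm])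
    ultimately show ?thesis by (simp add: e_def)
  qed
  then show "\<exists>s. weyl_reflection smul V e k s"
    unfolding weyl_reflection_def
    by (intro exI[of _ "\<rho> ?n"]) (use SL inj in \<open>auto simp: rep_closed rep_add rep_smul\<close>)
next
  fix v i j assume "v \<in> V"
  then show "e i j v \<in> V" by (simp add: e_def lie_in_V V_closed)
next
  fix v w i j assume "v \<in> V" "w \<in> V"
  then show "e i j (v + w) = e i j v + e i j w"
    by (simp add: e_def lie_linear_right trace_ux scale_right_distrib)
next
  fix v i j k assume "v \<in> V"
  then show "e i j (smul k v) = smul k (e i j v)"
    by (simp add: e_def lie_linear_right[where w = 0] V_closed trace_ux scale_right_distrib mult.commute)
qed (use subspace_V finite_dim v0 v0_weight v0_pos bracket_e in auto)

end

subsection \<open>Restriction along the third symmetric power\<close>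

lemma sym_cube_eq:
  "sym_cube A = (let p = A $ 1 $ 1; q = A $ 1 $ 2; r = A $ 2 $ 1; s = A $ 2 $ 2 in vector [
     vector [p ^ 3, p ^ 2 * q, p * q ^ 2, q ^ 3],
     vector [3 * p ^ 2 * r, p ^ 2 * s + 2 * p * r * q, 2 * p * q * s + r * q ^ 2, 3 * q ^ 2 * s],
     vector [3 * p * r ^ 2, 2 * p * r * s + r ^ 2 * q, p * s ^ 2 + 2 * r * q * s, 3 * q * s ^ 2],
     vector [r ^ 3, r ^ 2 * s, r * s ^ 2, s ^ 3]])"
  by (simp add: sym_cube_def Let_def transpose_def vec_eq_iff forall_4 power2_eq_square power3_eq_cube
      numeral_2_eq_2 numeral_3_eq_3 algebra_simps)

lemma sym_cube_mult: "sym_cube (A ** B) = sym_cube A ** sym_cube B"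
  unfolding sym_cube_eq Let_def matrix_matrix_mult_def
  by (simp add: vec_eq_iff forall_4 sum_4 sum_2) (intro conjI; algebra)

lemma sym_cube_one: "sym_cube (mat 1) = mat 1"
  by (simp add: sym_cube_eq Let_def mat_def vec_eq_iff forall_4)

lemma sym_cube_upper: "sym_cube (elem 1 2 s) = unitriangular4 s (s ^ 2) (s ^ 3) (2 * s) (3 * s ^ 2) (3 * s)"
  by (simp add: sym_cube_eq Let_def elem_def unitriangular4_def)

lemma sym_cube_lower: "sym_cube (elem 2 1 s) = transpose (unitriangular4 (3 * s) (3 * s ^ 2) (s ^ 3) (2 * s) (s ^ 2) s)"
  by (simp add: sym_cube_eq Let_def elem_def unitriangular4_def transpose_def vec_eq_iff forall_4)

lemma unitriangular4_in_SL: "unitriangular4 p q r s t u \<in> SL"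
proof -
  have "unitriangular4 p q r s t u = elem 3 4 u ** ((elem 2 3 s ** elem 2 4 t) **
      (elem 1 2 p ** (elem 1 3 q ** elem 1 4 r)))"
    by (simp add: vec_eq_iff forall_4 flip: matrix_mul_assoc, simp add: elem_mult_nth)
      (simp add: elem_def unitriangular4_def)
  also have "\<dots> \<in> SL" by (intro SL_mult elem_in_SL) simp_all
  finally show ?thesis .
qed

text \<open>By generation it suffices to consider elementary matrices, whose images are
  unitriangular or transposes of such.\<close>

lemma sym_cube_in_SL: "A \<in> SL \<Longrightarrow> sym_cube A \<in> SL"
proof (induction rule: SL_induct)
  case (step i j s A)
  then have "(i = 1 \<and> j = 2) \<or> (i = 2 \<and> j = 1)"
    using exhaust_2[of i] exhaust_2[of j] by auto
  then have "sym_cube (elem i j s) \<in> SL"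
    using unitriangular4_in_SL by (auto simp: sym_cube_upper sym_cube_lower) (simp add: SL_def)
  then show ?case using step by (simp add: sym_cube_mult SL_mult)
qed (simp add: sym_cube_one one_in_SL)

text \<open>The velocity at 0 of \<open>sym_cube (elem 1 2 s)\<close>; the coefficients 1, 2, 3 are
  those of the linear terms in \<open>sym_cube_upper\<close>. \<open>f_sym\<close> belongs to
  \<open>elem 2 1 s\<close>.\<close>

definition e_sym :: "complex^4^4" where
  "e_sym = munit 1 2 + mscale 2 (munit 2 3) + mscale 3 (munit 3 4)"

definition f_sym :: "complex^4^4" where
  "f_sym = mscale 3 (munit 2 1) + mscale 2 (munit 3 2) + munit 4 3"

lemma tangent_sym_cube:
  "tangent (\<lambda>s. sym_cube (elem 1 2 s)) e_sym" "tangent (\<lambda>s. sym_cube (elem 2 1 s)) f_sym"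
proof -
  have "sym_cube (elem 1 2 s) \<in> SL" "sym_cube (elem 2 1 s) \<in> SL" for s
    by (rule sym_cube_in_SL, rule elem_in_SL, simp)+
  moreover have "\<forall>i j. ((\<lambda>s. sym_cube (elem 1 2 s) $ i $ j) has_field_derivative e_sym $ i $ j) (at 0)"
    "\<forall>i j. ((\<lambda>s. sym_cube (elem 2 1 s) $ i $ j) has_field_derivative f_sym $ i $ j) (at 0)"
    unfolding forall_4 sym_cube_upper sym_cube_lower unitriangular4_def transpose_def
    by (simp_all add: e_sym_def f_sym_def) (auto intro!: derivative_eq_intros)
  ultimately show "tangent (\<lambda>s. sym_cube (elem 1 2 s)) e_sym" "tangent (\<lambda>s. sym_cube (elem 2 1 s)) f_sym"
    unfolding tangent_def by (simp_all add: elem_0 sym_cube_one)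
qed

context irrep_SL4
begin

definition sE :: "'v \<Rightarrow> 'v" where "sE v = e 1 2 v + smul 2 (e 2 3 v) + smul 3 (e 3 4 v)"
definition sF :: "'v \<Rightarrow> 'v" where "sF v = smul 3 (e 2 1 v) + smul 2 (e 3 2 v) + e 4 3 v"
definition sH :: "'v \<Rightarrow> 'v" where "sH v = smul 3 (e 1 1 v) + e 2 2 v - e 3 3 v - smul 3 (e 4 4 v)"
definition hb :: "'v \<Rightarrow> int" where
  "hb x = 3 * gl4.wt x 1 + gl4.wt x 2 - gl4.wt x 3 - 3 * gl4.wt x 4"

lemma I4: "1 \<in> I4" "Suc 0 \<in> I4" "2 \<in> I4" "3 \<in> I4" "4 \<in> I4"
  by (simp_all add: I4_def)

lemma lie_sym:
  assumes "v \<in> V"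
  shows "lie e_sym v = sE v" "lie f_sym v = sF v"
proof -
  have tr: "trace (munit i j) = 0" "trace (mscale k (munit i j)) = 0" if "i \<noteq> j" for k and i j :: 4
    using that by (simp_all add: trace_mscale trace_munit)
  show "lie e_sym v = sE v"
    unfolding e_sym_def sE_def using assms
    by (simp add: lie_linear_left(1) lie_mscale tr trace_add e_offdiag I4 ix_simps del: One_nat_def)
  show "lie f_sym v = sF v"
    unfolding f_sym_def sF_def using assms
    by (simp add: lie_linear_left(1) lie_mscale tr trace_add e_offdiag I4 ix_simps del: One_nat_def)
qed

sublocale sl2: sl2_weight_module smul V sE sF sH gl4.B hb
proof unfold_locales
  note lin = gl4.e_in_V gl4.e_add gl4.e_smul gl4.e_diff gl4.V_closed
  note sc = scale_right_distrib scale_right_diff_distrib scale_left_distrib scale_left_diff_distrib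
  show "finite gl4.B" "independent gl4.B" "span gl4.B = V" by (rule gl4.B)+
  fix v assume v: "v \<in> V"
  show "sE v \<in> V" "sF v \<in> V" using v by (simp_all add: sE_def sF_def lin)
  show "sE (smul k v) = smul k (sE v)" "sF (smul k v) = smul k (sF v)" "sH (smul k v) = smul k (sH v)" for k
    using v by (simp_all add: sE_def sF_def sH_def lin sc mult.commute)
  show "sE (v + w) = sE v + sE w" "sF (v + w) = sF v + sF w" "sH (v + w) = sH v + sH w" if "w \<in> V" for w
    using v that by (simp_all add: sE_def sF_def sH_def lin sc)
  have ef: "e i (Suc i) (e (Suc j) j v) = e (Suc j) j (e i (Suc i) v) +
      (if i = j then e i i v - e (Suc i) (Suc i) v else 0)" if "i \<in> {1, 2, 3}" "j \<in> {1, 2, 3}" for i j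
    using bracket_e[OF v, of i "Suc i" "Suc j" j] gl4.Suc_in_I4[of i] gl4.Suc_in_I4[of j] that by auto
  \<comment> \<open>Small multiples are written as repeated sums, so that the remaining identities
    hold in any abelian group.\<close>
  have n: "smul 2 x = x + x" "smul 3 x = x + x + x" "smul 4 x = x + x + x + x"
    "smul 6 x = x + x + x + x + x + x" "smul 9 x = x + x + x + x + x + x + x + x + x" for x
    using scale_left_distrib[of 1 1 x] scale_left_distrib[of 2 1 x] scale_left_distrib[of 3 1 x]
      scale_left_distrib[of 3 3 x] scale_left_distrib[of 6 3 x] by (simp_all add: add.assoc)
  \<comment> \<open>The coefficients of the simple coroots are \<open>1 * 3\<close>,
    \<open>2 * 2\<close>, \<open>3 * 1\<close>, and these sum up to the diagonal
    \<open>(3, 1, -1, -3)\<close>.\<close>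
  show "sE (sF v) = sF (sE v) + sH v"
    using ef[of 1 1] ef[of 1 2] ef[of 1 3] ef[of 2 1] ef[of 2 2] ef[of 2 3] ef[of 3 1] ef[of 3 2] ef[of 3 3] v
    by (simp add: sE_def sF_def sH_def lin sc numeral_eq_Suc)
      (simp add: n algebra_simps)
  have he: "e k k (e i j v) = e i j (e k k v) - (if j = k then e i k v else 0) + (if k = i then e k j v else 0)"
    if "i \<in> I4" "j \<in> I4" "k \<in> I4" "i \<noteq> j" for i j k
    using bracket_e[OF v, of i j k k] that by simp
  show "sH (sE v) = sE (sH v) + smul 2 (sE v)" "sH (sF v) = sF (sH v) - smul 2 (sF v)"
    using v by (simp_all add: sE_def sF_def sH_def lin sc he I4 del: One_nat_def)
      (simp_all add: n algebra_simps)
next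
  fix b assume b: "b \<in> gl4.B"
  then show "sH b = smul (of_int (hb b)) b"
    by (simp add: sH_def hb_def gl4.wt_e I4 scale_left_distrib scale_left_diff_distrib del: One_nat_def)
qed

text \<open>One direction differentiates along the two unipotent subgroups. The other integrates
  along them and uses that they generate the group.\<close>

lemma sym_cube_invariants:
  "{v \<in> V. \<forall>A\<in>SL. \<rho> (sym_cube A) v = v} = {v \<in> V. sE v = 0 \<and> sF v = 0}"
proof (intro Collect_cong conj_cong refl iffI ballI)
  fix v assume v: "v \<in> V"
  {
    assume inv: "\<forall>A\<in>SL. \<rho> (sym_cube A) v = v"
    have "lie e_sym v = 0" "lie f_sym v = 0"
      by (rule lie_eq_0[OF tangent_sym_cube(1) v], simp add: inv elem_in_SL,
          rule lie_eq_0[OF tangent_sym_cube(2) v], simp add: inv elem_in_SL)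
    then show "sE v = 0 \<and> sF v = 0" using lie_sym[OF v] by simp
  next
    assume EF: "sE v = 0 \<and> sF v = 0"
    have hom: "sym_cube (elem i j (s + t)) = sym_cube (elem i j s) ** sym_cube (elem i j t)"
      if "i \<noteq> j" for i j s t
      using that by (simp add: elem_mult_elem flip: sym_cube_mult)
    have fixed: "\<rho> (sym_cube (elem 1 2 s)) v = v" "\<rho> (sym_cube (elem 2 1 s)) v = v" for s
      using fixed_if_lie_eq_0[OF tangent_sym_cube(1) hom v] fixed_if_lie_eq_0[OF tangent_sym_cube(2) hom v]
        EF lie_sym[OF v] by simp_all
    fix A :: "complex^2^2" assume "A \<in> SL"
    then show "\<rho> (sym_cube A) v = v"
    proof (induction rule: SL_induct)
      case (step i j s A)
      then have "(i = 1 \<and> j = 2) \<or> (i = 2 \<and> j = 1)"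
        using exhaust_2[of i] exhaust_2[of j] by auto
      then have "\<rho> (sym_cube (elem i j s)) v = v" using fixed by auto
      then show ?case
        using step v by (simp add: sym_cube_mult rep_mult sym_cube_in_SL elem_in_SL)
    qed (simp add: sym_cube_one rep_one v)
  }
qed

text \<open>After rescaling, the intertwiner \<open>Q\<close> lies in \<open>SL\<close> and
  therefore acts on \<open>V\<close>, carrying the invariants of one subgroup onto those of its
  conjugate.\<close>

lemma dim_invariants_conj:
  assumes "sym_cube_embedding \<iota>"
  shows "dim (invariants (\<iota> ` SL)) = dim {v \<in> V. \<forall>A\<in>SL. \<rho> (sym_cube A) v = v}"
proof -
  obtain Q where Q: "invertible Q" "\<And>A. A \<in> SL \<Longrightarrow> \<iota> A ** Q = Q ** sym_cube A"
    using assms by (auto simp: sym_cube_embedding_def)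
  \<comment> \<open>A fourth root of the determinant: dividing the 4-by-4 matrix \<open>Q\<close> by
    it gives determinant 1.\<close>
  define d where "d = csqrt (csqrt (det Q))"
  have "d ^ 4 = (d ^ 2) ^ 2" by (simp flip: power_mult)
  then have d4: "d ^ 4 = det Q" by (simp add: d_def)
  have "det Q \<noteq> 0" using Q(1) by (simp add: invertible_det_nz)
  then have d0: "d \<noteq> 0" using d4 by auto
  define g where "g = mat (1 / d) ** Q"
  have scalar: "mat k ** X = X ** mat k" for k and X :: "complex^4^4"
    by (simp add: vec_eq_iff matrix_matrix_mult_def mat_def if_distrib if_distribR mult.commute cong: if_cong)
  have "det (mat (1 / d) :: complex^4^4) = (1 / d) ^ 4"
    by (subst det_diagonal) (simp_all add: mat_def)
  then have g: "g \<in> SL"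
    using d0 by (simp add: SL_def g_def det_mul d4 power_divide flip: d4)
  then obtain h where h: "h \<in> SL" "g ** h = mat 1" "h ** g = mat 1" by (rule SL_inverse)
  have conj: "\<iota> A ** g = g ** sym_cube A" if "A \<in> SL" for A
    using Q(2)[OF that] by (metis g_def scalar matrix_mul_assoc)
  then have \<iota>: "\<iota> A = g ** sym_cube A ** h" if "A \<in> SL" for A
    using that h(2) by (metis matrix_mul_assoc matrix_mul_rid)
  have \<iota>SL: "\<iota> A \<in> SL" if "A \<in> SL" for A
    using that g h by (simp add: \<iota> SL_mult sym_cube_in_SL)
  let ?I = "{v \<in> V. \<forall>A\<in>SL. \<rho> (sym_cube A) v = v}"
  have hg: "\<rho> h (\<rho> g v) = v" "\<rho> g (\<rho> h v) = v" if "v \<in> V" for v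
    using that g h by (simp_all add: rep_one flip: rep_mult)
  have gI: "\<rho> g v \<in> invariants (\<iota> ` SL)" if "v \<in> ?I" for v
  proof -
    have "\<rho> (\<iota> A) (\<rho> g v) = \<rho> g v" if "A \<in> SL" for A
    proof -
      have "\<rho> (\<iota> A) (\<rho> g v) = \<rho> (g ** sym_cube A) v"
        using that \<open>v \<in> ?I\<close> \<iota>SL g by (simp add: conj flip: rep_mult)
      also have "\<dots> = \<rho> g v"
        using that \<open>v \<in> ?I\<close> g by (simp add: rep_mult sym_cube_in_SL)
      finally show ?thesis .
    qed
    then show ?thesis using that g by (auto simp: invariants_def rep_closed)
  qed
  have hI: "\<rho> h v \<in> ?I" if "v \<in> invariants (\<iota> ` SL)" for v
  proof -
    have v: "v \<in> V" "\<And>A. A \<in> SL \<Longrightarrow> \<rho> (\<iota> A) v = v" using that by (auto simp: invariants_def)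
    have "\<rho> (sym_cube A) (\<rho> h v) = \<rho> h v" if "A \<in> SL" for A
    proof -
      have comm: "sym_cube A ** h = h ** \<iota> A"
        using that h(3) by (simp add: \<iota> matrix_mul_assoc)
      have "\<rho> (sym_cube A) (\<rho> h v) = \<rho> (sym_cube A ** h) v"
        using that v h by (simp add: rep_mult sym_cube_in_SL)
      also have "\<dots> = \<rho> h (\<rho> (\<iota> A) v)"
        unfolding comm using that v h \<iota>SL by (simp add: rep_mult)
      finally have "\<rho> (sym_cube A) (\<rho> h v) = \<rho> h (\<rho> (\<iota> A) v)" .
      then show ?thesis using v that by simp
    qed
    then show ?thesis using v h by (simp add: rep_closed)
  qed
  obtain C where C: "C \<subseteq> ?I" "independent C" "?I \<subseteq> span C" "card C = dim ?I"
    by (rule basis_exists)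
  have CV: "C \<subseteq> V" using C(1) by blast
  have finC: "finite C"
    using independent_span_bound[OF basis(1) C(2)] CV basis(3) by simp
  have ker: "v = 0" if "v \<in> span C" "\<rho> g v = 0" for v
  proof -
    have "v \<in> V" using that(1) span_minimal[OF CV subspace_V] by blast
    moreover have "\<rho> h 0 = 0" using rep_smul[OF h(1) V_closed(1), of 0] by simp
    ultimately show ?thesis using hg(1)[of v] that(2) by simp
  qed
  have ind: "independent (\<rho> g ` C)" and card: "card (\<rho> g ` C) = card C"
    by (rule independent_image_subspace[OF subspace_V finC C(2) CV rep_add[OF g] rep_smul[OF g]];
        use ker in blast)+
  have "invariants (\<iota> ` SL) \<subseteq> span (\<rho> g ` C)"
  proof
    fix v assume v: "v \<in> invariants (\<iota> ` SL)"
    have "\<rho> g w \<in> span (\<rho> g ` C)" if "w \<in> span C" for w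
    proof -
      have "w \<in> V \<and> \<rho> g w \<in> span (\<rho> g ` C)"
        using that
      proof (induction rule: span_induct_alt)
        case base
        then show ?case using rep_smul[OF g V_closed(1), of 0] by (simp add: V_closed span_zero)
      next
        case (step k x y)
        then have "x \<in> V" using CV by blast
        moreover have "\<rho> g x \<in> span (\<rho> g ` C)" using step by (intro span_base) blast
        ultimately show ?case
          using step by (simp add: rep_add[OF g] rep_smul[OF g] V_closed span_add span_scale)
      qed
      then show ?thesis ..
    qed
    then have "\<rho> g (\<rho> h v) \<in> span (\<rho> g ` C)" using hI[OF v] C(3) by blast
    then show "v \<in> span (\<rho> g ` C)" using hg(2)[of v] v by (simp add: invariants_def)
  qed
  moreover have "\<rho> g ` C \<subseteq> invariants (\<iota> ` SL)" using gI C(1) by blast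
  ultimately have "dim (invariants (\<iota> ` SL)) = card (\<rho> g ` C)"
    using ind by (intro dim_unique) auto
  then show ?thesis using card C(4) by simp
qed

text \<open>The witness is the character restricted to the torus of the principal subgroup; its
  coefficient at \<open>n\<close> counts the basis vectors of weight \<open>n\<close>.\<close>

lemma ex_character:
  assumes "sym_cube_embedding \<iota>"
  shows "\<exists>ch. ch * weyl_alt 0 0 0 = weyl_alt a b c \<and>
    int (dim (invariants (\<iota> ` SL))) = fls_nth ch 0 - fls_nth ch 2"
proof -
  define ch where "ch = (\<Sum>b\<in>gl4.B. qpow (hb b))"
  let ?f = "\<lambda>x y z w. qpow (3 * x + y - z - 3 * w)"
  have nth: "fls_nth ch n = int (card (sl2.Bn n))" for n
  proof -
    have "fls_nth ch n = (\<Sum>b\<in>gl4.B. if hb b = n then 1 else 0)"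
      unfolding ch_def fls_nth_sum by (intro sum.cong refl) (auto simp: qpow_def)
    also have "\<dots> = int (card (sl2.Bn n))"
      using gl4.B(1) by (simp add: sl2.Bn_def sum.If_cases Int_def)
    finally show ?thesis .
  qed
  have "?f (gl4.wt d 1 + p) (gl4.wt d 2 + q) (gl4.wt d 3 + r) (gl4.wt d 4 + s) = qpow (hb d) * ?f p q r s" for d p q r s
    by (simp add: hb_def algebra_simps flip: qpow_add)
  then have "alt4 (\<lambda>p q r s. ?f (gl4.wt d 1 + p) (gl4.wt d 2 + q) (gl4.wt d 3 + r) (gl4.wt d 4 + s)) 3 2 1 0 =
      qpow (hb d) * alt4 ?f 3 2 1 0" for d
    by (simp add: alt_defs algebra_simps)
  then have "ch * alt4 ?f 3 2 1 0 = alt4 ?f (hw 1 + 3) (hw 2 + 2) (hw 3 + 1) (hw 4)"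
    using gl4.weyl_character[of ?f] by (simp add: hw_def ch_def sum_distrib_right)
  then have "ch * weyl_alt 0 0 0 = weyl_alt a b c"
    by (simp add: weyl_alt_def hw_def)
  moreover have "int (dim (invariants (\<iota> ` SL))) = fls_nth ch 0 - fls_nth ch 2"
    unfolding dim_invariants_conj[OF assms] sym_cube_invariants sl2.dim_invariants nth ..
  ultimately show ?thesis by blast
qed

end

lemma irrep4_character:
  assumes "irrep4 smul V \<rho> a b c" "sym_cube_embedding \<iota>"
  shows "\<exists>ch. ch * weyl_alt 0 0 0 = weyl_alt a b c \<and>
    int (vector_space.dim smul (SL_rep.invariants V \<rho> (\<iota> ` SL))) = fls_nth ch 0 - fls_nth ch 2"
proof -
  interpret SL_rep smul V \<rho> using assms(1) by (simp add: irrep4_def)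
  obtain v0 where "v0 \<in> V" "v0 \<noteq> 0" "\<forall>p q r s t u. \<rho> (unitriangular4 p q r s t u) v0 = v0"
    "\<forall>t1 t2 t3 t4. t1 * t2 * t3 * t4 = 1 \<longrightarrow> \<rho> (diagonal4 t1 t2 t3 t4) v0 = smul (weight4 a b c t1 t2 t3) v0"
    using assms(1) by (auto simp: irrep4_def has_highest_weight_def)
  then interpret irrep_SL4 smul V \<rho> a b c v0
    using assms(1) by unfold_locales (auto simp: irrep4_def)
  show ?thesis by (rule ex_character[OF assms(2)])
qed

theorem theorem4p11:
  fixes smul :: "complex \<Rightarrow> 'v::ab_group_add \<Rightarrow> 'v"
    and V :: "nat \<Rightarrow> nat \<Rightarrow> nat \<Rightarrow> 'v set"
    and \<rho> :: "nat \<Rightarrow> nat \<Rightarrow> nat \<Rightarrow> complex^4^4 \<Rightarrow> 'v \<Rightarrow> 'v"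
    and \<iota> :: "complex^2^2 \<Rightarrow> complex^4^4"
  assumes "\<And>a b c. irrep4 smul (V a b c) (\<rho> a b c) a b c"
    and "sym_cube_embedding \<iota>"
  shows "U dvd 1 \<and> Xi smul V \<rho> (\<iota> ` SL) * U = P"
proof
  show "U dvd 1" by (rule U_unit)
  define ch where "ch a b c = (SOME ch. ch * weyl_alt 0 0 0 = weyl_alt a b c \<and>
    int (vector_space.dim smul (SL_rep.invariants (V a b c) (\<rho> a b c) (\<iota> ` SL))) = fls_nth ch 0 - fls_nth ch 2)"
    for a b c
  have ch: "ch a b c * weyl_alt 0 0 0 = weyl_alt a b c \<and>
      int (vector_space.dim smul (SL_rep.invariants (V a b c) (\<rho> a b c) (\<iota> ` SL))) =
        fls_nth (ch a b c) 0 - fls_nth (ch a b c) 2" for a b c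
    unfolding ch_def by (rule someI_ex[OF irrep4_character[OF assms]])
  have "Xi smul V \<rho> (\<iota> ` SL) = gen3 (\<lambda>a b c. fls_nth (ch a b c) 0 - fls_nth (ch a b c) 2)"
    using ch by (simp add: Xi_def fps3_of_def gen3_def)
  then show "Xi smul V \<rho> (\<iota> ` SL) * U = P"
    using gen3_invariants[of ch] ch by simp
qed

end
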